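(* Let $d\in\mathbb N$ and let $X_N$ ($N\in\mathbb N$) be a $dN\times dN$ block Gaussian matrix with covariance $\sigma:\{1,\dots,d\}^2\times\{1,\dots,d\}^2\to\mathbb R$. For $m,n\ge 1$ let $\alpha_{m,n}=\lim_{N\to\infty}\mathrm{Cov}\big(\mathrm{Tr}(X_N^m),\mathrm{Tr}(X_N^n)\big)$ and let $$G_2(z,w)=\sum_{m\ge1}\sum_{n\ge1}\frac{\alpha_{m,n}}{z^{m+1}w^{n+1}}.$$ Then there exists $K\in\mathbb R_+$ such that for all $z,w\in\mathbb C$ with $|z|,|w|>K$ the double series defining $G_2(z,w)$ converges absolutely and $$G_2(z,w)=\mathrm{Tr}\big(\mathcal G_2(z,w)\big),$$ where $\mathcal G_2:(\mathbb C\setminus[-K,K])^2\to M_{d^2}(\mathbb C)$ is an analytic function given by $$\mathcal G_2(z,w)=\Theta\Big(\mathcal G_D(z,z)\big\{\Theta[\mathcal H(z,w)]+\Phi\big[\mathcal H(z,w)^\Gamma(\mathcal G(z)\otimes\mathcal G(w))^\Gamma\mathcal H(z,w)^\Gamma\big]\big\}\mathcal G_D(w,w)^{\mathrm T}\Big)$$ with $$\mathcal H(z,w)=\big(I_{d^2}-\Sigma[\mathcal G(z)\otimes\mathcal G(w)]\big)^{-1}\Sigma,\qquad \mathcal G_D(z,w)=[\mathcal G(z)\otimes\mathcal G(w)]\big(I_{d^2}-\Sigma[\mathcal G(z)\otimes\mathcal G(w)]\big)^{-1}.$$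
   Context: Block Gaussian matrix with covariance $\sigma$: a selfadjoint $dN\times dN$ random matrix $X_N=(X_N^{(p,q)})_{p,q=1}^d$ whose blocks $X_N^{(p,q)}$ are $N\times N$ selfadjoint random matrices such that all the real and imaginary parts of the entries $X_N^{(p,q)}(i,j)$ ($1\le p,q\le d$, $1\le i,j\le N$) are jointly Gaussian with zero mean and covariance specified by $\mathbb E\big(X_N^{(p,q)}(k',l')X_N^{(r,s)}(k'',l'')\big)=\frac1N\delta_{k',l''}\delta_{l',k''}\sigma(p,q;r,s)$. Indexing: for $A\in M_{d^2}(\mathbb C)$ and $p,q,r,s\in\{1,\dots,d\}$ write $A(p,q;r,s)=A((p-1)d+r,(q-1)d+s)$; thus for $A,B\in M_d(\mathbb C)$, $(A\otimes B)(p,q;r,s)=A(p,q)B(r,s)$ (Kronecker product). $\Sigma\in M_{d^2}(\mathbb C)$ is the matrix with $\Sigma(p,q;r,s)=\sigma(p,q;r,s)$. For $A\in M_{d^2}(\mathbb C)$: $\Theta(A)(p,q;r,s)=A(p,r;q,s)$, $A^\Gamma(p,q;r,s)=A(p,q;s,r)$, $\Phi(A)=\Theta(A^\Gamma)$. $A^{\mathrm T}$ is the usual transpose. The function $\mathcal G$: let $\eta:M_d(\mathbb C)\to M_d(\mathbb C)$, $\eta(w)(p,q)=\sum_{k,l=1}^d w(k,l)\sigma(p,k;l,q)$, and for $\mathrm{Im}\,z>0$ let $T_z(w)=(zI_d-\eta(w))^{-1}$. On the upper half-plane $\mathcal G(z)=\lim_{n\to\infty}T_z^{\circ n}(w)$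 for any $w\in M_d(\mathbb C)$ with $\mathrm{Im}\,w<0$; it satisfies $\mathcal G(z)=T_z(\mathcal G(z))$. Equivalently $\mathcal G(z)=(\mathrm{id}_{M_d}\otimes\psi)\big((zI_d-X)^{-1}\big)$, where $X=(X(p,q))_{p,q=1}^d$ is a matrix of selfadjoint elements, with $X(p,q)=X(q,p)$, of a tracial $C^*$-probability space $(\mathcal B,\psi)$ forming a semicircular family of covariance $\sigma$, i.e. $\psi\big(\prod_{w=1}^mX(i_w,j_w)\big)=\sum_{\pi}\prod_{\{u,v\}\in\pi}\sigma(i_u,j_u;i_v,j_v)$, the sum being over non-crossing pairings $\pi$ of $\{1,\dots,m\}$. This last formula defines $\mathcal G$ as an analytic function on $\mathbb C\setminus[-\|X\|,\|X\|]$, and this is the function $\mathcal G$ used in the statement. *)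

theory Defs
  imports "HOL-Probability.Probability"
begin

section \<open>Block Gaussian matrices\<close>

text \<open>
  The block index set \<open>{1..d}\<close> is a finite type \<open>'d\<close>, so \<open>d = CARD('d)\<close>.  Since \<open>N\<close> varies, a
  \<open>dN \<times> dN\<close> matrix is a function on the index pairs \<open>(p, i)\<close> with \<open>p :: 'd\<close> and \<open>i < N\<close>; its
  block \<open>(p, q)\<close> has the entries \<open>X (p, i) (q, j)\<close>.
\<close>

type_synonym 'd covariance = "'d \<Rightarrow> 'd \<Rightarrow> 'd \<Rightarrow> 'd \<Rightarrow> real"
type_synonym 'd block_matrix = "'d \<times> nat \<Rightarrow> 'd \<times> nat \<Rightarrow> complex"

definition gaussian_rv :: "'a measure \<Rightarrow> ('a \<Rightarrow> real) \<Rightarrow> bool" where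
  \<comment> \<open>constants count as (degenerate) Gaussian variables\<close>
  "gaussian_rv M Y \<longleftrightarrow> Y \<in> borel_measurable M \<and>
     ((\<exists>m. AE \<omega> in M. Y \<omega> = m) \<or>
      (\<exists>m s. 0 < s \<and> distributed M lborel Y (\<lambda>x. ennreal (normal_density m s x))))"

definition jointly_gaussian :: "'a measure \<Rightarrow> 'i set \<Rightarrow> ('i \<Rightarrow> 'a \<Rightarrow> real) \<Rightarrow> bool" where
  "jointly_gaussian M I Y \<longleftrightarrow> (\<forall>c. gaussian_rv M (\<lambda>\<omega>. \<Sum>i\<in>I. c i * Y i \<omega>))"

definition block_gaussian ::
  "'d::finite covariance \<Rightarrow> nat \<Rightarrow> 'a measure \<Rightarrow> ('a \<Rightarrow> 'd block_matrix) \<Rightarrow> bool" where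
  \<comment> \<open>the two almost sure identities: \<open>X\<close> is selfadjoint, and so is each of its blocks\<close>
  "block_gaussian \<sigma> N M X \<longleftrightarrow>
     prob_space M \<and>
     (AE \<omega> in M. \<forall>p q. \<forall>i<N. \<forall>j<N. X \<omega> (q, j) (p, i) = cnj (X \<omega> (p, i) (q, j))) \<and>
     (AE \<omega> in M. \<forall>p q. \<forall>i<N. \<forall>j<N. X \<omega> (p, j) (q, i) = cnj (X \<omega> (p, i) (q, j))) \<and>
     jointly_gaussian M (UNIV \<times> UNIV \<times> {..<N} \<times> {..<N} \<times> {Re, Im})
       (\<lambda>(p, q, i, j, part) \<omega>. part (X \<omega> (p, i) (q, j))) \<and>
     (\<forall>p q. \<forall>i<N. \<forall>j<N. \<forall>part\<in>{Re, Im}.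
        (\<integral>\<omega>. part (X \<omega> (p, i) (q, j)) \<partial>M) = 0) \<and>
     (\<forall>p q r s. \<forall>k1<N. \<forall>l1<N. \<forall>k2<N. \<forall>l2<N.
        (\<integral>\<omega>. X \<omega> (p, k1) (q, l1) * X \<omega> (r, k2) (s, l2) \<partial>M) =
          1 / of_nat N * of_bool (k1 = l2) * of_bool (l1 = k2) * complex_of_real (\<sigma> p q r s))"

fun power_on :: "'i set \<Rightarrow> ('i \<Rightarrow> 'i \<Rightarrow> complex) \<Rightarrow> nat \<Rightarrow> 'i \<Rightarrow> 'i \<Rightarrow> complex" where
  "power_on I A 0 = (\<lambda>i j. of_bool (i = j))"
| "power_on I A (Suc m) = (\<lambda>i j. \<Sum>k\<in>I. A i k * power_on I A m k j)"

definition block_trace_power :: "nat \<Rightarrow> 'd::finite block_matrix \<Rightarrow> nat \<Rightarrow> complex" where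
  "block_trace_power N A m = (\<Sum>i\<in>UNIV \<times> {..<N}. power_on (UNIV \<times> {..<N}) A m i i)"

text \<open>\<open>Tr (X\<^sup>m)\<close> is almost surely real for selfadjoint \<open>X\<close>, so no conjugate is needed here.\<close>

definition Cov :: "'a measure \<Rightarrow> ('a \<Rightarrow> complex) \<Rightarrow> ('a \<Rightarrow> complex) \<Rightarrow> complex" where
  "Cov M Y Z = (\<integral>\<omega>. Y \<omega> * Z \<omega> \<partial>M) - (\<integral>\<omega>. Y \<omega> \<partial>M) * (\<integral>\<omega>. Z \<omega> \<partial>M)"

definition trace_cov ::
  "(nat \<Rightarrow> 'a measure) \<Rightarrow> (nat \<Rightarrow> 'a \<Rightarrow> 'd::finite block_matrix) \<Rightarrow> nat \<Rightarrow> nat \<Rightarrow> nat \<Rightarrow> complex" where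
  "trace_cov M X m n N =
     Cov (M N) (\<lambda>\<omega>. block_trace_power N (X N \<omega>) m) (\<lambda>\<omega>. block_trace_power N (X N \<omega>) n)"

definition alpha ::
  "(nat \<Rightarrow> 'a measure) \<Rightarrow> (nat \<Rightarrow> 'a \<Rightarrow> 'd::finite block_matrix) \<Rightarrow> nat \<Rightarrow> nat \<Rightarrow> complex" where
  "alpha M X m n = lim (trace_cov M X m n)"

definition G2_term :: "(nat \<Rightarrow> nat \<Rightarrow> complex) \<Rightarrow> complex \<Rightarrow> complex \<Rightarrow> nat \<Rightarrow> nat \<Rightarrow> complex" where
  "G2_term a z w m n = a m n / (z ^ (m + 1) * w ^ (n + 1))"

definition G2 :: "(nat \<Rightarrow> nat \<Rightarrow> complex) \<Rightarrow> complex \<Rightarrow> complex \<Rightarrow> complex" where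
  "G2 a z w = (\<Sum>\<^sub>\<infinity>m\<in>{1..}. \<Sum>\<^sub>\<infinity>n\<in>{1..}. G2_term a z w m n)"


section \<open>Matrices with four indices\<close>

text \<open>
  Rows and columns of a \<open>d\<^sup>2 \<times> d\<^sup>2\<close> matrix are indexed by \<open>'d \<times> 'd\<close>, the pair \<open>(p, r)\<close> standing for
  the number \<open>(p - 1) d + r\<close>.  Hence \<open>A(p,q;r,s)\<close> is the entry in row \<open>(p, r)\<close> and column \<open>(q, s)\<close>.
\<close>

type_synonym 'd matrix1 = "complex^'d^'d"
type_synonym 'd matrix2 = "complex^('d \<times> 'd)^('d \<times> 'd)"

definition entry4 :: "'d::finite matrix2 \<Rightarrow> 'd \<Rightarrow> 'd \<Rightarrow> 'd \<Rightarrow> 'd \<Rightarrow> complex" where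
  "entry4 A p q r s = A $ (p, r) $ (q, s)"

definition matrix4 :: "('d \<Rightarrow> 'd \<Rightarrow> 'd \<Rightarrow> 'd \<Rightarrow> complex) \<Rightarrow> 'd::finite matrix2" where
  "matrix4 f = (\<chi> a b. f (fst a) (fst b) (snd a) (snd b))"

lemma entry4_matrix4 [simp]: "entry4 (matrix4 f) p q r s = f p q r s"
  by (simp add: entry4_def matrix4_def)

definition kron :: "'d::finite matrix1 \<Rightarrow> 'd matrix1 \<Rightarrow> 'd matrix2" where
  "kron A B = matrix4 (\<lambda>p q r s. A $ p $ q * B $ r $ s)"

definition Sigma_mat :: "'d::finite covariance \<Rightarrow> 'd matrix2" where
  "Sigma_mat \<sigma> = matrix4 (\<lambda>p q r s. complex_of_real (\<sigma> p q r s))"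

definition Theta :: "'d::finite matrix2 \<Rightarrow> 'd matrix2" where
  "Theta A = matrix4 (\<lambda>p q r s. entry4 A p r q s)"

definition Gamma_tr :: "'d::finite matrix2 \<Rightarrow> 'd matrix2" where
  "Gamma_tr A = matrix4 (\<lambda>p q r s. entry4 A p q s r)"

definition Phi :: "'d::finite matrix2 \<Rightarrow> 'd matrix2" where
  "Phi A = Theta (Gamma_tr A)"


section \<open>Semicircular families and the Cauchy transform\<close>

class cstar_algebra = real_normed_algebra_1 + banach +
  fixes scaleC :: "complex \<Rightarrow> 'a \<Rightarrow> 'a"
    and star :: "'a \<Rightarrow> 'a"
  assumes scaleC_add_right: "scaleC c (x + y) = scaleC c x + scaleC c y"
    and scaleC_add_left: "scaleC (c + c') x = scaleC c x + scaleC c' x"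
    and scaleC_scaleC: "scaleC c (scaleC c' x) = scaleC (c * c') x"
    and scaleC_of_real: "scaleC (complex_of_real r) x = scaleR r x"
    and scaleC_mult_left: "scaleC c x * y = scaleC c (x * y)"
    and scaleC_mult_right: "x * scaleC c y = scaleC c (x * y)"
    and norm_scaleC: "norm (scaleC c x) = cmod c * norm x"
    and star_star: "star (star x) = x"
    and star_add: "star (x + y) = star x + star y"
    and star_scaleC: "star (scaleC c x) = scaleC (cnj c) (star x)"
    and star_mult: "star (x * y) = star y * star x"
    and cstar_identity: "norm (star x * x) = (norm x)\<^sup>2"

definition tracial_state :: "('b::cstar_algebra \<Rightarrow> complex) \<Rightarrow> bool" where
  "tracial_state \<psi> \<longleftrightarrow>
     (\<forall>x y. \<psi> (x + y) = \<psi> x + \<psi> y) \<and>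
     (\<forall>c x. \<psi> (scaleC c x) = c * \<psi> x) \<and>
     \<psi> 1 = 1 \<and>
     (\<forall>x. \<psi> (star x * x) \<in> \<real>\<^sub>\<ge>\<^sub>0) \<and>
     (\<forall>x y. \<psi> (x * y) = \<psi> (y * x))"

definition nc_pairings :: "nat \<Rightarrow> nat set set set" where
  "nc_pairings m =
     {\<pi>. partition_on {1..m} \<pi> \<and> (\<forall>V\<in>\<pi>. card V = 2) \<and>
         \<not> (\<exists>a b c e. a < b \<and> b < c \<and> c < e \<and> {a, c} \<in> \<pi> \<and> {b, e} \<in> \<pi>)}"

definition semicircular_family ::
  "'d::finite covariance \<Rightarrow> ('b::cstar_algebra \<Rightarrow> complex) \<Rightarrow> 'b^'d^'d \<Rightarrow> bool" where
  "semicircular_family \<sigma> \<psi> X \<longleftrightarrow>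
     (\<forall>p q. star (X $ p $ q) = X $ p $ q) \<and>
     (\<forall>p q. X $ p $ q = X $ q $ p) \<and>
     (\<forall>m (i :: nat \<Rightarrow> 'd) j.
        \<psi> (\<Prod>k\<leftarrow>[1..<m + 1]. X $ i k $ j k) =
        (\<Sum>\<pi>\<in>nc_pairings m. \<Prod>V\<in>\<pi>.
           complex_of_real (\<sigma> (i (Min V)) (j (Min V)) (i (Max V)) (j (Max V)))))"

definition resolvent_arg :: "'b::cstar_algebra^'d^'d \<Rightarrow> complex \<Rightarrow> 'b^'d^'d" where
  "resolvent_arg X z = mat (scaleC z 1) - X"

definition cauchy_transform ::
  "('b::cstar_algebra \<Rightarrow> complex) \<Rightarrow> 'b^'d^'d \<Rightarrow> complex \<Rightarrow> 'd::finite matrix1" where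
  "cauchy_transform \<psi> X z = (\<chi> p q. \<psi> (matrix_inv (resolvent_arg X z) $ p $ q))"


section \<open>The second-order Cauchy transform\<close>

text \<open>In this section \<open>S\<close> is the matrix \<open>\<Sigma>\<close> of the covariance and \<open>G\<close> the Cauchy transform.\<close>

definition H_arg ::
  "'d::finite matrix2 \<Rightarrow> (complex \<Rightarrow> 'd matrix1) \<Rightarrow> complex \<Rightarrow> complex \<Rightarrow> 'd matrix2" where
  "H_arg S G z w = mat 1 - S ** kron (G z) (G w)"

definition calH ::
  "'d::finite matrix2 \<Rightarrow> (complex \<Rightarrow> 'd matrix1) \<Rightarrow> complex \<Rightarrow> complex \<Rightarrow> 'd matrix2" where
  "calH S G z w = matrix_inv (H_arg S G z w) ** S"

definition calGD ::
  "'d::finite matrix2 \<Rightarrow> (complex \<Rightarrow> 'd matrix1) \<Rightarrow> complex \<Rightarrow> complex \<Rightarrow> 'd matrix2" where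
  "calGD S G z w = kron (G z) (G w) ** matrix_inv (H_arg S G z w)"

definition calG2 ::
  "'d::finite matrix2 \<Rightarrow> (complex \<Rightarrow> 'd matrix1) \<Rightarrow> complex \<Rightarrow> complex \<Rightarrow> 'd matrix2" where
  "calG2 S G z w =
     Theta (calGD S G z z **
            (Theta (calH S G z w) +
             Phi (Gamma_tr (calH S G z w) ** Gamma_tr (kron (G z) (G w)) **
                  Gamma_tr (calH S G z w))) **
            transpose (calGD S G w w))"

definition slit_plane :: "real \<Rightarrow> complex set" where
  "slit_plane K = - (complex_of_real ` {-K..K})"

text \<open>
  Holomorphy of a matrix-valued function of two complex variables on an open set: each entry has
  a complex-linear Frechet derivative.
\<close>

definition analytic2_on ::
  "(complex \<Rightarrow> complex \<Rightarrow> complex^'n^'m) \<Rightarrow> (complex \<times> complex) set \<Rightarrow> bool" where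
  "analytic2_on F U \<longleftrightarrow> open U \<and>
     (\<forall>x\<in>U. \<forall>a b. \<exists>u v.
        ((\<lambda>y. F (fst y) (snd y) $ a $ b) has_derivative (\<lambda>h. u * fst h + v * snd h)) (at x))"

end

theory Submission
  imports Defs "HOL-Complex_Analysis.Conformal_Mappings"
begin

text \<open>
  Write \<open>T w = Tr (X\<^sup>w)\<close> for the \<open>N \<times> N\<close> trace of a word \<open>w\<close> in the blocks and \<open>\<tau> w = \<psi> (Y\<^sup>w)\<close>; the
  sum over non-crossing pairings says that \<open>\<tau> (e w)\<close> is the sum of \<open>\<sigma> e f \<tau> w' \<tau> w''\<close> over the
  splittings \<open>w = w' f w''\<close>.  Gaussian integration by parts expresses a mixed moment of the centred
  traces \<open>T w - N \<tau> w\<close> through mixed moments of smaller total length, up to terms with a factor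
  \<open>1/N\<close>.  Hence all these moments converge, and the limiting covariances \<open>\<gamma> w u\<close> obey a linear
  recursion with source \<open>\<sigma> e f \<tau> (w u'' u')\<close>, one term for each splitting \<open>u = u' f u''\<close>.

  Let \<open>R\<close> be the resolvent of \<open>Y\<close>.  It exists off the real axis because positivity in the
  C*-algebra bounds \<open>z - Y\<close> below.  The recursion for \<open>\<tau>\<close> gives Schwinger--Dyson equations for
  \<open>B(p,q;u,s) = \<psi> (R(z)\<^sub>p\<^sub>q R(w)\<^sub>s\<^sub>u)\<close> near infinity, hence on the whole slit plane by analytic
  continuation; they read \<open>B = K + K \<Sigma> B\<close> with \<open>K = \<G>(z) \<otimes> \<G>(w)\<close>.  This exhibits \<open>1 + \<Sigma> B\<close> as the inverse
  of \<open>1 - \<Sigma> K\<close>, so \<open>\<G>\<^sub>D = B\<close>.  Solving the recursion for \<open>\<gamma>\<close> with the same linear system,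
  and differentiating \<open>B = K + K \<Sigma> B\<close> in \<open>w\<close> to compute its source, yields the formula.
\<close>

text \<open>Integration by parts does not close on pair covariances: splitting one trace produces
  two centred factors, so mixed moments of any number of factors have to be carried along. What
  decreases is the total number of letters, by two at each step. Centring at \<open>N * tau\<close>
  instead of the expectation makes the order N part of the equation cancel exactly by the recursion
  of \<open>tau\<close>; that both centrings agree in the limit comes out afterwards in
  \<open>cl_single\<close>. For the analytic half the obstacle is the domain. Smallness makes
  \<open>1 - \<Sigma> K\<close> invertible near infinity only, whereas invertibility is claimed on a
  whole slit plane; the continued equation for \<open>B\<close> supplies the inverse there without
  any estimate. The continuation in turn needs the resolvent at nonreal points near the spectrum,
  where the Neumann series in \<open>1 / z\<close> fails. This is why positivity is developed from
  the norm axioms, with \<open>norm (t - a) \<le> t\<close> in place of a spectrum and the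
  positivity of \<open>star x * x\<close> as the central fact.\<close>

section \<open>Arithmetic of complex scalars and of the involution\<close>

lemma scaleC_zero_left [simp]: "scaleC 0 x = 0" for x :: "'b::cstar_algebra"
  using scaleC_of_real[of 0 x] by simp

lemma scaleC_one [simp]: "scaleC 1 x = x" for x :: "'b::cstar_algebra"
  using scaleC_of_real[of 1 x] by simp

lemma scaleC_zero_right [simp]: "scaleC c 0 = 0" for c :: complex
  using scaleC_add_right[of c 0 0] by simp

lemma scaleC_minus_right: "scaleC c (- x) = - scaleC c x" for x :: "'b::cstar_algebra"
  using scaleC_add_right[of c x "- x"] by (simp add: eq_neg_iff_add_eq_0 add.commute)

lemma scaleC_minus_left: "scaleC (- c) x = - scaleC c x" for x :: "'b::cstar_algebra"
  using scaleC_add_left[of c "- c" x] by (simp add: eq_neg_iff_add_eq_0 add.commute)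

lemma scaleC_diff_right: "scaleC c (x - y) = scaleC c x - scaleC c y" for x :: "'b::cstar_algebra"
  using scaleC_add_right[of c x "- y"] by (simp add: scaleC_minus_right)

lemma scaleC_diff_left: "scaleC (c - c') x = scaleC c x - scaleC c' x" for x :: "'b::cstar_algebra"
  using scaleC_add_left[of c "- c'" x] by (simp add: scaleC_minus_left)

lemma scaleC_sum_right: "scaleC c (sum f A) = (\<Sum>i\<in>A. scaleC c (f i :: 'b::cstar_algebra))"
  by (induction A rule: infinite_finite_induct) (auto simp: scaleC_add_right)

lemma scaleC_scaleR: "scaleC c (scaleR r x) = scaleR r (scaleC c x)" for x :: "'b::cstar_algebra"
  by (simp add: scaleC_of_real[symmetric] scaleC_scaleC mult.commute)

lemma star_zero [simp]: "star (0::'b::cstar_algebra) = 0"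
  using star_add[of "0::'b" 0] by simp

lemma star_minus: "star (- x) = - star x" for x :: "'b::cstar_algebra"
  using star_add[of x "- x"] by (simp add: eq_neg_iff_add_eq_0 add.commute)

lemma star_diff: "star (x - y) = star x - star y" for x :: "'b::cstar_algebra"
  using star_add[of x "- y"] by (simp add: star_minus)

lemma star_one [simp]: "star (1::'b::cstar_algebra) = 1"
  by (metis mult.left_neutral mult.right_neutral star_mult star_star)

lemma star_scaleR: "star (scaleR r x) = scaleR r (star x)" for x :: "'b::cstar_algebra"
  using star_scaleC[of "complex_of_real r" x] by (simp add: scaleC_of_real)

lemma star_of_real [simp]: "star (of_real r :: 'b::cstar_algebra) = of_real r"
  by (simp add: of_real_def star_scaleR)

lemma star_power: "star (x ^ n) = star x ^ n" for x :: "'b::cstar_algebra"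
  by (induction n) (auto simp: star_mult power_commutes)

lemma star_sum: "star (sum f A) = (\<Sum>i\<in>A. star (f i :: 'b::cstar_algebra))"
  by (induction A rule: infinite_finite_induct) (auto simp: star_add)

lemma norm_star [simp]: "norm (star x) = norm x" for x :: "'b::cstar_algebra"
proof -
  have le: "norm y \<le> norm (star y)" for y :: 'b
  proof (cases "y = 0")
    case False
    have "norm y * norm y \<le> norm (star y) * norm y"
      using cstar_identity[of y] norm_mult_ineq[of "star y" y] by (simp add: power2_eq_square)
    then show ?thesis using False by simp
  qed auto
  show ?thesis using le[of x] le[of "star x"] by (simp add: star_star)
qed

lemma bounded_linear_star: "bounded_linear (star :: 'b::cstar_algebra \<Rightarrow> 'b)"
  by (rule bounded_linear_intro[where K = 1]) (auto simp: star_add star_scaleR)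

lemma bounded_linear_scaleC: "bounded_linear (scaleC c :: 'b::cstar_algebra \<Rightarrow> 'b)"
  by (rule bounded_linear_intro[where K = "cmod c"])
     (auto simp: scaleC_add_right scaleC_scaleR norm_scaleC)

lemma norm_selfadjoint_square: "star a = a \<Longrightarrow> norm (a * a) = (norm a)\<^sup>2" for a :: "'b::cstar_algebra"
  using cstar_identity[of a] by simp

lemma norm_selfadjoint_power:
  assumes "star a = (a :: 'b::cstar_algebra)"
  shows "norm (a ^ 2 ^ n) = norm a ^ 2 ^ n"
proof (induction n)
  case (Suc n)
  have "star (a ^ 2 ^ n) = a ^ 2 ^ n" by (simp add: star_power assms)
  from norm_selfadjoint_square[OF this] Suc show ?case
    by (simp add: power_add[symmetric] mult_2 power_mult[symmetric] mult.commute[of "2 ^ n"]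
        flip: power2_eq_square)
qed simp

subsection \<open>Square roots and positive elements\<close>

text \<open>The Taylor coefficients of \<open>sqrt (1 - t)\<close> at \<open>t = 0\<close>.\<close>

definition sqrt_coeff :: "nat \<Rightarrow> real" where
  "sqrt_coeff n = ((1/2) gchoose n) * (- 1) ^ n"

lemma sqrt_coeff_0 [simp]: "sqrt_coeff 0 = 1"
  by (simp add: sqrt_coeff_def)

lemma gbinomial_Suc_rec: "(a gchoose Suc n) = (a gchoose n) * (a - of_nat n) / of_nat (Suc n)"
  for a :: real
  using gbinomial_absorb_comp[of a n] gbinomial_absorption[of n a]
  by (simp add: field_simps gbinomial_mult_1)

lemma sqrt_coeff_Suc_nonpos: "sqrt_coeff (Suc n) \<le> 0"
proof (induction n)
  case (Suc n)
  have "sqrt_coeff (Suc (Suc n)) = sqrt_coeff (Suc n) * ((real (Suc n) - 1/2) / real (Suc (Suc n)))"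
    unfolding sqrt_coeff_def gbinomial_Suc_rec[of _ "Suc n"] by (simp add: field_simps)
  also have "\<dots> \<le> 0" using Suc by (intro mult_nonpos_nonneg) auto
  finally show ?case .
qed (simp add: sqrt_coeff_def gbinomial_Suc_rec)

text \<open>Partial alternating sums of the binomial coefficients of 1/2 are signed binomial
  coefficients of -1/2, and in those all signs cancel.\<close>

lemma sum_sqrt_coeff_nonneg: "0 \<le> (\<Sum>k\<le>n. sqrt_coeff k)"
proof -
  have pos: "0 \<le> (- 1) ^ n * ((- 1/2) gchoose n :: real)" for n
  proof (induction n)
    case (Suc n)
    have "(- 1) ^ Suc n * ((- 1/2) gchoose Suc n :: real) =
      ((- 1) ^ n * ((- 1/2) gchoose n)) * ((real n + 1/2) / real (Suc n))"
      unfolding gbinomial_Suc_rec[of _ n] by (simp add: field_simps)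
    with Suc show ?case by (auto intro!: mult_nonneg_nonneg)
  qed simp
  have "(\<Sum>k\<le>n. sqrt_coeff k) = (- 1) ^ n * ((1/2 - 1) gchoose n)"
    unfolding sqrt_coeff_def by (rule gbinomial_sum_lower_neg)
  then show ?thesis using pos[of n] by simp
qed

text \<open>Only the constant coefficient is positive, so nonnegative partial sums bound the
  absolute sum of the others by 1. This gives absolute convergence on the closed unit ball,
  including the boundary case \<open>norm (1 - a) = 1\<close>.\<close>

lemma sum_abs_sqrt_coeff: "(\<Sum>k<n. \<bar>sqrt_coeff (Suc k)\<bar>) \<le> 1"
proof -
  have "(\<Sum>k\<le>n. sqrt_coeff k) = 1 + (\<Sum>k<n. sqrt_coeff (Suc k))"
    by (simp add: sum.atMost_shift)
  moreover have "(\<Sum>k<n. \<bar>sqrt_coeff (Suc k)\<bar>) = - (\<Sum>k<n. sqrt_coeff (Suc k))"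
    by (simp add: sqrt_coeff_Suc_nonpos sum_negf[symmetric])
  ultimately show ?thesis using sum_sqrt_coeff_nonneg[of n] by simp
qed

lemma summable_sqrt_coeff: "summable (\<lambda>k. \<bar>sqrt_coeff k\<bar>)"
  by (subst summable_Suc_iff[symmetric], rule summableI_nonneg_bounded[where x = 1])
     (use sum_abs_sqrt_coeff in auto)

text \<open>The root is the power series of \<open>sqrt (1 - t)\<close> evaluated at
  \<open>t = 1 - a\<close>. The bound on \<open>1 - k\<close> makes the root positive again, and
  commutation passes from the powers of \<open>t\<close> to the limit; both are used throughout this
  part.\<close>

lemma square_root_exists:
  fixes a :: "'b::cstar_algebra"
  assumes "norm (1 - a) \<le> 1" "star a = a"
  shows "\<exists>k. star k = k \<and> k * k = a \<and> norm (1 - k) \<le> 1 \<and> (\<forall>x. x * a = a * x \<longrightarrow> x * k = k * x)"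
proof -
  define t where "t = 1 - a"
  define f where "f n = sqrt_coeff n *\<^sub>R t ^ n" for n
  define k where "k = suminf f"
  have star_t: "star t = t" by (simp add: t_def star_diff assms)
  have norm_t: "norm (t ^ n) \<le> 1" for n
    using norm_power_ineq[of t n] assms(1) by (smt (verit) norm_ge_zero power_le_one t_def)
  have nf: "norm (f n) \<le> \<bar>sqrt_coeff n\<bar>" for n
    unfolding f_def using norm_t[of n] by (simp add: mult_left_le)
  have sn: "summable (\<lambda>n. norm (f n))"
    by (rule summable_comparison_test[OF _ summable_sqrt_coeff]) (use nf in auto)
  have sf: "summable f" using sn by (rule summable_norm_cancel)
  have "star k = (\<Sum>n. star (f n))"
    unfolding k_def by (rule bounded_linear.suminf[OF bounded_linear_star sf, symmetric, THEN sym])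
  also have "\<dots> = k" by (simp add: k_def f_def[abs_def] star_scaleR star_power star_t)
  finally have star_k: "star k = k" .
  have "(\<lambda>n. \<Sum>i\<le>n. f i * f (n - i)) sums (k * k)"
    unfolding k_def by (rule Cauchy_product_sums[OF sn sn])
  moreover have "(\<Sum>i\<le>n. f i * f (n - i)) = ((1 gchoose n) * (- 1) ^ n) *\<^sub>R t ^ n" for n
  proof -
    have "(\<Sum>i\<le>n. f i * f (n - i)) = (\<Sum>i\<le>n. (sqrt_coeff i * sqrt_coeff (n - i)) *\<^sub>R t ^ n)"
      by (rule sum.cong) (auto simp: f_def power_add[symmetric])
    also have "\<dots> = (\<Sum>i\<le>n. (((1/2) gchoose i) * ((1/2) gchoose (n - i))) * (- 1) ^ n) *\<^sub>R t ^ n"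
      unfolding scaleR_sum_left[symmetric] sqrt_coeff_def
      by (intro arg_cong2[where f = scaleR] sum.cong refl)
         (auto simp: power_add[symmetric] algebra_simps)
    \<comment> \<open>Vandermonde with 1/2 + 1/2 = 1. The coefficients of index at least 2 vanish,
      so the Cauchy square of the series is \<open>1 - t\<close>.\<close>
    also have "\<dots> = ((1 gchoose n) * (- 1) ^ n) *\<^sub>R t ^ n"
      using gbinomial_Vandermonde[of "1/2::real" "1/2" n] by (simp add: sum_distrib_right[symmetric] atLeast0AtMost)
    finally show ?thesis .
  qed
  ultimately have "(\<lambda>n. ((1 gchoose n) * (- 1) ^ n) *\<^sub>R t ^ n) sums (k * k)" by simp
  moreover have "(\<lambda>n. ((1 gchoose n) * (- 1) ^ n) *\<^sub>R t ^ n) sums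
     (\<Sum>n\<in>{0,1}. ((1 gchoose n) * (- 1) ^ n) *\<^sub>R t ^ n)"
  proof (rule sums_finite)
    fix n :: nat assume "n \<notin> {0,1}"
    then have "(1::nat) < n" by auto
    then have "((1::real) gchoose n) = 0"
      by (metis binomial_eq_0 binomial_gbinomial of_nat_0 of_nat_1)
    then show "((1 gchoose n) * (- 1) ^ n) *\<^sub>R t ^ n = 0" by simp
  qed simp
  ultimately have "k * k = (\<Sum>n\<in>{0,1}. ((1 gchoose n) * (- 1) ^ n) *\<^sub>R t ^ n)"
    by (rule sums_unique2)
  then have kk: "k * k = a" by (simp add: t_def)
  have "k = f 0 + (\<Sum>n. f (Suc n))" using suminf_split_head[OF sf] by (simp add: k_def)
  then have "k = 1 + (\<Sum>n. f (Suc n))" by (simp add: f_def)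
  then have "norm (1 - k) = norm (\<Sum>n. f (Suc n))" by (metis add_diff_cancel_left' norm_minus_commute)
  also have "\<dots> \<le> (\<Sum>n. norm (f (Suc n)))" using sn summable_Suc_iff[of "\<lambda>n. norm (f n)"] by (intro summable_norm) simp
  also have "\<dots> \<le> (\<Sum>n. \<bar>sqrt_coeff (Suc n)\<bar>)"
    using sn summable_sqrt_coeff summable_Suc_iff[of "\<lambda>n. norm (f n)"]
      summable_Suc_iff[of "\<lambda>n. \<bar>sqrt_coeff n\<bar>"] by (intro suminf_le nf) auto
  also have "\<dots> \<le> 1"
    using summable_sqrt_coeff sum_abs_sqrt_coeff summable_Suc_iff[of "\<lambda>n. \<bar>sqrt_coeff n\<bar>"]
    by (intro suminf_le_const) auto
  finally have "norm (1 - k) \<le> 1" .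
  moreover have "x * k = k * x" if "x * a = a * x" for x
  proof -
    have "x * t = t * x" using that by (simp add: t_def algebra_simps)
    then have "x * t ^ n = t ^ n * x" for n
      by (metis power_commuting_commutes)
    then have "x * f n = f n * x" for n by (simp add: f_def)
    then show ?thesis
      unfolding k_def by (simp add: suminf_mult[OF sf, symmetric] suminf_mult2[OF sf])
  qed
  ultimately show ?thesis using star_k kk by blast
qed

text \<open>The norm condition says that the spectrum lies in \<open>[0, 2 t]\<close>. In this form
  sums of positive elements are positive by the triangle inequality, without any spectral
  theory.\<close>

definition pos_elem :: "'b::cstar_algebra \<Rightarrow> bool" where
  "pos_elem a \<longleftrightarrow> star a = a \<and> (\<exists>t>0. norm (of_real t - a) \<le> t)"

lemma pos_elem_scale:
  assumes "pos_elem a" "0 < r"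
  shows "pos_elem (r *\<^sub>R a)"
proof -
  from assms obtain t where t: "t > 0" "norm (of_real t - a) \<le> t" "star a = a"
    by (auto simp: pos_elem_def)
  have "norm (of_real (r * t) - r *\<^sub>R a) = r * norm (of_real t - a)"
    using assms(2) by (simp add: of_real_def scaleR_diff_right[symmetric] flip: scaleR_scaleR)
  then show ?thesis using t assms(2)
    by (auto simp: pos_elem_def star_scaleR intro!: exI[of _ "r * t"])
qed

lemma pos_elem_add: "pos_elem a \<Longrightarrow> pos_elem b \<Longrightarrow> pos_elem (a + b)"
proof -
  assume "pos_elem a" "pos_elem b"
  then obtain t s where "t > 0" "norm (of_real t - a) \<le> t" "star a = a"
    "s > 0" "norm (of_real s - b) \<le> s" "star b = b"
    by (auto simp: pos_elem_def)
  then show "pos_elem (a + b)"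
    using norm_triangle_ineq[of "of_real t - a" "of_real s - b"]
    by (auto simp: pos_elem_def star_add algebra_simps intro!: exI[of _ "t + s"])
qed

lemma pos_elem_zero: "pos_elem 0"
  by (auto simp: pos_elem_def intro!: exI[of _ 1])

lemma pos_elem_sum: "(\<And>i. i \<in> A \<Longrightarrow> pos_elem (f i)) \<Longrightarrow> pos_elem (sum f A)"
  by (induction A rule: infinite_finite_induct) (auto intro: pos_elem_add pos_elem_zero)

lemma pos_elem_norm_diff: "star c = c \<Longrightarrow> norm c \<le> \<beta> \<Longrightarrow> 0 < \<beta> \<Longrightarrow> pos_elem (of_real \<beta> - c)"
  by (auto simp: pos_elem_def star_diff intro!: exI[of _ \<beta>])

lemma pos_elem_sqrt:
  assumes "pos_elem a"
  shows "\<exists>k. star k = k \<and> k * k = a \<and> pos_elem k \<and> (\<forall>x. x * a = a * x \<longrightarrow> x * k = k * x)"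
proof -
  from assms obtain t where t: "t > 0" "norm (of_real t - a) \<le> t" "star a = a"
    by (auto simp: pos_elem_def)
  define a' where "a' = (1 / t) *\<^sub>R a"
  have "1 - a' = (1 / t) *\<^sub>R (of_real t - a)"
    using t by (simp add: a'_def of_real_def scaleR_diff_right)
  then have "norm (1 - a') \<le> 1" using t by (simp add: divide_simps)
  moreover have "star a' = a'" using t by (simp add: a'_def star_scaleR)
  ultimately obtain k where k: "star k = k" "k * k = a'" "norm (1 - k) \<le> 1"
    "\<And>x. x * a' = a' * x \<Longrightarrow> x * k = k * x"
    using square_root_exists[of a'] by blast
  have "pos_elem k" using k(1,3) by (auto simp: pos_elem_def intro!: exI[of _ 1])
  then have 1: "pos_elem (sqrt t *\<^sub>R k)" using t(1) by (simp add: pos_elem_scale)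
  have 2: "(sqrt t *\<^sub>R k) * (sqrt t *\<^sub>R k) = a"
    using t(1) k(2) by (simp add: a'_def)
  have 3: "x * (sqrt t *\<^sub>R k) = (sqrt t *\<^sub>R k) * x" if "x * a = a * x" for x
    using k(4)[of x] that by (simp add: a'_def)
  have "star (sqrt t *\<^sub>R k) = sqrt t *\<^sub>R k" by (simp add: star_scaleR k(1))
  with 1 2 3 show ?thesis by blast
qed

text \<open>The element \<open>k + i l\<close> is unitary, hence of norm 1, and \<open>k\<close> is
  its real part.\<close>

lemma norm_le_one_if_unitary:
  fixes k l :: "'b::cstar_algebra"
  assumes "star k = k" "star l = l" "k * l = l * k" "k * k + l * l = 1"
  shows "norm k \<le> 1"
proof -
  define u where "u = k + scaleC \<i> l"
  have su: "star u = k - scaleC \<i> l"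
    by (simp add: u_def star_add star_scaleC assms scaleC_minus_left)
  have "star u * u = k * k + l * l"
    unfolding su unfolding u_def
    by (simp add: algebra_simps scaleC_mult_left scaleC_mult_right scaleC_scaleC assms(3)
        scaleC_minus_left scaleC_add_right scaleC_diff_right)
  then have "norm u = 1"
    using cstar_identity[of u] assms(4) by (simp add: power2_eq_1_iff) (smt (verit) norm_ge_zero)
  have "2 *\<^sub>R k = u + star u" unfolding su by (simp add: u_def scaleR_2)
  then have "2 * norm k \<le> norm u + norm (star u)"
    by (metis abs_numeral norm_scaleR norm_triangle_ineq)
  then show ?thesis using \<open>norm u = 1\<close> by simp
qed

text \<open>After scaling to norm at most 1, \<open>1 - g * g\<close> has a root \<open>k\<close>,
  and \<open>k * k + g * g = 1\<close> forces \<open>norm k \<le> 1\<close>. Then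
  \<open>norm (1 - g * g) = (norm k)\<^sup>2 \<le> 1\<close>, which is positivity of
  \<open>g * g\<close> with witness 1.\<close>

lemma pos_elem_square:
  assumes "star h = (h :: 'b::cstar_algebra)"
  shows "pos_elem (h * h)"
proof -
  define t where "t = norm h + 1"
  have t: "t > 0" by (simp add: t_def add_nonneg_pos)
  define g where "g = (1 / t) *\<^sub>R h"
  have g: "star g = g" "norm g \<le> 1" using t by (auto simp: g_def star_scaleR assms) (auto simp: t_def divide_simps)
  have "norm (1 - (1 - g * g)) \<le> 1" "star (1 - g * g) = 1 - g * g"
    using g by (auto simp: norm_selfadjoint_square star_diff star_mult power_le_one)
  then obtain k where k: "star k = k" "k * k = 1 - g * g"
    "\<And>x. x * (1 - g * g) = (1 - g * g) * x \<Longrightarrow> x * k = k * x"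
    using square_root_exists[of "1 - g * g"] by blast
  have "g * k = k * g" by (rule k(3)) (simp add: algebra_simps)
  then have "norm k \<le> 1"
    using k(1,2) g(1) by (intro norm_le_one_if_unitary[of k g]) auto
  then have "norm (1 - g * g) \<le> 1"
    using norm_selfadjoint_square[OF k(1)] k(2) by (simp add: power_le_one)
  then have "pos_elem (g * g)"
    using g by (auto simp: pos_elem_def star_mult intro!: exI[of _ 1])
  then have "pos_elem ((t * t) *\<^sub>R (g * g))" using t by (intro pos_elem_scale) auto
  moreover have "(t * t) *\<^sub>R (g * g) = h * h" using t by (simp add: g_def)
  ultimately show ?thesis by simp
qed

text \<open>The roots of \<open>a\<close> and \<open>\<beta> - a\<close> commute and have squares
  adding up to \<open>\<beta>\<close>; divided by \<open>sqrt \<beta>\<close> they are the real and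
  imaginary part of a unitary.\<close>

lemma norm_le_if_pos_elem:
  fixes a :: "'b::cstar_algebra"
  assumes "pos_elem a" "pos_elem (of_real \<beta> - a)" "0 < \<beta>"
  shows "norm a \<le> \<beta>"
proof -
  from pos_elem_sqrt[OF assms(1)] obtain k where k: "star k = k" "k * k = a" by blast
  from pos_elem_sqrt[OF assms(2)] obtain l where l: "star l = l" "l * l = of_real \<beta> - a"
    "\<And>x. x * (of_real \<beta> - a) = (of_real \<beta> - a) * x \<Longrightarrow> x * l = l * x" by blast
  have "k * a = a * k" by (simp add: k(2)[symmetric] mult.assoc)
  then have kl: "k * l = l * k"
    by (intro l(3)) (simp add: algebra_simps of_real_def)
  define c where "c = 1 / sqrt \<beta>"
  have c: "c * c = 1 / \<beta>" using assms(3) by (simp add: c_def)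
  have "norm (c *\<^sub>R k) \<le> 1"
  proof (rule norm_le_one_if_unitary[of _ "c *\<^sub>R l"])
    have "c *\<^sub>R k * c *\<^sub>R k + c *\<^sub>R l * c *\<^sub>R l = (c * c) *\<^sub>R (k * k + l * l)"
      by (simp add: scaleR_add_right)
    also have "\<dots> = 1" using assms(3) by (simp add: k l c of_real_def)
    finally show "c *\<^sub>R k * c *\<^sub>R k + c *\<^sub>R l * c *\<^sub>R l = 1" .
  qed (auto simp: star_scaleR k l kl)
  then have "norm k \<le> sqrt \<beta>" using assms(3) by (simp add: c_def divide_simps)
  then have "(norm k)\<^sup>2 \<le> \<beta>" using assms(3) by (smt (verit) norm_ge_zero power_mono real_sqrt_pow2)
  then show ?thesis using norm_selfadjoint_square[OF k(1)] k(2) by simp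
qed

text \<open>For every \<open>\<beta> > 0\<close> the element \<open>\<beta> - a\<close> is a sum of
  two positive ones, so the norm of \<open>a\<close> is at most \<open>\<beta>\<close>.\<close>

lemma pos_elem_antisym:
  fixes a :: "'b::cstar_algebra"
  assumes "pos_elem a" "pos_elem (- a)"
  shows "a = 0"
proof -
  have "norm a \<le> \<beta>" if "\<beta> > 0" for \<beta>
  proof (rule norm_le_if_pos_elem[OF assms(1) _ that])
    have "pos_elem (of_real \<beta> - (0::'b))" using that by (intro pos_elem_norm_diff) auto
    from pos_elem_add[OF this assms(2)] show "pos_elem (of_real \<beta> - a)" by simp
  qed
  then have "norm a \<le> 0" by (meson dense_ge)
  then show ?thesis by simp
qed

text \<open>Relates the powers of \<open>1 - x * y\<close> to those of \<open>1 - y * x\<close>. It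
  takes over the role of the fact that \<open>x * y\<close> and \<open>y * x\<close> have the same
  nonzero spectrum.\<close>

lemma power_one_minus_mult:
  fixes x y :: "'b::ring_1"
  shows "(1 - x * y) ^ n = 1 - x * (\<Sum>k<n. (1 - y * x) ^ k) * y"
proof (induction n)
  case (Suc n)
  define S where "S = (\<Sum>k<n. (1 - y * x) ^ k)"
  have geom: "(1 - y * x) ^ n = 1 - y * x * S"
    unfolding S_def by (induction n) (auto simp: algebra_simps power_commutes)
  have "(1 - x * y) ^ Suc n = (1 - x * y) * (1 - x * S * y)" using Suc by (simp add: S_def)
  also have "\<dots> = 1 - x * (S + (1 - y * x * S)) * y" by (simp add: algebra_simps)
  finally show ?case by (simp add: S_def[symmetric] geom)
qed simp

text \<open>The growth of the powers of \<open>1 - x y\<close> is at most linear, so for a selfadjoint element the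
  identity \<open>\<parallel>a\<^sup>n\<parallel> = \<parallel>a\<parallel>\<^sup>n\<close> (for \<open>n\<close> a power of two) forces norm at most one.\<close>

lemma norm_one_minus_mult_swap:
  fixes x y :: "'b::cstar_algebra"
  assumes "norm (1 - y * x) \<le> 1" "star (x * y) = x * y"
  shows "norm (1 - x * y) \<le> 1"
proof (rule ccontr)
  define r where "r = norm (1 - x * y)"
  assume "\<not> norm (1 - x * y) \<le> 1"
  then have r: "r > 1" by (simp add: r_def)
  define c where "c = norm x * norm y"
  have bound: "r ^ 2 ^ n \<le> 1 + c * 2 ^ n" for n
  proof -
    have "norm (\<Sum>k<2^n. (1 - y * x) ^ k) \<le> (\<Sum>k<(2::nat)^n. 1)"
    proof (rule sum_norm_le)
      fix k show "norm ((1 - y * x) ^ k) \<le> 1"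
        by (rule order_trans[OF norm_power_ineq]) (use assms in \<open>simp add: power_le_one\<close>)
    qed
    then have S: "norm (\<Sum>k<2^n. (1 - y * x) ^ k) \<le> 2 ^ n" by simp
    have "r ^ 2 ^ n = norm (1 - x * (\<Sum>k<2^n. (1 - y * x) ^ k) * y)"
      using norm_selfadjoint_power[of "1 - x * y" n] assms(2)
      by (simp add: star_diff r_def power_one_minus_mult[of x y "2 ^ n"])
    also have "\<dots> \<le> 1 + norm (x * (\<Sum>k<2^n. (1 - y * x) ^ k) * y)"
      by (metis norm_one norm_triangle_ineq4)
    also have "norm (x * (\<Sum>k<2^n. (1 - y * x) ^ k) * y) \<le> norm x * 2 ^ n * norm y"
      by (intro order_trans[OF norm_mult_ineq] mult_mono order_trans[OF norm_mult_ineq] S) auto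
    finally show ?thesis by (simp add: c_def mult_ac)
  qed
  have "(\<lambda>m::nat. (1 + c * m) / r ^ m) \<longlonglongrightarrow> 0"
    using r by real_asymp
  then have "\<forall>\<^sub>F m in sequentially. (1 + c * real m) / r ^ m < 1"
    by (rule order_tendstoD) simp
  then obtain M where M: "(1 + c * real m) / r ^ m < 1" if "m \<ge> M" for m
    by (auto simp: eventually_sequentially)
  have "(1 + c * 2 ^ M) / r ^ 2 ^ M < 1" using M[of "2 ^ M"] by simp
  with bound[of M] r show False by (simp add: divide_simps)
qed

text \<open>Multiplying \<open>x\<close> by the negative part of \<open>star x * x\<close> gives an
  element \<open>y\<close> for which \<open>star y * y\<close> is both negative and positive. Hence
  \<open>y = 0\<close>, and the negative part vanishes.\<close>

lemma pos_elem_star_mult: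
  fixes x :: "'b::cstar_algebra"
  shows "pos_elem (star x * x)"
proof -
  define h where "h = star x * x"
  have sh: "star h = h" by (simp add: h_def star_mult star_star)
  obtain b where b: "star b = b" "b * b = h * h" "pos_elem b"
    and comm: "\<And>x. x * (h * h) = h * h * x \<Longrightarrow> x * b = b * x"
    using pos_elem_sqrt[OF pos_elem_square[OF sh]] by blast
  have hb: "h * b = b * h" by (rule comm) (simp add: mult.assoc)
  \<comment> \<open>Here \<open>b\<close> is the absolute value of \<open>h\<close>, so
    \<open>n\<close> is twice the negative part of \<open>h\<close>.\<close>
  define n where "n = b - h"
  have sn: "star n = n" by (simp add: n_def star_diff b sh)
  have hn: "h * n = - (b * n)" by (simp add: n_def algebra_simps b(2) hb)
  have bn: "b * n = n * b" by (simp add: n_def algebra_simps hb)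
  obtain k where k: "star k = k" "k * k = b" and kc: "\<And>x. x * b = b * x \<Longrightarrow> x * k = k * x"
    using pos_elem_sqrt[OF b(3)] by blast
  have nk: "n * k = k * n" by (rule kc) (simp add: bn)
  have "pos_elem ((k * n) * (k * n))"
    by (rule pos_elem_square) (simp add: star_mult sn k(1) nk)
  moreover have "(k * n) * (k * n) = b * n * n"
    by (metis k(2) mult.assoc nk)
  ultimately have pbn: "pos_elem (b * n * n)" by simp
  define y where "y = x * n"
  have yy: "star y * y = - (b * n * n)"
  proof -
    have "star y * y = n * (h * n)" by (simp add: y_def star_mult sn h_def mult.assoc)
    also have "\<dots> = - (n * b * n)" by (simp add: hn mult.assoc)
    finally show ?thesis by (simp add: bn)
  qed
  then have neg: "pos_elem (- (star y * y))" using pbn by simp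
  \<comment> \<open>Negativity moves from \<open>star y * y\<close> to \<open>y * star y\<close> by
    exchanging the factors in \<open>1 - x * y\<close>; the scale \<open>- 1 / t\<close> puts the
    norm condition into the shape required there.\<close>
  have neg': "pos_elem (- (y * star y))"
  proof -
    from neg obtain t where t: "t > 0" "norm (of_real t + star y * y) \<le> t"
      by (auto simp: pos_elem_def)
    have "1 - star y * (- (1 / t) *\<^sub>R y) = (1 / t) *\<^sub>R (of_real t + star y * y)"
      using t by (simp add: of_real_def scaleR_add_right)
    then have "norm (1 - star y * (- (1 / t) *\<^sub>R y)) \<le> 1" using t by (simp add: divide_simps)
    then have "norm (1 - (- (1 / t) *\<^sub>R y) * star y) \<le> 1"
      by (rule norm_one_minus_mult_swap) (simp add: star_minus star_scaleR star_mult star_star)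
    moreover have "of_real t + y * star y = t *\<^sub>R (1 - (- (1 / t) *\<^sub>R y) * star y)"
      using t by (simp add: of_real_def scaleR_add_right)
    ultimately have "norm (of_real t + y * star y) \<le> t"
      using t by (simp add: mult_left_le)
    then show ?thesis
      using t by (auto simp: pos_elem_def star_minus star_mult star_star intro!: exI[of _ t])
  qed
  \<comment> \<open>Up to scalars these are the real and imaginary parts of \<open>y\<close>; the
    sum of their squares is positive and equals twice
    \<open>star y * y + y * star y\<close>.\<close>
  define u v where "u = y + star y" and "v = scaleC \<i> (y - star y)"
  have "star u = u" by (simp add: u_def star_add star_star add.commute)
  moreover have "star v = v"
    by (simp add: v_def star_scaleC star_diff star_star scaleC_minus_left scaleC_diff_right)
  ultimately have "pos_elem ((1/2) *\<^sub>R (u * u + v * v))"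
    by (intro pos_elem_scale pos_elem_add pos_elem_square) auto
  moreover have "u * u + v * v = 2 *\<^sub>R (star y * y + y * star y)"
    by (simp add: u_def v_def scaleC_mult_left scaleC_mult_right scaleC_scaleC scaleC_minus_left
        scaleC_add_right scaleC_diff_right algebra_simps scaleR_2)
  ultimately have "pos_elem (star y * y + y * star y)" by simp
  from pos_elem_add[OF this neg'] have "pos_elem (star y * y)" by simp
  from pos_elem_antisym[OF this neg] have "star y * y = 0" .
  then have "y = 0" using cstar_identity[of y] by simp
  then have "h * n = 0" by (simp add: h_def y_def mult.assoc)
  then have "b * n = 0" using hn by simp
  then have "n * n = 0" using \<open>h * n = 0\<close> by (simp add: n_def algebra_simps)
  then have "n = 0" using norm_selfadjoint_square[OF sn] by simp
  then show ?thesis using b(3) by (simp add: n_def h_def)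
qed

text \<open>For \<open>\<beta>\<close> above the norm of the sum S,
  \<open>\<beta> - star (x j) * x j\<close> is \<open>\<beta> - S\<close> plus the remaining
  summands, all of them positive. This is the substitute for the norm of a vector over the
  algebra.\<close>

lemma norm_square_le_sum:
  fixes x :: "'i \<Rightarrow> 'b::cstar_algebra"
  assumes "finite A" "j \<in> A"
  shows "(norm (x j))\<^sup>2 \<le> norm (\<Sum>i\<in>A. star (x i) * x i)"
proof -
  define S where "S = (\<Sum>i\<in>A. star (x i) * x i)"
  have sS: "star S = S" by (simp add: S_def star_sum star_mult star_star)
  have S: "S = star (x j) * x j + (\<Sum>i\<in>A - {j}. star (x i) * x i)"
    unfolding S_def using assms by (rule sum.remove)
  have "norm (star (x j) * x j) \<le> \<beta>" if "norm S < \<beta>" for \<beta>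
  proof (rule norm_le_if_pos_elem)
    show "0 < \<beta>" using that norm_ge_zero[of S] by linarith
    have "pos_elem ((of_real \<beta> - S) + (\<Sum>i\<in>A - {j}. star (x i) * x i))"
      using that \<open>0 < \<beta>\<close> sS
      by (intro pos_elem_add pos_elem_sum pos_elem_star_mult pos_elem_norm_diff) auto
    then show "pos_elem (of_real \<beta> - star (x j) * x j)" by (simp add: S)
  qed (rule pos_elem_star_mult)
  then have "norm (star (x j) * x j) \<le> norm S" by (meson dense_ge)
  then show ?thesis by (simp add: cstar_identity S_def)
qed

subsection \<open>States\<close>

lemma tracial_state_pos:
  assumes "tracial_state \<psi>" "pos_elem a"
  shows "0 \<le> Re (\<psi> a)" "Im (\<psi> a) = 0"
proof -
  obtain k where "star k = k" "k * k = a" using pos_elem_sqrt[OF assms(2)] by blast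
  then have "\<psi> a \<in> \<real>\<^sub>\<ge>\<^sub>0" using assms(1) unfolding tracial_state_def by metis
  then show "0 \<le> Re (\<psi> a)" "Im (\<psi> a) = 0" by (auto simp: complex_nonneg_Reals_iff)
qed

lemma
  assumes "tracial_state \<psi>"
  shows tracial_state_add: "\<psi> (x + y) = \<psi> x + \<psi> y"
    and tracial_state_scaleC: "\<psi> (scaleC c x) = c * \<psi> x"
    and tracial_state_one: "\<psi> 1 = 1"
    and tracial_state_commute: "\<psi> (x * y) = \<psi> (y * x)"
    and tracial_state_scaleR: "\<psi> (r *\<^sub>R x) = r *\<^sub>R \<psi> x"
    and tracial_state_diff: "\<psi> (x - y) = \<psi> x - \<psi> y"
proof -
  show add: "\<psi> (x + y) = \<psi> x + \<psi> y" for x y using assms by (simp add: tracial_state_def)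
  show scale: "\<psi> (scaleC c x) = c * \<psi> x" for c x using assms by (simp add: tracial_state_def)
  show "\<psi> 1 = 1" using assms by (simp add: tracial_state_def)
  show "\<psi> (x * y) = \<psi> (y * x)" using assms by (simp add: tracial_state_def)
  show "\<psi> (r *\<^sub>R x) = r *\<^sub>R \<psi> x"
    using scale[of "complex_of_real r" x] by (simp add: scaleC_of_real scaleR_conv_of_real)
  have m: "\<psi> (- x) = - \<psi> x" for x using scale[of "- 1" x] by (simp add: scaleC_minus_left)
  show "\<psi> (x - y) = \<psi> x - \<psi> y" using add[of x "- y"] by (simp add: m)
qed

text \<open>Positivity of \<open>\<beta> - a\<close> and \<open>\<beta> + a\<close> bounds the value
  from both sides. Taking \<open>\<beta>\<close> strictly above the norm keeps it positive even for
  \<open>a = 0\<close>.\<close>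

lemma tracial_state_selfadjoint:
  assumes "tracial_state \<psi>" "star a = a"
  shows "cmod (\<psi> a) \<le> norm a" "Im (\<psi> a) = 0"
proof -
  have *: "cmod (\<psi> a) \<le> \<beta> \<and> Im (\<psi> a) = 0" if "norm a < \<beta>" for \<beta>
  proof -
    have \<beta>: "0 < \<beta>" using that norm_ge_zero[of a] by linarith
    have eq: "\<psi> (of_real \<beta>) = of_real \<beta>"
      by (simp add: of_real_def tracial_state_scaleR[OF assms(1)] tracial_state_one[OF assms(1)])
    have "pos_elem (of_real \<beta> - a)" "pos_elem (of_real \<beta> - (- a))"
      using that \<beta> assms(2) by (intro pos_elem_norm_diff; simp add: star_minus)+
    from this[THEN tracial_state_pos(1)[OF assms(1)]] this[THEN tracial_state_pos(2)[OF assms(1)]]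
    show ?thesis
      using eq by (simp add: tracial_state_diff[OF assms(1)] tracial_state_add[OF assms(1)] cmod_eq_Re)
  qed
  show "Im (\<psi> a) = 0" using *[of "norm a + 1"] by simp
  show "cmod (\<psi> a) \<le> norm a" using * by (meson dense_ge)
qed

lemma selfadjoint_decomposition:
  fixes x :: "'b::cstar_algebra"
  obtains u v where "star u = u" "star v = v" "x = u + scaleC \<i> v" "norm u \<le> norm x" "norm v \<le> norm x"
proof
  define u v where "u = (1/2) *\<^sub>R (x + star x)" and "v = (1/2) *\<^sub>R scaleC (- \<i>) (x - star x)"
  show "star u = u" by (simp add: u_def star_scaleR star_add star_star add.commute)
  show "star v = v"
    by (simp add: v_def star_scaleR star_scaleC star_diff star_star scaleC_minus_left
        scaleC_diff_right)
  show "x = u + scaleC \<i> v"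
    by (simp add: u_def v_def scaleC_scaleR scaleC_scaleC scaleR_add_right[symmetric]
        scaleR_2[symmetric] del: scaleR_add_right)
  show "norm u \<le> norm x" using norm_triangle_ineq[of x "star x"] by (simp add: u_def)
  show "norm v \<le> norm x" using norm_triangle_ineq4[of x "star x"] by (simp add: v_def norm_scaleC)
qed

text \<open>The factor 2 comes from treating real and imaginary part separately. It is harmless,
  since the bound serves only continuity and exponential growth estimates.\<close>

lemma tracial_state_norm_le:
  assumes "tracial_state \<psi>"
  shows "cmod (\<psi> x) \<le> 2 * norm x"
proof -
  obtain u v where uv: "star u = u" "star v = v" "x = u + scaleC \<i> v" "norm u \<le> norm x" "norm v \<le> norm x"
    by (rule selfadjoint_decomposition)
  have "cmod (\<psi> x) \<le> cmod (\<psi> u) + cmod (\<psi> v)"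
    using norm_triangle_ineq[of "\<psi> u" "\<i> * \<psi> v"]
    by (simp add: uv(3) tracial_state_add[OF assms] tracial_state_scaleC[OF assms] norm_mult)
  with tracial_state_selfadjoint(1)[OF assms uv(1)] tracial_state_selfadjoint(1)[OF assms uv(2)] uv
  show ?thesis by linarith
qed

lemma tracial_state_star:
  assumes "tracial_state \<psi>"
  shows "\<psi> (star x) = cnj (\<psi> x)"
proof -
  obtain u v where uv: "star u = u" "star v = v" "x = u + scaleC \<i> v"
    by (rule selfadjoint_decomposition)
  have "star x = u - scaleC \<i> v" by (simp add: uv star_add star_scaleC scaleC_minus_left)
  then show ?thesis
    using tracial_state_selfadjoint(2)[OF assms uv(1)] tracial_state_selfadjoint(2)[OF assms uv(2)]
    by (simp add: uv(3) tracial_state_add[OF assms] tracial_state_diff[OF assms] tracial_state_scaleC[OF assms]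
        complex_eq_iff)
qed

lemma bounded_linear_tracial_state: "tracial_state \<psi> \<Longrightarrow> bounded_linear \<psi>"
  by (rule bounded_linear_intro[where K = 2])
     (auto simp: tracial_state_add tracial_state_scaleR tracial_state_norm_le mult.commute[of _ 2])

subsection \<open>Words and their splittings\<close>

text \<open>The common shape of Wick's formula, of formal derivatives of words and of the recursion
  by the partner of a letter. The summand is a function of both remainders, so that splittings of
  lists of words and of single words can be nested.\<close>

definition split_sum :: "('e list \<Rightarrow> 'e \<Rightarrow> 'e list \<Rightarrow> 'c::comm_monoid_add) \<Rightarrow> 'e list \<Rightarrow> 'c" where
  "split_sum \<Phi> w = (\<Sum>j<length w. \<Phi> (take j w) (w ! j) (drop (Suc j) w))"

lemma split_sum_Nil [simp]: "split_sum \<Phi> [] = 0"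
  by (simp add: split_sum_def)

lemma split_sum_Cons [simp]: "split_sum \<Phi> (x # xs) = \<Phi> [] x xs + split_sum (\<lambda>a. \<Phi> (x # a)) xs"
  by (simp add: split_sum_def sum.lessThan_Suc_shift del: sum.lessThan_Suc)

lemma split_sum_append:
  "split_sum \<Phi> (u @ w) = split_sum (\<lambda>a f b. \<Phi> a f (b @ w)) u + split_sum (\<lambda>a f b. \<Phi> (u @ a) f b) w"
  by (induction u arbitrary: \<Phi>) (auto simp: add.assoc)

lemma split_sum_cong:
  assumes "\<And>a f b. w = a @ f # b \<Longrightarrow> \<Phi> a f b = \<Psi> a f b"
  shows "split_sum \<Phi> w = split_sum \<Psi> w"
  unfolding split_sum_def by (rule sum.cong) (auto intro!: assms simp: id_take_nth_drop)

lemma split_sum_add: "split_sum (\<lambda>a f b. \<Phi> a f b + \<Psi> a f b) w = split_sum \<Phi> w + split_sum \<Psi> w"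
  by (simp add: split_sum_def sum.distrib)

lemma split_sum_mult_left: "split_sum (\<lambda>a f b. c * \<Phi> a f b) w = c * split_sum \<Phi> w"
  for c :: "'c::semiring_0"
  by (simp add: split_sum_def sum_distrib_left)

lemma split_sum_mult_right: "split_sum (\<lambda>a f b. \<Phi> a f b * c) w = split_sum \<Phi> w * c"
  for c :: "'c::semiring_0"
  by (simp add: split_sum_def sum_distrib_right)

lemma split_sum_sum: "split_sum (\<lambda>a f b. \<Sum>i\<in>I. \<Phi> i a f b) w = (\<Sum>i\<in>I. split_sum (\<Phi> i) w)"
  unfolding split_sum_def by (rule sum.swap)

subsection \<open>Non-crossing pairings\<close>

text \<open>Organised by the partner of the first letter: a non-crossing pairing restricts
  independently to the letters before and after this partner.\<close>

fun tau :: "('e \<Rightarrow> 'e \<Rightarrow> complex) \<Rightarrow> 'e list \<Rightarrow> complex" where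
  "tau s [] = 1"
| "tau s (e # w) = (\<Sum>j<length w. s e (w ! j) * tau s (take j w) * tau s (drop (Suc j) w))"

lemma tau_Cons: "tau s (e # w) = split_sum (\<lambda>a f b. s e f * tau s a * tau s b) w"
  by (simp add: split_sum_def)

declare tau.simps(2) [simp del]

text \<open>Pairings of an arbitrary set of naturals, so that the restrictions of a pairing to
  intervals are again of this kind.\<close>

definition ncp :: "nat set \<Rightarrow> nat set set set" where
  "ncp A = {\<pi>. partition_on A \<pi> \<and> (\<forall>V\<in>\<pi>. card V = 2) \<and>
     \<not> (\<exists>a b c e. a < b \<and> b < c \<and> c < e \<and> {a, c} \<in> \<pi> \<and> {b, e} \<in> \<pi>)}"

lemma ncp_partition: "\<pi> \<in> ncp A \<Longrightarrow> partition_on A \<pi>"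
  by (simp add: ncp_def)

lemma ncp_subset: "\<pi> \<in> ncp A \<Longrightarrow> V \<in> \<pi> \<Longrightarrow> V \<subseteq> A"
  by (auto simp: ncp_def partition_on_def)

lemma ncp_nonempty: "\<pi> \<in> ncp A \<Longrightarrow> V \<in> \<pi> \<Longrightarrow> V \<noteq> {}"
  by (auto simp: ncp_def partition_on_def)

lemma ncp_block: "\<pi> \<in> ncp A \<Longrightarrow> V \<in> \<pi> \<Longrightarrow> \<exists>x y. x < y \<and> V = {x, y}"
  by (auto simp: ncp_def card_2_iff) (metis insert_commute linorder_neqE_nat)

lemma ncp_no_crossing: "\<pi> \<in> ncp A \<Longrightarrow> {a, c} \<in> \<pi> \<Longrightarrow> {b, e} \<in> \<pi> \<Longrightarrow> a < b \<Longrightarrow> b < c \<Longrightarrow> c < e \<Longrightarrow> False"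
  unfolding ncp_def by blast

lemma ncp_disjoint: "\<pi> \<in> ncp A \<Longrightarrow> V \<in> \<pi> \<Longrightarrow> W \<in> \<pi> \<Longrightarrow> z \<in> V \<Longrightarrow> z \<in> W \<Longrightarrow> V = W"
  unfolding ncp_def partition_on_def disjoint_def by blast

lemma ncp_cover: "\<pi> \<in> ncp A \<Longrightarrow> z \<in> A \<Longrightarrow> \<exists>V\<in>\<pi>. z \<in> V"
  unfolding ncp_def partition_on_def by blast

lemma ncp_empty: "ncp {} = {{}}"
  by (auto simp: ncp_def partition_on_def)

lemma finite_ncp_elem: "finite A \<Longrightarrow> \<pi> \<in> ncp A \<Longrightarrow> finite \<pi>"
  using finite_elements ncp_partition by blast

lemma partition_on_disjoint_Un:
  assumes "A \<inter> B = {}" "partition_on A P" "partition_on B Q"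
  shows "partition_on (A \<union> B) (P \<union> Q)"
proof (rule partition_onI)
  note A = partition_onD1[OF assms(2)] and B = partition_onD1[OF assms(3)]
  show "\<Union>(P \<union> Q) = A \<union> B" using A B by blast
  show "{} \<notin> P \<union> Q" using partition_onD3[OF assms(2)] partition_onD3[OF assms(3)] by blast
  fix p q assume pq: "p \<in> P \<union> Q" "q \<in> P \<union> Q" "p \<noteq> q"
  then consider "p \<in> P" "q \<in> P" | "p \<in> Q" "q \<in> Q" | "p \<in> P" "q \<in> Q" | "p \<in> Q" "q \<in> P"
    by blast
  then show "disjnt p q"
  proof cases
    case 1
    then show ?thesis using partition_onD2[OF assms(2)] pq(3) by (simp add: disjoint_def disjnt_def)
  next
    case 2
    then show ?thesis using partition_onD2[OF assms(3)] pq(3) by (simp add: disjoint_def disjnt_def)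
  qed (use assms(1) A B in \<open>auto simp: disjnt_def\<close>)
qed

lemma insert_block_in_ncp:
  assumes "a < k" "k < b" "\<pi>\<^sub>1 \<in> ncp {Suc a..<k}" "\<pi>\<^sub>2 \<in> ncp {Suc k..<b}"
  shows "insert {a, k} (\<pi>\<^sub>1 \<union> \<pi>\<^sub>2) \<in> ncp {a..<b}"
proof -
  let ?\<pi> = "insert {a, k} (\<pi>\<^sub>1 \<union> \<pi>\<^sub>2)"
  note sub = ncp_subset[OF assms(3)] ncp_subset[OF assms(4)]
  have p: "partition_on ({Suc a..<k} \<union> {Suc k..<b}) (\<pi>\<^sub>1 \<union> \<pi>\<^sub>2)"
    by (rule partition_on_disjoint_Un[OF _ ncp_partition[OF assms(3)] ncp_partition[OF assms(4)]]) auto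
  have "partition_on ({a, k} \<union> ({Suc a..<k} \<union> {Suc k..<b})) ({{a, k}} \<union> (\<pi>\<^sub>1 \<union> \<pi>\<^sub>2))"
    by (rule partition_on_disjoint_Un[OF _ _ p]) (use assms(1) in \<open>auto simp: partition_on_def\<close>)
  moreover have "{a, k} \<union> ({Suc a..<k} \<union> {Suc k..<b}) = {a..<b}" using assms(1,2) by auto
  ultimately have "partition_on {a..<b} ?\<pi>" by simp
  moreover have "\<forall>V\<in>?\<pi>. card V = 2" using assms by (auto simp: ncp_def)
  moreover have False if cr: "x < y" "y < u" "u < v" "{x, u} \<in> ?\<pi>" "{y, v} \<in> ?\<pi>" for x y u v
  proof -
    have 1: "{x, u} = {a, k} \<or> {x, u} \<in> \<pi>\<^sub>1 \<and> {x, u} \<subseteq> {Suc a..<k} \<or> {x, u} \<in> \<pi>\<^sub>2 \<and> {x, u} \<subseteq> {Suc k..<b}"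
      using cr sub by blast
    have 2: "{y, v} = {a, k} \<or> {y, v} \<in> \<pi>\<^sub>1 \<and> {y, v} \<subseteq> {Suc a..<k} \<or> {y, v} \<in> \<pi>\<^sub>2 \<and> {y, v} \<subseteq> {Suc k..<b}"
      using cr sub by blast
    show False
      using 1 2 assms(1,2) cr(1-3) ncp_no_crossing[OF assms(3) _ _ cr(1-3)] ncp_no_crossing[OF assms(4) _ _ cr(1-3)]
      by (auto simp: doubleton_eq_iff)
  qed
  ultimately show ?thesis unfolding ncp_def by blast
qed

lemma ncp_interval_decompose:
  assumes "\<pi> \<in> ncp {a..<b}" "a < b"
  obtains k \<pi>\<^sub>1 \<pi>\<^sub>2 where "a < k" "k < b" "\<pi>\<^sub>1 \<in> ncp {Suc a..<k}" "\<pi>\<^sub>2 \<in> ncp {Suc k..<b}"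
    "\<pi> = insert {a, k} (\<pi>\<^sub>1 \<union> \<pi>\<^sub>2)"
proof -
  obtain V where V: "V \<in> \<pi>" "a \<in> V" using ncp_cover[OF assms(1), of a] assms(2) by auto
  then obtain x y where xy: "x < y" "V = {x, y}" using ncp_block[OF assms(1)] by blast
  with V ncp_subset[OF assms(1) V(1)] have "x = a" by force
  then obtain k where k: "{a, k} \<in> \<pi>" "a < k" using V xy by auto
  have kb: "k < b" using ncp_subset[OF assms(1) k(1)] by auto
  define \<pi>\<^sub>1 where "\<pi>\<^sub>1 = {V \<in> \<pi>. V \<subseteq> {Suc a..<k}}"
  define \<pi>\<^sub>2 where "\<pi>\<^sub>2 = {V \<in> \<pi>. V \<subseteq> {Suc k..<b}}"
  have cases: "V = {a, k} \<or> V \<in> \<pi>\<^sub>1 \<or> V \<in> \<pi>\<^sub>2" if V: "V \<in> \<pi>" for V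
  proof (rule ccontr)
    assume neg: "\<not> ?thesis"
    obtain x y where xy: "x < y" "V = {x, y}" using ncp_block[OF assms(1) V] by blast
    have "V \<inter> {a, k} = {}" using neg ncp_disjoint[OF assms(1) V k(1)] by blast
    moreover have "V \<subseteq> {a..<b}" using ncp_subset[OF assms(1) V] .
    ultimately have r: "a < x" "x \<noteq> k" "y \<noteq> k" "y < b" using xy by (auto simp: order_less_le)
    \<comment> \<open>A block with one point on each side of \<open>k\<close> would cross
      \<open>{a, k}\<close>.\<close>
    have "\<not> (x < k \<and> k < y)" using ncp_no_crossing[OF assms(1) k(1), of x y] r V xy by blast
    then show False using neg r xy V by (auto simp: \<pi>\<^sub>1_def \<pi>\<^sub>2_def)
  qed
  have sub: "\<pi>\<^sub>1 \<subseteq> \<pi>" "\<pi>\<^sub>2 \<subseteq> \<pi>" by (auto simp: \<pi>\<^sub>1_def \<pi>\<^sub>2_def)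
  have ncpI: "\<pi>' \<in> ncp B" if "\<pi>' \<subseteq> \<pi>" "\<Union>\<pi>' = B" for \<pi>' B
  proof -
    have "partition_on B \<pi>'"
    proof (rule partition_onI)
      show "\<Union>\<pi>' = B" using that(2) .
      show "{} \<notin> \<pi>'" using partition_onD3[OF ncp_partition[OF assms(1)]] that(1) by blast
      show "disjnt p q" if "p \<in> \<pi>'" "q \<in> \<pi>'" "p \<noteq> q" for p q
        using partition_onD2[OF ncp_partition[OF assms(1)]] that \<open>\<pi>' \<subseteq> \<pi>\<close>
        by (auto simp: disjoint_def disjnt_def)
    qed
    moreover have "\<forall>V\<in>\<pi>'. card V = 2" using assms(1) that(1) unfolding ncp_def by blast
    ultimately show ?thesis
      unfolding ncp_def using ncp_no_crossing[OF assms(1)] that(1) by blast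
  qed
  have "\<Union>\<pi>\<^sub>1 = {Suc a..<k}"
  proof
    show "{Suc a..<k} \<subseteq> \<Union>\<pi>\<^sub>1"
    proof
      fix z assume z: "z \<in> {Suc a..<k}"
      then obtain V where V: "V \<in> \<pi>" "z \<in> V" using ncp_cover[OF assms(1), of z] kb by auto
      then show "z \<in> \<Union>\<pi>\<^sub>1" using cases[OF V(1)] z by (auto simp: \<pi>\<^sub>2_def)
    qed
  qed (auto simp: \<pi>\<^sub>1_def)
  moreover have "\<Union>\<pi>\<^sub>2 = {Suc k..<b}"
  proof
    show "{Suc k..<b} \<subseteq> \<Union>\<pi>\<^sub>2"
    proof
      fix z assume z: "z \<in> {Suc k..<b}"
      then obtain V where V: "V \<in> \<pi>" "z \<in> V" using ncp_cover[OF assms(1), of z] k by auto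
      then show "z \<in> \<Union>\<pi>\<^sub>2" using cases[OF V(1)] z k by (auto simp: \<pi>\<^sub>1_def)
    qed
  qed (auto simp: \<pi>\<^sub>2_def)
  moreover have "\<pi> = insert {a, k} (\<pi>\<^sub>1 \<union> \<pi>\<^sub>2)" using cases sub k(1) by blast
  ultimately show thesis using that[of k \<pi>\<^sub>1 \<pi>\<^sub>2] k(2) kb ncpI[OF sub(1)] ncpI[OF sub(2)] by blast
qed

lemma bij_betw_ncp_interval:
  assumes "a < b"
  shows "bij_betw (\<lambda>(k, \<pi>\<^sub>1, \<pi>\<^sub>2). insert {a, k} (\<pi>\<^sub>1 \<union> \<pi>\<^sub>2))
    (SIGMA k:{a<..<b}. ncp {Suc a..<k} \<times> ncp {Suc k..<b}) (ncp {a..<b})"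
  unfolding bij_betw_def
proof
  \<comment> \<open>The two parts can be read off from their union because the intervals are
    disjoint and no block is empty.\<close>
  have recover: "\<pi>\<^sub>1 = {V \<in> insert {a, k} (\<pi>\<^sub>1 \<union> \<pi>\<^sub>2). V \<subseteq> {Suc a..<k}}"
      "\<pi>\<^sub>2 = {V \<in> insert {a, k} (\<pi>\<^sub>1 \<union> \<pi>\<^sub>2). V \<subseteq> {Suc k..<b}}"
    if "a < k" "\<pi>\<^sub>1 \<in> ncp {Suc a..<k}" "\<pi>\<^sub>2 \<in> ncp {Suc k..<b}" for k \<pi>\<^sub>1 \<pi>\<^sub>2
    using that ncp_subset[OF that(2)] ncp_subset[OF that(3)]
      ncp_nonempty[OF that(2)] ncp_nonempty[OF that(3)] by (fastforce)+
  show "inj_on (\<lambda>(k, \<pi>\<^sub>1, \<pi>\<^sub>2). insert {a, k} (\<pi>\<^sub>1 \<union> \<pi>\<^sub>2))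
    (SIGMA k:{a<..<b}. ncp {Suc a..<k} \<times> ncp {Suc k..<b})"
  proof (rule inj_onI, clarsimp)
    fix k \<pi>\<^sub>1 \<pi>\<^sub>2 k' \<pi>\<^sub>1' \<pi>\<^sub>2'
    assume k: "a < k" "k < b" "a < k'" "k' < b"
      and p: "\<pi>\<^sub>1 \<in> ncp {Suc a..<k}" "\<pi>\<^sub>2 \<in> ncp {Suc k..<b}"
        "\<pi>\<^sub>1' \<in> ncp {Suc a..<k'}" "\<pi>\<^sub>2' \<in> ncp {Suc k'..<b}"
      and eq: "insert {a, k} (\<pi>\<^sub>1 \<union> \<pi>\<^sub>2) = insert {a, k'} (\<pi>\<^sub>1' \<union> \<pi>\<^sub>2')"
    have "{a, k} = {a, k'}"
      by (rule ncp_disjoint[OF insert_block_in_ncp[OF k(1,2) p(1,2)], of _ _ a]) (use eq in auto)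
    then have kk: "k = k'" by (auto simp: doubleton_eq_iff)
    have "\<pi>\<^sub>1 = \<pi>\<^sub>1'"
      using recover(1)[OF k(1) p(1,2)] recover(1)[OF k(3) p(3,4)] eq kk by metis
    moreover have "\<pi>\<^sub>2 = \<pi>\<^sub>2'"
      using recover(2)[OF k(1) p(1,2)] recover(2)[OF k(3) p(3,4)] eq kk by metis
    ultimately show "k = k' \<and> \<pi>\<^sub>1 = \<pi>\<^sub>1' \<and> \<pi>\<^sub>2 = \<pi>\<^sub>2'" using kk by blast
  qed
  show "(\<lambda>(k, \<pi>\<^sub>1, \<pi>\<^sub>2). insert {a, k} (\<pi>\<^sub>1 \<union> \<pi>\<^sub>2)) `
    (SIGMA k:{a<..<b}. ncp {Suc a..<k} \<times> ncp {Suc k..<b}) = ncp {a..<b}"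
  proof (intro equalityI subsetI)
    fix \<pi> assume "\<pi> \<in> ncp {a..<b}"
    from ncp_interval_decompose[OF this assms] obtain k \<pi>\<^sub>1 \<pi>\<^sub>2 where "a < k" "k < b"
      "\<pi>\<^sub>1 \<in> ncp {Suc a..<k}" "\<pi>\<^sub>2 \<in> ncp {Suc k..<b}" "\<pi> = insert {a, k} (\<pi>\<^sub>1 \<union> \<pi>\<^sub>2)" by metis
    then show "\<pi> \<in> (\<lambda>(k, \<pi>\<^sub>1, \<pi>\<^sub>2). insert {a, k} (\<pi>\<^sub>1 \<union> \<pi>\<^sub>2)) `
      (SIGMA k:{a<..<b}. ncp {Suc a..<k} \<times> ncp {Suc k..<b})"
      by (intro image_eqI[of _ _ "(k, \<pi>\<^sub>1, \<pi>\<^sub>2)"]) auto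
  qed (auto intro: insert_block_in_ncp)
qed

lemma sum_ncp_interval:
  fixes a b :: nat
  shows "(\<Sum>\<pi>\<in>ncp {a..<b}. \<Prod>V\<in>\<pi>. s (e (Min V)) (e (Max V))) = tau s (map e [a..<b])"
proof (induction "b - a" arbitrary: a b rule: less_induct)
  case less
  define W where "W \<pi> = (\<Prod>V\<in>\<pi>. s (e (Min V)) (e (Max V)))" for \<pi> :: "nat set set"
  show ?case
  proof (cases "a < b")
    case False
    then show ?thesis by (simp add: ncp_empty)
  next
    case True
    have W: "W (insert {a, k} (\<pi>\<^sub>1 \<union> \<pi>\<^sub>2)) = s (e a) (e k) * W \<pi>\<^sub>1 * W \<pi>\<^sub>2"
      if k: "a < k" and p: "\<pi>\<^sub>1 \<in> ncp {Suc a..<k}" "\<pi>\<^sub>2 \<in> ncp {Suc k..<b}" for k \<pi>\<^sub>1 \<pi>\<^sub>2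
    proof -
      have fin: "finite \<pi>\<^sub>1" "finite \<pi>\<^sub>2" using p by (auto intro: finite_ncp_elem)
      have "\<pi>\<^sub>1 \<inter> \<pi>\<^sub>2 = {}"
        using ncp_subset[OF p(1)] ncp_subset[OF p(2)] ncp_nonempty[OF p(1)] by fastforce
      moreover have "{a, k} \<notin> \<pi>\<^sub>1 \<union> \<pi>\<^sub>2"
        using ncp_subset[OF p(1)] ncp_subset[OF p(2)] by fastforce
      ultimately show ?thesis
        using fin k by (simp add: W_def prod.union_disjoint mult.assoc)
    qed
    have fin: "finite (ncp A)" if "finite A" for A
      by (rule finite_subset[of _ "Pow (Pow A)"]) (use that ncp_subset in auto)
    have IH: "(\<Sum>\<pi>\<in>ncp {a'..<b'}. W \<pi>) = tau s (map e [a'..<b'])" if "b' - a' < b - a" for a' b'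
      using less[OF that] by (simp add: W_def)
    have "(\<Sum>\<pi>\<in>ncp {a..<b}. W \<pi>) =
      (\<Sum>(k, \<pi>\<^sub>1, \<pi>\<^sub>2)\<in>(SIGMA k:{a<..<b}. ncp {Suc a..<k} \<times> ncp {Suc k..<b}). W (insert {a, k} (\<pi>\<^sub>1 \<union> \<pi>\<^sub>2)))"
      by (subst sum.reindex_bij_betw[OF bij_betw_ncp_interval[OF True], symmetric])
         (simp add: case_prod_beta)
    also have "\<dots> = (\<Sum>(k, \<pi>\<^sub>1, \<pi>\<^sub>2)\<in>(SIGMA k:{a<..<b}. ncp {Suc a..<k} \<times> ncp {Suc k..<b}).
        s (e a) (e k) * W \<pi>\<^sub>1 * W \<pi>\<^sub>2)"
      by (rule sum.cong) (auto simp: W)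
    also have "\<dots> = (\<Sum>k\<in>{a<..<b}. s (e a) (e k) * (\<Sum>\<pi>\<in>ncp {Suc a..<k}. W \<pi>) * (\<Sum>\<pi>\<in>ncp {Suc k..<b}. W \<pi>))"
    proof -
      have "(\<Sum>(\<pi>\<^sub>1, \<pi>\<^sub>2)\<in>A \<times> B. c * W \<pi>\<^sub>1 * W \<pi>\<^sub>2) = c * sum W A * sum W B" for A B c
        by (simp add: sum.cartesian_product[symmetric] mult.assoc sum_distrib_left[symmetric]
            sum_distrib_right[symmetric])
      then show ?thesis
        by (subst sum.Sigma[symmetric]) (auto intro!: fin)
    qed
    also have "\<dots> = (\<Sum>k\<in>{a<..<b}. s (e a) (e k) * tau s (map e [Suc a..<k]) * tau s (map e [Suc k..<b]))"
      by (rule sum.cong) (auto simp: IH)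
    \<comment> \<open>The partner \<open>k\<close> becomes its position \<open>j\<close> in the word
      without its first letter.\<close>
    also have "\<dots> = (\<Sum>j<b - Suc a. s (e a) (e (Suc a + j)) * tau s (map e [Suc a..<Suc a + j]) *
        tau s (map e [Suc (Suc a + j)..<b]))"
      by (rule sum.reindex_bij_witness[of _ "\<lambda>j. Suc a + j" "\<lambda>k. k - Suc a"]) auto
    also have "\<dots> = tau s (e a # map e [Suc a..<b])"
      unfolding tau.simps
      by (rule sum.cong) (auto simp: take_map drop_map take_upt drop_upt add.commute)
    also have "e a # map e [Suc a..<b] = map e [a..<b]" using True by (simp add: upt_conv_Cons)
    finally show ?thesis by (simp add: W_def)
  qed
qed

definition cov_letters :: "'d covariance \<Rightarrow> 'd \<times> 'd \<Rightarrow> 'd \<times> 'd \<Rightarrow> complex" where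
  "cov_letters \<sigma> e f = complex_of_real (\<sigma> (fst e) (snd e) (fst f) (snd f))"

definition word_val :: "'b::monoid_mult^'d^'d \<Rightarrow> ('d::finite \<times> 'd) list \<Rightarrow> 'b" where
  "word_val Y w = prod_list (map (\<lambda>e. Y $ fst e $ snd e) w)"

lemma word_val_Nil [simp]: "word_val Y [] = 1"
  and word_val_Cons [simp]: "word_val Y (e # w) = Y $ fst e $ snd e * word_val Y w"
  and word_val_append: "word_val Y (u @ w) = word_val Y u * word_val Y w"
  by (auto simp: word_val_def)

lemma semicircular_word:
  assumes "semicircular_family \<sigma> \<psi> Y"
  shows "\<psi> (word_val Y w) = tau (cov_letters \<sigma>) w"
proof -
  \<comment> \<open>Pairings count positions from 1, list indices from 0.\<close>
  define e where "e k = w ! (k - 1)" for k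
  define m where "m = length w"
  have w: "map e [1..<m + 1] = w"
    by (rule nth_equalityI) (auto simp: m_def e_def simp del: upt_Suc)
  have "word_val Y w = (\<Prod>k\<leftarrow>[1..<m + 1]. Y $ fst (e k) $ snd (e k))"
    unfolding word_val_def by (subst w[symmetric]) (simp add: comp_def del: upt_Suc)
  then have "\<psi> (word_val Y w) =
     (\<Sum>\<pi>\<in>nc_pairings m. \<Prod>V\<in>\<pi>. cov_letters \<sigma> (e (Min V)) (e (Max V)))"
    using assms unfolding semicircular_family_def cov_letters_def by simp
  moreover have "nc_pairings m = ncp {1..<m + 1}"
    by (simp add: nc_pairings_def ncp_def atLeastLessThanSuc_atLeastAtMost)
  ultimately show ?thesis using sum_ncp_interval[of "cov_letters \<sigma>" e 1 "m + 1"] w by simp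
qed

subsection \<open>Random variables with finite moments\<close>

text \<open>All orders are required at once, because products of such variables must stay in the
  class.\<close>

definition finite_moments :: "'a measure \<Rightarrow> ('a \<Rightarrow> complex) \<Rightarrow> bool" where
  "finite_moments M f \<longleftrightarrow> f \<in> borel_measurable M \<and> (\<forall>k. integrable M (\<lambda>\<omega>. norm (f \<omega>) ^ k))"

lemma finite_moments_integrable: "finite_moments M f \<Longrightarrow> integrable M f"
proof -
  assume f: "finite_moments M f"
  then have "integrable M (\<lambda>\<omega>. norm (f \<omega>) ^ 1)" unfolding finite_moments_def by blast
  with f show ?thesis by (simp add: finite_moments_def integrable_norm_iff)
qed

lemma (in prob_space) finite_moments_const [simp]: "finite_moments M (\<lambda>\<omega>. c)"
  by (auto simp: finite_moments_def)

text \<open>The bound \<open>|f g|^k \<le> |f|^(2 k) + |g|^(2 k)\<close> reduces products to moments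
  of the factors.\<close>

lemma finite_moments_mult:
  assumes "finite_moments M f" "finite_moments M g"
  shows "finite_moments M (\<lambda>\<omega>. f \<omega> * g \<omega>)"
  unfolding finite_moments_def
proof (intro conjI allI)
  have [measurable]: "f \<in> borel_measurable M" "g \<in> borel_measurable M"
    using assms by (auto simp: finite_moments_def)
  show "(\<lambda>\<omega>. f \<omega> * g \<omega>) \<in> borel_measurable M" by measurable
  fix k
  show "integrable M (\<lambda>\<omega>. norm (f \<omega> * g \<omega>) ^ k)"
  proof (rule Bochner_Integration.integrable_bound)
    show "integrable M (\<lambda>\<omega>. norm (f \<omega>) ^ (2 * k) + norm (g \<omega>) ^ (2 * k))"
      using assms by (auto simp: finite_moments_def)
    have "x * y \<le> x\<^sup>2 + y\<^sup>2" if "0 \<le> x" "0 \<le> y" for x y :: real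
      using sum_squares_bound[of x y] mult_nonneg_nonneg[OF that] by (simp add: mult.assoc)
    then show "AE \<omega> in M. norm (norm (f \<omega> * g \<omega>) ^ k) \<le> norm (norm (f \<omega>) ^ (2 * k) + norm (g \<omega>) ^ (2 * k))"
      by (intro AE_I2) (simp add: norm_mult power_mult_distrib power_mult mult.commute[of 2])
  qed measurable
qed

lemma finite_moments_add:
  assumes "finite_moments M f" "finite_moments M g"
  shows "finite_moments M (\<lambda>\<omega>. f \<omega> + g \<omega>)"
  unfolding finite_moments_def
proof (intro conjI allI)
  have [measurable]: "f \<in> borel_measurable M" "g \<in> borel_measurable M"
    using assms by (auto simp: finite_moments_def)
  show "(\<lambda>\<omega>. f \<omega> + g \<omega>) \<in> borel_measurable M" by measurable
  fix k
  show "integrable M (\<lambda>\<omega>. norm (f \<omega> + g \<omega>) ^ k)"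
  proof (rule Bochner_Integration.integrable_bound)
    show "integrable M (\<lambda>\<omega>. 2 ^ k * (norm (f \<omega>) ^ k + norm (g \<omega>) ^ k))"
      using assms by (auto simp: finite_moments_def)
    have *: "norm (x + y) ^ k \<le> 2 ^ k * (norm x ^ k + norm y ^ k)" for x y :: complex
    proof -
      have "norm (x + y) \<le> 2 * max (norm x) (norm y)"
        using norm_triangle_ineq[of x y] by linarith
      then have "norm (x + y) ^ k \<le> (2 * max (norm x) (norm y)) ^ k" by (rule power_mono) simp
      also have "\<dots> \<le> 2 ^ k * (norm x ^ k + norm y ^ k)"
        by (auto simp: power_mult_distrib max_def)
      finally show ?thesis .
    qed
    show "AE \<omega> in M. norm (norm (f \<omega> + g \<omega>) ^ k) \<le> norm (2 ^ k * (norm (f \<omega>) ^ k + norm (g \<omega>) ^ k))"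
      by (intro AE_I2) (use * in simp)
  qed measurable
qed

lemma (in prob_space) finite_moments_cmult: "finite_moments M f \<Longrightarrow> finite_moments M (\<lambda>\<omega>. c * f \<omega>)"
  by (intro finite_moments_mult) auto

lemma (in prob_space) finite_moments_sum:
  "(\<And>i. i \<in> A \<Longrightarrow> finite_moments M (f i)) \<Longrightarrow> finite_moments M (\<lambda>\<omega>. \<Sum>i\<in>A. f i \<omega>)"
  by (induction A rule: infinite_finite_induct) (auto intro: finite_moments_add)

lemma (in prob_space) finite_moments_power:
  "finite_moments M f \<Longrightarrow> finite_moments M (\<lambda>\<omega>. f \<omega> ^ n)"
  by (induction n) (auto intro: finite_moments_mult)

lemma (in prob_space) finite_moments_prod_list:
  "(\<And>z. z \<in> set zs \<Longrightarrow> finite_moments M (f z)) \<Longrightarrow> finite_moments M (\<lambda>\<omega>. \<Prod>z\<leftarrow>zs. f z \<omega>)"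
  by (induction zs) (auto intro: finite_moments_mult)

subsection \<open>Moments of centred Gaussian variables\<close>

text \<open>The second claim is integration by parts for one variable. It is read off from the
  explicit even and odd normal moments.\<close>

lemma (in prob_space) gaussian_rv_moments:
  assumes "gaussian_rv M Y" "expectation Y = 0"
  shows "integrable M (\<lambda>\<omega>. Y \<omega> ^ n)"
    and "expectation (\<lambda>\<omega>. Y \<omega> ^ Suc (Suc n)) =
      real (Suc n) * expectation (\<lambda>\<omega>. (Y \<omega>)\<^sup>2) * expectation (\<lambda>\<omega>. Y \<omega> ^ n)"
proof -
  have [measurable]: "Y \<in> borel_measurable M" using assms(1) by (simp add: gaussian_rv_def)
  consider (const) m where "AE \<omega> in M. Y \<omega> = m"
    | (normal) m s where "0 < s" "distributed M lborel Y (\<lambda>x. ennreal (normal_density m s x))"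
    using assms(1) by (auto simp: gaussian_rv_def)
  then have "integrable M (\<lambda>\<omega>. Y \<omega> ^ n) \<and> expectation (\<lambda>\<omega>. Y \<omega> ^ Suc (Suc n)) =
      real (Suc n) * expectation (\<lambda>\<omega>. (Y \<omega>)\<^sup>2) * expectation (\<lambda>\<omega>. Y \<omega> ^ n)"
  proof cases
    case const
    \<comment> \<open>With mean 0 the constant must be 0, and both sides of the recursion
      vanish.\<close>
    have "expectation Y = expectation (\<lambda>_. m)" using const by (intro integral_cong_AE) auto
    then have "m = 0" using assms(2) prob_space by simp
    then have *: "AE \<omega> in M. Y \<omega> ^ k = 0 ^ k" for k using const by (auto elim: eventually_mono)
    have "expectation (\<lambda>\<omega>. Y \<omega> ^ k) = expectation (\<lambda>_. 0 ^ k)" for k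
      using * by (intro integral_cong_AE) auto
    moreover have "integrable M (\<lambda>\<omega>. Y \<omega> ^ n)"
      using integrable_cong_AE[of "\<lambda>\<omega>. Y \<omega> ^ n" M "\<lambda>_. 0 ^ n"] *[of n] by auto
    ultimately show ?thesis using prob_space by (auto simp del: power_Suc)
  next
    case normal
    have "m = 0" using normal_distributed_expectation[OF normal] assms(2) by simp
    note dist = normal(2)[unfolded \<open>m = 0\<close>]
    have int: "integrable M (\<lambda>\<omega>. Y \<omega> ^ k)" for k
      using distributed_integrable[OF dist, of "\<lambda>x. x ^ k"] integrable_normal_moment[OF normal(1), of 0 k]
      by simp
    have ex: "expectation (\<lambda>\<omega>. Y \<omega> ^ k) = integral\<^sup>L lborel (\<lambda>x. normal_density 0 s x * x ^ k)" for k
      using distributed_integral[OF dist, of "\<lambda>x. x ^ k"] by simp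
    have even: "expectation (\<lambda>\<omega>. Y \<omega> ^ (2 * k)) = fact (2 * k) / ((2 / s\<^sup>2) ^ k * fact k)" for k
      using integral_normal_moment_even[OF normal(1), of 0 k] by (simp add: ex)
    have odd: "expectation (\<lambda>\<omega>. Y \<omega> ^ (2 * k + 1)) = 0" for k
      unfolding ex using integral_normal_moment_odd[OF normal(1), of 0 k] by simp
    have sq: "expectation (\<lambda>\<omega>. (Y \<omega>)\<^sup>2) = s\<^sup>2" using even[of 1] by (simp add: fact_2)
    show ?thesis
    proof (cases "Parity.even n")
      case True
      then obtain k where k: "n = 2 * k" by (elim evenE)
      have 2: "Suc (Suc n) = 2 * Suc k" by (simp add: k)
      have f: "fact (2 * Suc k) = (2 * (real k + 1)) * (2 * real k + 1) * fact (2 * k)"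
        by (simp add: algebra_simps)
      have g: "(2 / s\<^sup>2) ^ Suc k * fact (Suc k) = (2 / s\<^sup>2) * (real k + 1) * ((2 / s\<^sup>2) ^ k * fact k)"
        by (simp add: algebra_simps)
      have alg: "(2 * (x + 1)) * (2 * x + 1) * F / ((2 / s\<^sup>2) * (x + 1) * P) = (2 * x + 1) * s\<^sup>2 * (F / P)"
        if "x \<ge> 0" for x F P :: real
      proof -
        have "x + 1 \<noteq> 0" "s\<^sup>2 \<noteq> 0" using that normal(1) by auto
        then show ?thesis by simp
      qed
      have "expectation (\<lambda>\<omega>. Y \<omega> ^ Suc (Suc n)) = (2 * real k + 1) * s\<^sup>2 * (fact (2 * k) / ((2 / s\<^sup>2) ^ k * fact k))"
        unfolding 2 even f g by (rule alg) simp
      then show ?thesis using int unfolding sq unfolding k even by (simp add: add.commute)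
    next
      case False
      then obtain k where k: "n = 2 * k + 1" by (elim oddE)
      have 2: "Suc (Suc n) = 2 * Suc k + 1" by (simp add: k)
      show ?thesis using int[of "2 * k + 1"] unfolding 2 odd unfolding k odd by simp
    qed
  qed
  then show "integrable M (\<lambda>\<omega>. Y \<omega> ^ n)" "expectation (\<lambda>\<omega>. Y \<omega> ^ Suc (Suc n)) =
      real (Suc n) * expectation (\<lambda>\<omega>. (Y \<omega>)\<^sup>2) * expectation (\<lambda>\<omega>. Y \<omega> ^ n)" by auto
qed

subsection \<open>Wick's formula\<close>

text \<open>Joint Gaussianity enters in coordinate-free form: a family of centred Gaussian variables
  closed under \<open>u + t v\<close>. Moving along such lines is what polarization needs.\<close>

locale gaussian_space = prob_space M for M :: "'a measure" +
  fixes V :: "('a \<Rightarrow> real) set"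
  assumes lin: "u \<in> V \<Longrightarrow> v \<in> V \<Longrightarrow> (\<lambda>\<omega>. u \<omega> + t * v \<omega>) \<in> V"
    and gauss: "v \<in> V \<Longrightarrow> gaussian_rv M v"
    and mean: "v \<in> V \<Longrightarrow> expectation v = 0"
begin

definition CV :: "('a \<Rightarrow> complex) set" where
  "CV = {Z. (\<lambda>\<omega>. Re (Z \<omega>)) \<in> V \<and> (\<lambda>\<omega>. Im (Z \<omega>)) \<in> V}"

abbreviation EE :: "('a \<Rightarrow> complex) \<Rightarrow> complex" where "EE f \<equiv> integral\<^sup>L M f"

lemma finite_moments_real:
  assumes "v \<in> V"
  shows "finite_moments M (\<lambda>\<omega>. complex_of_real (v \<omega>))"
  unfolding finite_moments_def
proof (intro conjI allI)
  have [measurable]: "v \<in> borel_measurable M" using gauss[OF assms] by (simp add: gaussian_rv_def)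
  show "(\<lambda>\<omega>. complex_of_real (v \<omega>)) \<in> borel_measurable M" by measurable
  fix k
  have "integrable M (\<lambda>\<omega>. \<bar>v \<omega> ^ k\<bar>)"
    using gaussian_rv_moments(1)[OF gauss[OF assms] mean[OF assms]] by (rule integrable_abs)
  then show "integrable M (\<lambda>\<omega>. cmod (complex_of_real (v \<omega>)) ^ k)" by (simp add: power_abs)
qed

lemma finite_moments_CV:
  assumes "Z \<in> CV"
  shows "finite_moments M Z"
proof -
  have "finite_moments M (\<lambda>\<omega>. complex_of_real (Re (Z \<omega>)) + \<i> * complex_of_real (Im (Z \<omega>)))"
    using assms by (intro finite_moments_add finite_moments_cmult finite_moments_real) (auto simp: CV_def)
  then show ?thesis by (simp add: complex_eq[symmetric])
qed

lemma EE_add: "finite_moments M f \<Longrightarrow> finite_moments M g \<Longrightarrow> EE (\<lambda>\<omega>. f \<omega> + g \<omega>) = EE f + EE g"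
  by (intro Bochner_Integration.integral_add finite_moments_integrable)

lemma EE_sum: "(\<And>i. i \<in> A \<Longrightarrow> finite_moments M (f i)) \<Longrightarrow> EE (\<lambda>\<omega>. \<Sum>i\<in>A. f i \<omega>) = (\<Sum>i\<in>A. EE (f i))"
  by (intro Bochner_Integration.integral_sum finite_moments_integrable)

lemma EE_cmult: "EE (\<lambda>\<omega>. c * f \<omega>) = c * EE f"
  by simp

abbreviation cr :: "('a \<Rightarrow> real) \<Rightarrow> 'a \<Rightarrow> complex" where "cr v \<omega> \<equiv> complex_of_real (v \<omega>)"

text \<open>The expectation is a polynomial in \<open>t\<close>. Peeling off one factor
  \<open>S + t U\<close> at a time turns this into an induction with the product rule, and no
  differentiation under the integral is required.\<close>

lemma EE_power_derivative:
  assumes "S \<in> V" "U \<in> V" "finite_moments M H"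
  shows "((\<lambda>t. EE (\<lambda>\<omega>. cr (\<lambda>\<omega>. S \<omega> + t * U \<omega>) \<omega> ^ n * H \<omega>)) has_vector_derivative
    of_nat n * EE (\<lambda>\<omega>. cr S \<omega> ^ (n - 1) * cr U \<omega> * H \<omega>)) (at 0)"
  using assms(3)
proof (induction n arbitrary: H)
  case 0
  then show ?case by simp
next
  case (Suc n)
  note fm = finite_moments_mult finite_moments_power finite_moments_real lin assms(1,2) Suc.prems
    finite_moments_cmult
  let ?S = "\<lambda>t \<omega>. cr (\<lambda>\<omega>. S \<omega> + t * U \<omega>) \<omega>"
  let ?F = "\<lambda>H t. EE (\<lambda>\<omega>. ?S t \<omega> ^ n * H \<omega>)"
  have "EE (\<lambda>\<omega>. ?S t \<omega> ^ Suc n * H \<omega>) = ?F (\<lambda>\<omega>. cr S \<omega> * H \<omega>) t + t *\<^sub>R ?F (\<lambda>\<omega>. cr U \<omega> * H \<omega>) t" for t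
  proof -
    have "EE (\<lambda>\<omega>. ?S t \<omega> ^ Suc n * H \<omega>) =
      EE (\<lambda>\<omega>. ?S t \<omega> ^ n * (cr S \<omega> * H \<omega>) + complex_of_real t * (?S t \<omega> ^ n * (cr U \<omega> * H \<omega>)))"
      by (simp add: algebra_simps)
    also have "\<dots> = ?F (\<lambda>\<omega>. cr S \<omega> * H \<omega>) t + EE (\<lambda>\<omega>. complex_of_real t * (?S t \<omega> ^ n * (cr U \<omega> * H \<omega>)))"
      by (rule EE_add) (intro fm)+
    finally show ?thesis by (simp add: scaleR_conv_of_real)
  qed
  moreover have "((\<lambda>t. ?F (\<lambda>\<omega>. cr S \<omega> * H \<omega>) t + t *\<^sub>R ?F (\<lambda>\<omega>. cr U \<omega> * H \<omega>) t) has_vector_derivative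
      (of_nat n * EE (\<lambda>\<omega>. cr S \<omega> ^ (n - 1) * cr U \<omega> * (cr S \<omega> * H \<omega>)) +
      (0 *\<^sub>R (of_nat n * EE (\<lambda>\<omega>. cr S \<omega> ^ (n - 1) * cr U \<omega> * (cr U \<omega> * H \<omega>))) + 1 *\<^sub>R ?F (\<lambda>\<omega>. cr U \<omega> * H \<omega>) 0))) (at 0)"
    by (intro has_vector_derivative_add has_vector_derivative_scaleR Suc.IH fm DERIV_ident)
  moreover have "of_nat n * EE (\<lambda>\<omega>. cr S \<omega> ^ (n - 1) * cr U \<omega> * (cr S \<omega> * H \<omega>)) =
      of_nat n * EE (\<lambda>\<omega>. cr S \<omega> ^ n * cr U \<omega> * H \<omega>)"
    by (cases n) (auto simp: mult_ac)
  ultimately show ?case by (cases "n = 0") (simp_all add: mult_ac distrib_right add_ac)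
qed

text \<open>Polarization of the one-variable recursion: differentiate
  \<open>E (S + t A)^(m+1) = m E (S + t A)^2 E (S + t A)^(m-1)\<close> at
  \<open>t = 0\<close>.\<close>

lemma wick_power:
  assumes "A \<in> V" "S \<in> V"
  shows "EE (\<lambda>\<omega>. cr A \<omega> * cr S \<omega> ^ m) =
    of_nat m * EE (\<lambda>\<omega>. cr A \<omega> * cr S \<omega>) * EE (\<lambda>\<omega>. cr S \<omega> ^ (m - 1))"
proof (induction m rule: less_induct)
  case (less m)
  have rec: "EE (\<lambda>\<omega>. cr v \<omega> ^ Suc (Suc n)) = of_nat (Suc n) * EE (\<lambda>\<omega>. cr v \<omega> ^ 2) * EE (\<lambda>\<omega>. cr v \<omega> ^ n)"
    if "v \<in> V" for v n
  proof -
    have *: "EE (\<lambda>\<omega>. cr v \<omega> ^ k) = complex_of_real (expectation (\<lambda>\<omega>. v \<omega> ^ k))" for k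
      using integral_complex_of_real[of M "\<lambda>\<omega>. v \<omega> ^ k"] by simp
    show ?thesis
      unfolding * using gaussian_rv_moments(2)[OF gauss[OF that] mean[OF that], of n] by simp
  qed
  have mean0: "EE (cr v) = 0" if "v \<in> V" for v
    using mean[OF that] integral_complex_of_real[of M v] by simp
  consider "m = 0" | "m = 1" | k where "m = Suc (Suc k)" by (metis not0_implies_Suc One_nat_def)
  then show ?case
  proof cases
    case 1
    then show ?thesis using mean0[OF assms(1)] by simp
  next
    case 2
    then show ?thesis using prob_space by simp
  next
    case (3 k)
    let ?S = "\<lambda>t \<omega>. cr (\<lambda>\<omega>. S \<omega> + t * A \<omega>) \<omega>"
    note der = EE_power_derivative[OF assms(2,1) finite_moments_const[of 1], simplified]
    have eq: "EE (\<lambda>\<omega>. ?S t \<omega> ^ Suc m) = of_nat m * EE (\<lambda>\<omega>. ?S t \<omega> ^ 2) * EE (\<lambda>\<omega>. ?S t \<omega> ^ Suc k)" for t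
      using rec[of "\<lambda>\<omega>. S \<omega> + t * A \<omega>" "Suc k"] lin[OF assms(2,1)] 3 by simp
    have "((\<lambda>t. EE (\<lambda>\<omega>. ?S t \<omega> ^ Suc m)) has_vector_derivative of_nat (Suc m) * EE (\<lambda>\<omega>. cr S \<omega> ^ m * cr A \<omega>)) (at 0)"
      using der[of "Suc m"] by simp
    moreover have "((\<lambda>t. of_nat m * (EE (\<lambda>\<omega>. ?S t \<omega> ^ 2) * EE (\<lambda>\<omega>. ?S t \<omega> ^ Suc k))) has_vector_derivative
       of_nat m * (EE (\<lambda>\<omega>. ?S 0 \<omega> ^ 2) * (of_nat (Suc k) * EE (\<lambda>\<omega>. cr S \<omega> ^ k * cr A \<omega>)) +
         (of_nat 2 * EE (\<lambda>\<omega>. cr S \<omega> ^ 1 * cr A \<omega>)) * EE (\<lambda>\<omega>. ?S 0 \<omega> ^ Suc k))) (at 0)"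
      using der[of 2] der[of "Suc k"]
      by (intro has_vector_derivative_mult_right has_vector_derivative_mult) auto
    ultimately have "of_nat (Suc m) * EE (\<lambda>\<omega>. cr S \<omega> ^ m * cr A \<omega>) =
       of_nat m * (EE (\<lambda>\<omega>. cr S \<omega> ^ 2) * (of_nat (Suc k) * EE (\<lambda>\<omega>. cr S \<omega> ^ k * cr A \<omega>)) +
         (2 * EE (\<lambda>\<omega>. cr S \<omega> * cr A \<omega>)) * EE (\<lambda>\<omega>. cr S \<omega> ^ Suc k))"
      unfolding eq by (simp add: mult.assoc del: power_Suc) (rule vector_derivative_unique_at)
    \<comment> \<open>The induction hypothesis for exponent \<open>k\<close> and the moment
      recursion evaluate both sides to the same product.\<close>
    moreover have "EE (\<lambda>\<omega>. cr S \<omega> ^ 2) * EE (\<lambda>\<omega>. cr S \<omega> ^ k * cr A \<omega>) =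
       EE (\<lambda>\<omega>. cr S \<omega> * cr A \<omega>) * EE (\<lambda>\<omega>. cr S \<omega> ^ Suc k)"
    proof (cases k)
      case 0
      then show ?thesis using mean0 assms by simp
    next
      case (Suc j)
      have "EE (\<lambda>\<omega>. cr S \<omega> ^ k * cr A \<omega>) = of_nat k * EE (\<lambda>\<omega>. cr S \<omega> * cr A \<omega>) * EE (\<lambda>\<omega>. cr S \<omega> ^ (k - 1))"
        using less[of k] 3 by (simp add: mult.commute)
      moreover have "EE (\<lambda>\<omega>. cr S \<omega> ^ Suc k) = of_nat k * EE (\<lambda>\<omega>. cr S \<omega> ^ 2) * EE (\<lambda>\<omega>. cr S \<omega> ^ (k - 1))"
        using rec[OF assms(2), of j] Suc by simp
      ultimately show ?thesis by simp
    qed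
    \<comment> \<open>With \<open>m = k + 2\<close> the coefficients add up to
      \<open>m (k + 1) + 2 m = m (m + 1)\<close>, which cancels the factor \<open>m + 1\<close> on
      the left.\<close>
    ultimately have "of_nat (Suc m) * EE (\<lambda>\<omega>. cr S \<omega> ^ m * cr A \<omega>) =
       of_nat (Suc m) * (of_nat m * EE (\<lambda>\<omega>. cr S \<omega> * cr A \<omega>) * EE (\<lambda>\<omega>. cr S \<omega> ^ Suc k))"
      using 3 by (simp add: algebra_simps del: power_Suc)
    then have "EE (\<lambda>\<omega>. cr S \<omega> ^ m * cr A \<omega>) = of_nat m * EE (\<lambda>\<omega>. cr S \<omega> * cr A \<omega>) * EE (\<lambda>\<omega>. cr S \<omega> ^ Suc k)"
      by (subst (asm) mult_cancel_left) (simp only: of_nat_eq_0_iff nat.distinct simp_thms)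
    then show ?thesis using 3 by (simp add: mult.commute)
  qed
qed

definition pr :: "('a \<Rightarrow> complex) list \<Rightarrow> 'a \<Rightarrow> complex" where
  "pr zs \<omega> = (\<Prod>z\<leftarrow>zs. z \<omega>)"

lemma pr_Nil [simp]: "pr [] \<omega> = 1" and pr_Cons [simp]: "pr (z # zs) \<omega> = z \<omega> * pr zs \<omega>"
  by (auto simp: pr_def)

lemma finite_moments_pr: "set zs \<subseteq> CV \<Longrightarrow> finite_moments M (pr zs)"
  unfolding pr_def[abs_def] by (intro finite_moments_prod_list finite_moments_CV) auto

text \<open>The powers of \<open>S\<close> carry the polarization: differentiating at \<open>S + t U\<close> inserts a factor \<open>U\<close>.\<close>

lemma wick_aux:
  assumes "A \<in> V" "set zs \<subseteq> CV" "S \<in> V"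
  shows "EE (\<lambda>\<omega>. cr S \<omega> ^ m * (cr A \<omega> * pr zs \<omega>)) =
    split_sum (\<lambda>a z b. EE (\<lambda>\<omega>. cr A \<omega> * z \<omega>) * EE (\<lambda>\<omega>. cr S \<omega> ^ m * (pr a \<omega> * pr b \<omega>))) zs +
    of_nat m * EE (\<lambda>\<omega>. cr A \<omega> * cr S \<omega>) * EE (\<lambda>\<omega>. cr S \<omega> ^ (m - 1) * pr zs \<omega>)"
  using assms(2,3)
proof (induction zs arbitrary: S m)
  case Nil
  then show ?case using wick_power[OF assms(1), of S m] by (simp add: mult.commute)
next
  case (Cons z zs)
  note IH = Cons.IH
  have zs: "set zs \<subseteq> CV" and z: "z \<in> CV" and S: "S \<in> V" using Cons.prems by auto
  note fm = finite_moments_mult finite_moments_power finite_moments_real finite_moments_pr finite_moments_CV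
  define L where "L z = EE (\<lambda>\<omega>. cr S \<omega> ^ m * (cr A \<omega> * pr (z # zs) \<omega>))" for z
  define R where "R z = split_sum (\<lambda>a z b. EE (\<lambda>\<omega>. cr A \<omega> * z \<omega>) * EE (\<lambda>\<omega>. cr S \<omega> ^ m * (pr a \<omega> * pr b \<omega>))) (z # zs) +
    of_nat m * EE (\<lambda>\<omega>. cr A \<omega> * cr S \<omega>) * EE (\<lambda>\<omega>. cr S \<omega> ^ (m - 1) * pr (z # zs) \<omega>)" for z
  have real: "L (cr U) = R (cr U)" if U: "U \<in> V" for U
  proof -
    let ?S = "\<lambda>t \<omega>. S \<omega> + t * U \<omega>"
    \<comment> \<open>The induction hypothesis is used with exponent \<open>m + 1\<close>, so that
      its derivative has exponent \<open>m\<close>; the common factor \<open>m + 1\<close> is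
      cancelled at the end.\<close>
    let ?f = "\<lambda>t. EE (\<lambda>\<omega>. cr (?S t) \<omega> ^ Suc m * (cr A \<omega> * pr zs \<omega>))"
    let ?g = "\<lambda>t. split_sum (\<lambda>a z b. EE (\<lambda>\<omega>. cr A \<omega> * z \<omega>) * EE (\<lambda>\<omega>. cr (?S t) \<omega> ^ Suc m * (pr a \<omega> * pr b \<omega>))) zs +
      of_nat (Suc m) * ((EE (\<lambda>\<omega>. cr A \<omega> * cr S \<omega>) + t *\<^sub>R EE (\<lambda>\<omega>. cr A \<omega> * cr U \<omega>)) *
        EE (\<lambda>\<omega>. cr (?S t) \<omega> ^ m * pr zs \<omega>))"
    have eq: "?f t = ?g t" for t
    proof -
      have "EE (\<lambda>\<omega>. cr A \<omega> * cr (?S t) \<omega>) = EE (\<lambda>\<omega>. cr A \<omega> * cr S \<omega> + complex_of_real t * (cr A \<omega> * cr U \<omega>))"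
        by (simp add: algebra_simps)
      also have "\<dots> = EE (\<lambda>\<omega>. cr A \<omega> * cr S \<omega>) + EE (\<lambda>\<omega>. complex_of_real t * (cr A \<omega> * cr U \<omega>))"
        by (intro EE_add finite_moments_cmult fm assms S U)
      finally show ?thesis
        using IH[OF zs lin[OF S U], of t "Suc m"] by (simp add: scaleR_conv_of_real mult.assoc)
    qed
    have d1: "(?f has_vector_derivative of_nat (Suc m) * EE (\<lambda>\<omega>. cr S \<omega> ^ (Suc m - 1) * cr U \<omega> * (cr A \<omega> * pr zs \<omega>))) (at 0)"
      by (intro EE_power_derivative S U fm assms zs)
    have d2: "(?g has_vector_derivative
        split_sum (\<lambda>a z b. EE (\<lambda>\<omega>. cr A \<omega> * z \<omega>) * (of_nat (Suc m) * EE (\<lambda>\<omega>. cr S \<omega> ^ (Suc m - 1) * cr U \<omega> * (pr a \<omega> * pr b \<omega>)))) zs +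
        of_nat (Suc m) * ((EE (\<lambda>\<omega>. cr A \<omega> * cr S \<omega>) + 0 *\<^sub>R EE (\<lambda>\<omega>. cr A \<omega> * cr U \<omega>)) *
          (of_nat m * EE (\<lambda>\<omega>. cr S \<omega> ^ (m - 1) * cr U \<omega> * pr zs \<omega>)) +
          EE (\<lambda>\<omega>. cr A \<omega> * cr U \<omega>) * EE (\<lambda>\<omega>. cr (?S 0) \<omega> ^ m * pr zs \<omega>))) (at 0)"
    proof (intro has_vector_derivative_add has_vector_derivative_mult_right has_vector_derivative_mult
        EE_power_derivative S U finite_moments_pr zs)
      show "((\<lambda>t. split_sum (\<lambda>a z b. EE (\<lambda>\<omega>. cr A \<omega> * z \<omega>) * EE (\<lambda>\<omega>. cr (?S t) \<omega> ^ Suc m * (pr a \<omega> * pr b \<omega>))) zs)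
        has_vector_derivative split_sum (\<lambda>a z b. EE (\<lambda>\<omega>. cr A \<omega> * z \<omega>) *
          (of_nat (Suc m) * EE (\<lambda>\<omega>. cr S \<omega> ^ (Suc m - 1) * cr U \<omega> * (pr a \<omega> * pr b \<omega>)))) zs) (at 0)"
        unfolding split_sum_def
        by (intro has_vector_derivative_sum has_vector_derivative_mult_right EE_power_derivative S U fm)
           (use zs in \<open>auto dest: in_set_takeD in_set_dropD\<close>)
      show "((\<lambda>t. EE (\<lambda>\<omega>. cr A \<omega> * cr S \<omega>) + t *\<^sub>R EE (\<lambda>\<omega>. cr A \<omega> * cr U \<omega>)) has_vector_derivative
          EE (\<lambda>\<omega>. cr A \<omega> * cr U \<omega>)) (at 0)"
        by (auto intro!: derivative_eq_intros)
    qed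
    have "?f = ?g" using eq by (rule ext)
    then have d1': "(?g has_vector_derivative of_nat (Suc m) * EE (\<lambda>\<omega>. cr S \<omega> ^ (Suc m - 1) * cr U \<omega> * (cr A \<omega> * pr zs \<omega>))) (at 0)"
      using d1 by (simp only:)
    have pull: "split_sum (\<lambda>a z b. EE (\<lambda>\<omega>. cr A \<omega> * z \<omega>) * (c * F a b)) zs =
        c * split_sum (\<lambda>a z b. EE (\<lambda>\<omega>. cr A \<omega> * z \<omega>) * F a b) zs" for c F
      unfolding split_sum_mult_left[symmetric] by (rule split_sum_cong) simp
    have "of_nat (Suc m) * EE (\<lambda>\<omega>. cr S \<omega> ^ m * cr U \<omega> * (cr A \<omega> * pr zs \<omega>)) =
        of_nat (Suc m) * (split_sum (\<lambda>a z b. EE (\<lambda>\<omega>. cr A \<omega> * z \<omega>) * EE (\<lambda>\<omega>. cr S \<omega> ^ m * cr U \<omega> * (pr a \<omega> * pr b \<omega>))) zs) +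
        of_nat (Suc m) * (EE (\<lambda>\<omega>. cr A \<omega> * cr S \<omega>) * (of_nat m * EE (\<lambda>\<omega>. cr S \<omega> ^ (m - 1) * cr U \<omega> * pr zs \<omega>)) +
          EE (\<lambda>\<omega>. cr A \<omega> * cr U \<omega>) * EE (\<lambda>\<omega>. cr S \<omega> ^ m * pr zs \<omega>))"
      using vector_derivative_unique_at[OF d1' d2, unfolded pull] by (simp del: of_nat_Suc)
    then have "EE (\<lambda>\<omega>. cr S \<omega> ^ m * cr U \<omega> * (cr A \<omega> * pr zs \<omega>)) =
        split_sum (\<lambda>a z b. EE (\<lambda>\<omega>. cr A \<omega> * z \<omega>) * EE (\<lambda>\<omega>. cr S \<omega> ^ m * cr U \<omega> * (pr a \<omega> * pr b \<omega>))) zs +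
        (EE (\<lambda>\<omega>. cr A \<omega> * cr S \<omega>) * (of_nat m * EE (\<lambda>\<omega>. cr S \<omega> ^ (m - 1) * cr U \<omega> * pr zs \<omega>)) +
          EE (\<lambda>\<omega>. cr A \<omega> * cr U \<omega>) * EE (\<lambda>\<omega>. cr S \<omega> ^ m * pr zs \<omega>))"
      unfolding distrib_left[symmetric] by (subst (asm) mult_cancel_left) (simp only: of_nat_eq_0_iff nat.distinct simp_thms)
    then show ?thesis by (simp add: L_def R_def mult_ac)
  qed
  \<comment> \<open>Both sides are complex linear in the new letter, so real and imaginary part
    suffice.\<close>
  define U W where "U \<omega> = Re (z \<omega>)" and "W \<omega> = Im (z \<omega>)" for \<omega>
  have UW: "U \<in> V" "W \<in> V" using z by (auto simp: CV_def U_def[abs_def] W_def[abs_def])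
  have zz: "z \<omega> = cr U \<omega> + \<i> * cr W \<omega>" for \<omega> by (simp add: U_def W_def complex_eq[symmetric])
  have split: "EE (\<lambda>\<omega>. H \<omega> * z \<omega>) = EE (\<lambda>\<omega>. H \<omega> * cr U \<omega>) + \<i> * EE (\<lambda>\<omega>. H \<omega> * cr W \<omega>)"
    if "finite_moments M H" for H
  proof -
    have "EE (\<lambda>\<omega>. H \<omega> * z \<omega>) = EE (\<lambda>\<omega>. H \<omega> * cr U \<omega> + \<i> * (H \<omega> * cr W \<omega>))"
      by (simp add: zz algebra_simps)
    also have "\<dots> = EE (\<lambda>\<omega>. H \<omega> * cr U \<omega>) + EE (\<lambda>\<omega>. \<i> * (H \<omega> * cr W \<omega>))"
      by (intro EE_add finite_moments_cmult fm UW that)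
    finally show ?thesis by simp
  qed
  have "L z = L (cr U) + \<i> * L (cr W)"
    unfolding L_def
    using split[of "\<lambda>\<omega>. cr S \<omega> ^ m * cr A \<omega> * pr zs \<omega>"] by (simp add: fm assms S zs mult_ac)
  moreover have "R z = R (cr U) + \<i> * R (cr W)"
  proof -
    have "split_sum (\<lambda>a y b. EE (\<lambda>\<omega>. cr A \<omega> * y \<omega>) * EE (\<lambda>\<omega>. cr S \<omega> ^ m * (pr (z # a) \<omega> * pr b \<omega>))) zs =
      split_sum (\<lambda>a y b. EE (\<lambda>\<omega>. cr A \<omega> * y \<omega>) * EE (\<lambda>\<omega>. cr S \<omega> ^ m * (pr (cr U # a) \<omega> * pr b \<omega>)) +
        \<i> * (EE (\<lambda>\<omega>. cr A \<omega> * y \<omega>) * EE (\<lambda>\<omega>. cr S \<omega> ^ m * (pr (cr W # a) \<omega> * pr b \<omega>)))) zs"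
    proof (rule split_sum_cong)
      fix a f b assume "zs = a @ f # b"
      then have "set a \<subseteq> CV" "set b \<subseteq> CV" using zs by auto
      then show "EE (\<lambda>\<omega>. cr A \<omega> * f \<omega>) * EE (\<lambda>\<omega>. cr S \<omega> ^ m * (pr (z # a) \<omega> * pr b \<omega>)) =
        EE (\<lambda>\<omega>. cr A \<omega> * f \<omega>) * EE (\<lambda>\<omega>. cr S \<omega> ^ m * (pr (cr U # a) \<omega> * pr b \<omega>)) +
        \<i> * (EE (\<lambda>\<omega>. cr A \<omega> * f \<omega>) * EE (\<lambda>\<omega>. cr S \<omega> ^ m * (pr (cr W # a) \<omega> * pr b \<omega>)))"
        using split[of "\<lambda>\<omega>. cr S \<omega> ^ m * (pr a \<omega> * pr b \<omega>)"] by (simp add: fm S mult_ac distrib_left)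
    qed
    moreover have "EE (\<lambda>\<omega>. cr S \<omega> ^ (m - 1) * pr (z # zs) \<omega>) =
      EE (\<lambda>\<omega>. cr S \<omega> ^ (m - 1) * pr (cr U # zs) \<omega>) + \<i> * EE (\<lambda>\<omega>. cr S \<omega> ^ (m - 1) * pr (cr W # zs) \<omega>)"
      using split[of "\<lambda>\<omega>. cr S \<omega> ^ (m - 1) * pr zs \<omega>"] by (simp add: fm S zs mult_ac)
    moreover note split[of "cr A"] fm(3)[OF assms(1)]
    ultimately show ?thesis
      by (simp add: R_def split_sum_add split_sum_mult_left algebra_simps)
  qed
  ultimately have "L z = R z" using real UW by simp
  then show ?case by (simp add: L_def R_def)
qed

lemma wick:
  assumes "A \<in> CV" "set zs \<subseteq> CV"
  shows "EE (\<lambda>\<omega>. A \<omega> * pr zs \<omega>) =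
    split_sum (\<lambda>a z b. EE (\<lambda>\<omega>. A \<omega> * z \<omega>) * EE (\<lambda>\<omega>. pr a \<omega> * pr b \<omega>)) zs"
proof -
  note fm = finite_moments_mult finite_moments_real finite_moments_pr finite_moments_CV
  have real: "EE (\<lambda>\<omega>. cr A \<omega> * pr zs \<omega>) =
    split_sum (\<lambda>a z b. EE (\<lambda>\<omega>. cr A \<omega> * z \<omega>) * EE (\<lambda>\<omega>. pr a \<omega> * pr b \<omega>)) zs" if "A \<in> V" for A
    using wick_aux[OF that assms(2) that, of 0] by simp
  define U W where "U \<omega> = Re (A \<omega>)" and "W \<omega> = Im (A \<omega>)" for \<omega>
  have UW: "U \<in> V" "W \<in> V" using assms(1) by (auto simp: CV_def U_def[abs_def] W_def[abs_def])
  have zz: "A \<omega> = cr U \<omega> + \<i> * cr W \<omega>" for \<omega> by (simp add: U_def W_def complex_eq[symmetric])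
  have split: "EE (\<lambda>\<omega>. A \<omega> * H \<omega>) = EE (\<lambda>\<omega>. cr U \<omega> * H \<omega>) + \<i> * EE (\<lambda>\<omega>. cr W \<omega> * H \<omega>)"
    if "finite_moments M H" for H
  proof -
    have "EE (\<lambda>\<omega>. A \<omega> * H \<omega>) = EE (\<lambda>\<omega>. cr U \<omega> * H \<omega> + \<i> * (cr W \<omega> * H \<omega>))"
      by (simp add: zz algebra_simps)
    also have "\<dots> = EE (\<lambda>\<omega>. cr U \<omega> * H \<omega>) + EE (\<lambda>\<omega>. \<i> * (cr W \<omega> * H \<omega>))"
      by (intro EE_add finite_moments_cmult fm UW that)
    finally show ?thesis by simp
  qed
  have "split_sum (\<lambda>a z b. EE (\<lambda>\<omega>. A \<omega> * z \<omega>) * EE (\<lambda>\<omega>. pr a \<omega> * pr b \<omega>)) zs =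
    split_sum (\<lambda>a z b. EE (\<lambda>\<omega>. cr U \<omega> * z \<omega>) * EE (\<lambda>\<omega>. pr a \<omega> * pr b \<omega>) +
      \<i> * (EE (\<lambda>\<omega>. cr W \<omega> * z \<omega>) * EE (\<lambda>\<omega>. pr a \<omega> * pr b \<omega>))) zs"
  proof (rule split_sum_cong)
    fix a z b assume "zs = a @ z # b"
    then have "finite_moments M z" using assms(2) by (auto intro: finite_moments_CV)
    from split[OF this] show "EE (\<lambda>\<omega>. A \<omega> * z \<omega>) * EE (\<lambda>\<omega>. pr a \<omega> * pr b \<omega>) =
      EE (\<lambda>\<omega>. cr U \<omega> * z \<omega>) * EE (\<lambda>\<omega>. pr a \<omega> * pr b \<omega>) +
      \<i> * (EE (\<lambda>\<omega>. cr W \<omega> * z \<omega>) * EE (\<lambda>\<omega>. pr a \<omega> * pr b \<omega>))"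
      by (simp add: distrib_right mult.assoc)
  qed
  then show ?thesis
    using split[OF finite_moments_pr[OF assms(2)]] real UW by (simp add: split_sum_add split_sum_mult_left)
qed

end

subsection \<open>Polynomials and Gaussian integration by parts\<close>

text \<open>\<open>f' v\<close> is the formal derivative of the polynomial \<open>f\<close> in \<open>v\<close>, unspecified for \<open>v\<close> outside \<open>I\<close>.\<close>

inductive poly_deriv ::
  "'v set \<Rightarrow> (('v \<Rightarrow> complex) \<Rightarrow> complex) \<Rightarrow> ('v \<Rightarrow> ('v \<Rightarrow> complex) \<Rightarrow> complex) \<Rightarrow> bool"
  for I where
  one: "poly_deriv I (\<lambda>x. 1) (\<lambda>v x. 0)"
| var: "b \<in> I \<Longrightarrow> poly_deriv I h h' \<Longrightarrow>
    poly_deriv I (\<lambda>x. x b * h x) (\<lambda>v x. of_bool (v = b) * h x + x b * h' v x)"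
| lin: "poly_deriv I f f' \<Longrightarrow> poly_deriv I g g' \<Longrightarrow>
    poly_deriv I (\<lambda>x. f x + c * g x) (\<lambda>v x. f' v x + c * g' v x)"
| cong: "poly_deriv I f f' \<Longrightarrow> (\<And>x. f x = g x) \<Longrightarrow> (\<And>v x. v \<in> I \<Longrightarrow> f' v x = g' v x) \<Longrightarrow> poly_deriv I g g'"

lemma poly_deriv_mult:
  assumes "poly_deriv I f f'" "poly_deriv I g g'"
  shows "poly_deriv I (\<lambda>x. f x * g x) (\<lambda>v x. f' v x * g x + f x * g' v x)"
  using assms(1)
proof induction
  case one
  show ?case by (rule poly_deriv.cong[OF assms(2)]) auto
next
  case (var b h h')
  show ?case
    by (rule poly_deriv.cong[OF poly_deriv.var[OF var(1,3)]]) (auto simp: algebra_simps)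
next
  case (lin f f' h h' c)
  show ?case
    by (rule poly_deriv.cong[OF poly_deriv.lin[OF lin(3,4), where c = c]]) (auto simp: algebra_simps)
next
  case (cong f f' h h')
  show ?case
    by (rule poly_deriv.cong[OF cong(4)]) (use cong in auto)
qed

lemma poly_deriv_zero: "poly_deriv I (\<lambda>x. 0) (\<lambda>v x. 0)"
  by (rule poly_deriv.cong[OF poly_deriv.lin[OF poly_deriv.one poly_deriv.one, where c = "- 1"]]) auto

lemma poly_deriv_const: "poly_deriv I (\<lambda>x. c) (\<lambda>v x. 0)"
  by (rule poly_deriv.cong[OF poly_deriv.lin[OF poly_deriv_zero poly_deriv.one, where c = c]]) auto

lemma poly_deriv_add:
  "poly_deriv I f f' \<Longrightarrow> poly_deriv I g g' \<Longrightarrow> poly_deriv I (\<lambda>x. f x + g x) (\<lambda>v x. f' v x + g' v x)"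
  by (drule (1) poly_deriv.lin[where c = 1]) simp

lemma poly_deriv_sum:
  "(\<And>i. i \<in> A \<Longrightarrow> poly_deriv I (f i) (f' i)) \<Longrightarrow>
    poly_deriv I (\<lambda>x. \<Sum>i\<in>A. f i x) (\<lambda>v x. \<Sum>i\<in>A. f' i v x)"
  by (induction A rule: infinite_finite_induct) (auto intro: poly_deriv_zero poly_deriv_add)

context gaussian_space begin

lemma poly_deriv_finite_moments:
  assumes "poly_deriv I f f'" "\<And>v. v \<in> I \<Longrightarrow> x v \<in> CV"
  shows "finite_moments M (\<lambda>\<omega>. f (\<lambda>v. x v \<omega>)) \<and> (\<forall>v\<in>I. finite_moments M (\<lambda>\<omega>. f' v (\<lambda>v. x v \<omega>)))"
  using assms(1)
proof induction
  case (var b h h')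
  then show ?case using finite_moments_CV[OF assms(2)[OF var(1)]]
    by (auto intro!: finite_moments_mult finite_moments_add)
next
  case (lin f f' g g' c)
  then show ?case by (auto intro!: finite_moments_cmult finite_moments_add)
qed auto

text \<open>The monomial \<open>L\<close> is an accumulator that makes the induction over
  \<open>poly_deriv\<close> work: a variable factor of the polynomial moves into \<open>L\<close>,
  and the constant polynomial leaves exactly Wick's formula for the monomial.\<close>

lemma integration_by_parts_aux:
  assumes "poly_deriv I f f'" "finite I" "\<And>v. v \<in> I \<Longrightarrow> x v \<in> CV" "a \<in> I" "set L \<subseteq> I"
  defines "mon \<equiv> \<lambda>L \<omega>. pr (map x L) \<omega>"
  defines "dmon \<equiv> \<lambda>L v \<omega>. split_sum (\<lambda>p b q. of_bool (v = b) * (mon p \<omega> * mon q \<omega>)) L"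
  shows "EE (\<lambda>\<omega>. x a \<omega> * (mon L \<omega> * f (\<lambda>v. x v \<omega>))) =
    (\<Sum>v\<in>I. EE (\<lambda>\<omega>. x a \<omega> * x v \<omega>) *
      EE (\<lambda>\<omega>. dmon L v \<omega> * f (\<lambda>v. x v \<omega>) + mon L \<omega> * f' v (\<lambda>v. x v \<omega>)))"
  using assms(1,5)
proof (induction arbitrary: L)
  case one
  have sub: "set (map x L) \<subseteq> CV" using one assms(3) by auto
  have fm: "finite_moments M (mon K)" if "set K \<subseteq> I" for K
    unfolding mon_def using that assms(3) by (intro finite_moments_pr) auto
  have split_map: "split_sum \<Phi> (map x L) = split_sum (\<lambda>p b q. \<Phi> (map x p) (x b) (map x q)) L" for \<Phi> :: "_ \<Rightarrow> _ \<Rightarrow> _ \<Rightarrow> complex"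
    unfolding split_sum_def by (rule sum.cong) (auto simp: take_map drop_map)
  have dm: "split_sum (\<lambda>p b q. of_bool (v = b) * EE (\<lambda>\<omega>. mon p \<omega> * mon q \<omega>)) L = EE (dmon L v)" for v
  proof -
    have "EE (dmon L v) = (\<Sum>j<length L. EE (\<lambda>\<omega>. of_bool (v = L ! j) * (mon (take j L) \<omega> * mon (drop (Suc j) L) \<omega>)))"
      unfolding dmon_def split_sum_def using one
      by (intro EE_sum finite_moments_cmult finite_moments_mult fm) (auto dest: in_set_takeD in_set_dropD)
    then show ?thesis by (simp add: split_sum_def)
  qed
  have "EE (\<lambda>\<omega>. x a \<omega> * mon L \<omega>) =
    split_sum (\<lambda>p b q. EE (\<lambda>\<omega>. x a \<omega> * x b \<omega>) * EE (\<lambda>\<omega>. mon p \<omega> * mon q \<omega>)) L"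
    using wick[OF assms(3)[OF assms(4)] sub] unfolding split_map by (simp add: mon_def)
  also have "\<dots> = split_sum (\<lambda>p b q. \<Sum>v\<in>I. EE (\<lambda>\<omega>. x a \<omega> * x v \<omega>) *
      (of_bool (v = b) * EE (\<lambda>\<omega>. mon p \<omega> * mon q \<omega>))) L"
  proof (rule split_sum_cong)
    fix p b q assume "L = p @ b # q"
    then have "b \<in> I" using one by auto
    then show "EE (\<lambda>\<omega>. x a \<omega> * x b \<omega>) * EE (\<lambda>\<omega>. mon p \<omega> * mon q \<omega>) =
      (\<Sum>v\<in>I. EE (\<lambda>\<omega>. x a \<omega> * x v \<omega>) * (of_bool (v = b) * EE (\<lambda>\<omega>. mon p \<omega> * mon q \<omega>)))"
      using assms(2) by (simp add: of_bool_def if_distrib if_distribR sum.delta cong: if_cong)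
  qed
  also have "\<dots> = (\<Sum>v\<in>I. EE (\<lambda>\<omega>. x a \<omega> * x v \<omega>) *
      split_sum (\<lambda>p b q. of_bool (v = b) * EE (\<lambda>\<omega>. mon p \<omega> * mon q \<omega>)) L)"
    unfolding split_sum_sum by (intro sum.cong refl) (rule split_sum_mult_left)
  finally show ?case by (simp add: dm)
next
  case (var b h h')
  have "set (b # L) \<subseteq> I" using var by auto
  from var.IH[OF this] show ?case
    by (simp add: mon_def dmon_def algebra_simps split_sum_mult_left)
next
  case (lin f f' g g' c)
  have xL: "set (map x L) \<subseteq> CV" using lin.prems assms(3) by auto
  have fm: "finite_moments M (mon K)" if "set K \<subseteq> I" for K
    unfolding mon_def using that assms(3) by (intro finite_moments_pr) auto
  have fmd: "finite_moments M (dmon L v)" for v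
    unfolding dmon_def split_sum_def using lin.prems
    by (intro finite_moments_sum finite_moments_cmult finite_moments_mult fm) (auto dest: in_set_takeD in_set_dropD)
  note F = poly_deriv_finite_moments[OF lin(1) assms(3), rule_format]
    and G = poly_deriv_finite_moments[OF lin(2) assms(3), rule_format]
  let ?x = "\<lambda>\<omega> v. x v \<omega>"
  have "EE (\<lambda>\<omega>. x a \<omega> * (mon L \<omega> * (f (?x \<omega>) + c * g (?x \<omega>)))) =
      EE (\<lambda>\<omega>. x a \<omega> * (mon L \<omega> * f (?x \<omega>)) + c * (x a \<omega> * (mon L \<omega> * g (?x \<omega>))))"
    by (simp add: algebra_simps)
  also have "\<dots> = EE (\<lambda>\<omega>. x a \<omega> * (mon L \<omega> * f (?x \<omega>))) + EE (\<lambda>\<omega>. c * (x a \<omega> * (mon L \<omega> * g (?x \<omega>))))"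
    using F G fm[OF lin.prems] finite_moments_CV[OF assms(3)[OF assms(4)]]
    by (intro EE_add finite_moments_cmult finite_moments_mult) auto
  finally have lhs: "EE (\<lambda>\<omega>. x a \<omega> * (mon L \<omega> * (f (?x \<omega>) + c * g (?x \<omega>)))) =
    EE (\<lambda>\<omega>. x a \<omega> * (mon L \<omega> * f (?x \<omega>))) + c * EE (\<lambda>\<omega>. x a \<omega> * (mon L \<omega> * g (?x \<omega>)))" by simp
  have rhs: "EE (\<lambda>\<omega>. dmon L v \<omega> * (f (?x \<omega>) + c * g (?x \<omega>)) + mon L \<omega> * (f' v (?x \<omega>) + c * g' v (?x \<omega>))) =
    EE (\<lambda>\<omega>. dmon L v \<omega> * f (?x \<omega>) + mon L \<omega> * f' v (?x \<omega>)) +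
    c * EE (\<lambda>\<omega>. dmon L v \<omega> * g (?x \<omega>) + mon L \<omega> * g' v (?x \<omega>))" if "v \<in> I" for v
  proof -
    have "EE (\<lambda>\<omega>. dmon L v \<omega> * (f (?x \<omega>) + c * g (?x \<omega>)) + mon L \<omega> * (f' v (?x \<omega>) + c * g' v (?x \<omega>))) =
      EE (\<lambda>\<omega>. (dmon L v \<omega> * f (?x \<omega>) + mon L \<omega> * f' v (?x \<omega>)) +
        c * (dmon L v \<omega> * g (?x \<omega>) + mon L \<omega> * g' v (?x \<omega>)))"
      by (simp add: algebra_simps)
    also have "\<dots> = EE (\<lambda>\<omega>. dmon L v \<omega> * f (?x \<omega>) + mon L \<omega> * f' v (?x \<omega>)) +
        EE (\<lambda>\<omega>. c * (dmon L v \<omega> * g (?x \<omega>) + mon L \<omega> * g' v (?x \<omega>)))"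
      using F G fm[OF lin.prems] fmd that
      by (intro EE_add finite_moments_cmult finite_moments_mult finite_moments_add) auto
    finally show ?thesis by simp
  qed
  show ?case
    unfolding lhs lin.IH(1)[OF lin.prems] lin.IH(2)[OF lin.prems] sum_distrib_left sum.distrib[symmetric]
  proof (intro sum.cong refl)
    fix v assume "v \<in> I"
    show "EE (\<lambda>\<omega>. x a \<omega> * x v \<omega>) * EE (\<lambda>\<omega>. dmon L v \<omega> * f (?x \<omega>) + mon L \<omega> * f' v (?x \<omega>)) +
      c * (EE (\<lambda>\<omega>. x a \<omega> * x v \<omega>) * EE (\<lambda>\<omega>. dmon L v \<omega> * g (?x \<omega>) + mon L \<omega> * g' v (?x \<omega>))) =
      EE (\<lambda>\<omega>. x a \<omega> * x v \<omega>) * EE (\<lambda>\<omega>. dmon L v \<omega> * (f (?x \<omega>) + c * g (?x \<omega>)) +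
        mon L \<omega> * (f' v (?x \<omega>) + c * g' v (?x \<omega>)))"
      unfolding rhs[OF \<open>v \<in> I\<close>] by (simp only: distrib_left mult.left_commute)
  qed
next
  case (cong f f' g g')
  have "(\<Sum>v\<in>I. EE (\<lambda>\<omega>. x a \<omega> * x v \<omega>) * EE (\<lambda>\<omega>. dmon L v \<omega> * f (\<lambda>v. x v \<omega>) + mon L \<omega> * f' v (\<lambda>v. x v \<omega>))) =
    (\<Sum>v\<in>I. EE (\<lambda>\<omega>. x a \<omega> * x v \<omega>) * EE (\<lambda>\<omega>. dmon L v \<omega> * g (\<lambda>v. x v \<omega>) + mon L \<omega> * g' v (\<lambda>v. x v \<omega>)))"
    by (rule sum.cong) (auto simp: cong.hyps)
  then show ?case using cong.IH[OF cong.prems] by (simp add: cong.hyps)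
qed

lemma integration_by_parts:
  assumes "poly_deriv I f f'" "finite I" "\<And>v. v \<in> I \<Longrightarrow> x v \<in> CV" "a \<in> I"
  shows "EE (\<lambda>\<omega>. x a \<omega> * f (\<lambda>v. x v \<omega>)) =
    (\<Sum>v\<in>I. EE (\<lambda>\<omega>. x a \<omega> * x v \<omega>) * EE (\<lambda>\<omega>. f' v (\<lambda>v. x v \<omega>)))"
  using integration_by_parts_aux[OF assms(1-3) assms(4), where L = "[]"] by simp

end

subsection \<open>Traces of words in the blocks\<close>

fun word_entry :: "nat \<Rightarrow> ('e \<times> nat \<times> nat \<Rightarrow> complex) \<Rightarrow> 'e list \<Rightarrow> nat \<Rightarrow> nat \<Rightarrow> complex" where
  "word_entry N x [] i j = of_bool (i = j)"
| "word_entry N x (e # w) i j = (\<Sum>k<N. x (e, i, k) * word_entry N x w k j)"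

definition word_trace :: "nat \<Rightarrow> ('e \<times> nat \<times> nat \<Rightarrow> complex) \<Rightarrow> 'e list \<Rightarrow> complex" where
  "word_trace N x w = (\<Sum>i<N. word_entry N x w i i)"

lemma word_entry_append:
  "i < N \<Longrightarrow> word_entry N x (u @ w) i j = (\<Sum>k<N. word_entry N x u i k * word_entry N x w k j)"
proof (induction u arbitrary: i)
  case Nil
  then show ?case by (simp add: of_bool_def if_distrib if_distribR sum.delta cong: if_cong)
next
  case (Cons e u)
  have "word_entry N x ((e # u) @ w) i j =
    (\<Sum>l<N. x (e, i, l) * (\<Sum>k<N. word_entry N x u l k * word_entry N x w k j))"
    using Cons by simp
  also have "\<dots> = (\<Sum>k<N. (\<Sum>l<N. x (e, i, l) * word_entry N x u l k) * word_entry N x w k j)"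
    by (simp add: sum_distrib_left sum_distrib_right mult.assoc) (rule sum.swap)
  finally show ?case by simp
qed

definition entry_vars :: "nat \<Rightarrow> ('e \<times> nat \<times> nat) set" where
  "entry_vars N = UNIV \<times> {..<N} \<times> {..<N}"

lemma finite_entry_vars: "finite (entry_vars N :: ('e::finite \<times> nat \<times> nat) set)"
  by (simp add: entry_vars_def)

text \<open>Removing one occurrence of the letter \<open>f\<close> opens the product at the row
  index \<open>k\<close> and the column index \<open>l\<close> of the differentiated entry.\<close>

definition word_entry_deriv ::
  "nat \<Rightarrow> 'e list \<Rightarrow> nat \<Rightarrow> nat \<Rightarrow> 'e \<times> nat \<times> nat \<Rightarrow> ('e \<times> nat \<times> nat \<Rightarrow> complex) \<Rightarrow> complex" where
  "word_entry_deriv N w i j = (\<lambda>(f, k, l) x.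
     split_sum (\<lambda>a g b. of_bool (f = g) * (word_entry N x a i k * word_entry N x b l j)) w)"

lemma poly_deriv_word_entry:
  "i < N \<Longrightarrow> poly_deriv (entry_vars N) (\<lambda>x. word_entry N x w i j) (word_entry_deriv N w i j)"
proof (induction w arbitrary: i)
  case Nil
  have "poly_deriv (entry_vars N) (\<lambda>x. of_bool (i = j)) (\<lambda>v x. 0)" by (rule poly_deriv_const)
  then show ?case by (rule poly_deriv.cong) (auto simp: word_entry_deriv_def)
next
  case (Cons e w)
  have "poly_deriv (entry_vars N) (\<lambda>x. \<Sum>k<N. x (e, i, k) * word_entry N x w k j)
    (\<lambda>v x. \<Sum>k<N. of_bool (v = (e, i, k)) * word_entry N x w k j + x (e, i, k) * word_entry_deriv N w k j v x)"
    using Cons by (intro poly_deriv_sum poly_deriv.var) (auto simp: entry_vars_def)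
  then show ?case
  proof (rule poly_deriv.cong)
    fix v :: "'a \<times> nat \<times> nat" and x assume v: "v \<in> entry_vars N"
    obtain f k l where [simp]: "v = (f, k, l)" by (cases v) auto
    have "l < N" using v by (simp add: entry_vars_def)
    then have "(\<Sum>m<N. of_bool (v = (e, i, m)) * word_entry N x w m j) = of_bool (f = e) * (of_bool (i = k) * word_entry N x w l j)"
    proof -
      have *: "of_bool (v = (e, i, m)) * word_entry N x w m j =
        (if m = l then of_bool (f = e) * (of_bool (i = k) * word_entry N x w l j) else 0)" for m by auto
      show ?thesis unfolding * using \<open>l < N\<close> by simp
    qed
    moreover have "(\<Sum>m<N. x (e, i, m) * word_entry_deriv N w m j v x) =
      split_sum (\<lambda>a g b. of_bool (f = g) * (word_entry N x (e # a) i k * word_entry N x b l j)) w"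
      unfolding word_entry_deriv_def
      by (simp add: split_sum_sum[symmetric] split_sum_mult_left[symmetric] sum_distrib_left sum_distrib_right mult_ac)
    ultimately show "(\<Sum>k<N. of_bool (v = (e, i, k)) * word_entry N x w k j + x (e, i, k) * word_entry_deriv N w k j v x) =
      word_entry_deriv N (e # w) i j v x"
      by (simp add: sum.distrib) (simp add: word_entry_deriv_def)
  qed simp
qed

text \<open>Cutting a trace at one letter leaves a single open word, the cyclic rotation
  \<open>b @ a\<close> running from \<open>l\<close> to \<open>k\<close>.\<close>

definition word_trace_deriv ::
  "nat \<Rightarrow> 'e list \<Rightarrow> 'e \<times> nat \<times> nat \<Rightarrow> ('e \<times> nat \<times> nat \<Rightarrow> complex) \<Rightarrow> complex" where
  "word_trace_deriv N w = (\<lambda>(f, k, l) x. split_sum (\<lambda>a g b. of_bool (f = g) * word_entry N x (b @ a) l k) w)"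

lemma poly_deriv_word_trace:
  "poly_deriv (entry_vars N) (\<lambda>x. word_trace N x w) (word_trace_deriv N w)"
proof -
  have "poly_deriv (entry_vars N) (\<lambda>x. word_trace N x w) (\<lambda>v x. \<Sum>i<N. word_entry_deriv N w i i v x)"
    unfolding word_trace_def by (intro poly_deriv_sum poly_deriv_word_entry) auto
  then show ?thesis
  proof (rule poly_deriv.cong)
    fix v :: "'a \<times> nat \<times> nat" and x assume v: "v \<in> entry_vars N"
    obtain f k l where [simp]: "v = (f, k, l)" by (cases v) auto
    have l: "l < N" using v by (simp add: entry_vars_def)
    show "(\<Sum>i<N. word_entry_deriv N w i i v x) = word_trace_deriv N w v x"
      unfolding word_trace_deriv_def word_entry_deriv_def
      by (simp add: split_sum_sum[symmetric] word_entry_append[OF l] sum_distrib_left mult_ac)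
  qed simp
qed

text \<open>\<open>t\<close> will be the limiting normalized trace, so the centring is not at the expectation.\<close>

definition centred_prod ::
  "('e list \<Rightarrow> complex) \<Rightarrow> nat \<Rightarrow> 'e list list \<Rightarrow> ('e \<times> nat \<times> nat \<Rightarrow> complex) \<Rightarrow> complex" where
  "centred_prod t N us x = (\<Prod>u\<leftarrow>us. word_trace N x u - of_nat N * t u)"

lemma centred_prod_Nil [simp]: "centred_prod t N [] x = 1"
  and centred_prod_Cons: "centred_prod t N (u # us) x = (word_trace N x u - of_nat N * t u) * centred_prod t N us x"
  by (auto simp: centred_prod_def)

lemma poly_deriv_centred_prod:
  "poly_deriv (entry_vars N) (centred_prod t N us)
    (\<lambda>v x. split_sum (\<lambda>p u q. word_trace_deriv N u v x * centred_prod t N (p @ q) x) us)"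
proof (induction us)
  case Nil
  show ?case by (rule poly_deriv.cong[OF poly_deriv_const[of _ 1]]) auto
next
  case (Cons u us)
  have "poly_deriv (entry_vars N) (\<lambda>x. word_trace N x u + (- of_nat N * t u)) (\<lambda>v x. word_trace_deriv N u v x + 0)"
    by (intro poly_deriv_add poly_deriv_word_trace poly_deriv_const)
  from poly_deriv_mult[OF this Cons] show ?case
    by (rule poly_deriv.cong) (auto simp: centred_prod_Cons split_sum_mult_left[symmetric] mult_ac)
qed

subsection \<open>Loop equations\<close>

locale gaussian_blocks = gaussian_space M V for M :: "'a measure" and V +
  fixes N :: nat and s :: "'e::finite \<Rightarrow> 'e \<Rightarrow> complex" and x :: "'e \<times> nat \<times> nat \<Rightarrow> 'a \<Rightarrow> complex"
  assumes N: "1 \<le> N"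
    and entries: "v \<in> entry_vars N \<Longrightarrow> x v \<in> CV"
    and covariance: "i < N \<Longrightarrow> j < N \<Longrightarrow> k < N \<Longrightarrow> l < N \<Longrightarrow>
      integral\<^sup>L M (\<lambda>\<omega>. x (e, i, j) \<omega> * x (f, k, l) \<omega>) =
        of_bool (i = l) * of_bool (j = k) * s e f / of_nat N"
begin

abbreviation xs :: "'a \<Rightarrow> 'e \<times> nat \<times> nat \<Rightarrow> complex" where "xs \<omega> \<equiv> \<lambda>v. x v \<omega>"

abbreviation T :: "'e list \<Rightarrow> 'a \<Rightarrow> complex" where "T w \<omega> \<equiv> word_trace N (xs \<omega>) w"

abbreviation C :: "'e list list \<Rightarrow> 'a \<Rightarrow> complex" where "C us \<omega> \<equiv> centred_prod (tau s) N us (xs \<omega>)"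

lemma fm_entry:
  assumes "i < N"
  shows "finite_moments M (\<lambda>\<omega>. word_entry N (xs \<omega>) w i j)"
  by (rule conjunct1[OF poly_deriv_finite_moments[where x = x, OF poly_deriv_word_entry[OF assms] entries]])

lemma fm_T: "finite_moments M (T w)"
  by (rule conjunct1[OF poly_deriv_finite_moments[where x = x, OF poly_deriv_word_trace entries]])

lemma fm_C: "finite_moments M (C us)"
  by (rule conjunct1[OF poly_deriv_finite_moments[where x = x, OF poly_deriv_centred_prod entries]])

lemma fm_split_sum:
  "(\<And>a f b. w = a @ f # b \<Longrightarrow> finite_moments M (F a f b)) \<Longrightarrow> finite_moments M (\<lambda>\<omega>. split_sum (\<lambda>a f b. F a f b \<omega>) w)"
  unfolding split_sum_def by (intro finite_moments_sum) (simp add: id_take_nth_drop[symmetric])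

lemma EE_split_sum:
  "(\<And>a f b. w = a @ f # b \<Longrightarrow> finite_moments M (F a f b)) \<Longrightarrow>
    EE (\<lambda>\<omega>. split_sum (\<lambda>a f b. F a f b \<omega>) w) = split_sum (\<lambda>a f b. EE (F a f b)) w"
  unfolding split_sum_def by (intro EE_sum) (simp add: id_take_nth_drop[symmetric])

text \<open>The Kronecker deltas select the transposed position \<open>(j, i)\<close>; the letter
  stays free and is weighted by \<open>s\<close>.\<close>

lemma covariance_contract:
  assumes "i < N" "j < N"
  shows "(\<Sum>v\<in>entry_vars N. EE (\<lambda>\<omega>. x (e, i, j) \<omega> * x v \<omega>) * F v) =
    (\<Sum>f\<in>UNIV. s e f * F (f, j, i)) / of_nat N"
proof -
  have "(\<Sum>v\<in>entry_vars N. EE (\<lambda>\<omega>. x (e, i, j) \<omega> * x v \<omega>) * F v) =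
    (\<Sum>f\<in>UNIV. \<Sum>k<N. \<Sum>l<N. EE (\<lambda>\<omega>. x (e, i, j) \<omega> * x (f, k, l) \<omega>) * F (f, k, l))"
    by (simp add: entry_vars_def sum.cartesian_product)
  also have "\<dots> = (\<Sum>f\<in>UNIV. \<Sum>k<N. \<Sum>l<N. if l = i then if k = j then s e f / of_nat N * F (f, j, i) else 0 else 0)"
    by (intro sum.cong refl) (use assms in \<open>auto simp: covariance\<close>)
  also have "\<dots> = (\<Sum>f\<in>UNIV. s e f / of_nat N * F (f, j, i))"
    using assms by simp
  finally show ?thesis by (simp add: sum_divide_distrib)
qed

lemma sum_of_bool_letter: "(\<Sum>f\<in>UNIV. s e f * (of_bool (f = g) * c)) = s e g * c"
proof -
  have "s e f * (of_bool (f = g) * c) = (if f = g then s e g * c else 0)" for f by auto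
  then show ?thesis by simp
qed

text \<open>Integration by parts in the first letter. If the derivative hits the same trace, it
  splits into \<open>T a\<close> and \<open>T b\<close>; if it hits a trace of the product, the two
  traces merge into the single word \<open>w @ b @ a\<close>.\<close>

lemma loop_equation:
  "EE (\<lambda>\<omega>. T (e # w) \<omega> * C us \<omega>) = (split_sum (\<lambda>a g b. s e g * EE (\<lambda>\<omega>. T a \<omega> * T b \<omega> * C us \<omega>)) w +
     split_sum (\<lambda>p u q. split_sum (\<lambda>a g b. s e g * EE (\<lambda>\<omega>. T (w @ b @ a) \<omega> * C (p @ q) \<omega>)) u) us) / of_nat N"
proof -
  note fm = finite_moments_mult fm_entry fm_T fm_C fm_split_sum finite_moments_cmult finite_moments_add
    finite_moments_CV[OF entries]
  let ?W = "\<lambda>w i j \<omega>. word_entry N (xs \<omega>) w i j"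
  let ?D = "\<lambda>v \<omega>. split_sum (\<lambda>p u q. word_trace_deriv N u v (xs \<omega>) * C (p @ q) \<omega>) us"
  have ibp: "EE (\<lambda>\<omega>. x (e, i, k) \<omega> * (?W w k i \<omega> * C us \<omega>)) =
    (split_sum (\<lambda>a g b. s e g * EE (\<lambda>\<omega>. ?W a k k \<omega> * ?W b i i \<omega> * C us \<omega>)) w +
     split_sum (\<lambda>p u q. split_sum (\<lambda>a g b. s e g * EE (\<lambda>\<omega>. ?W w k i \<omega> * ?W (b @ a) i k \<omega> * C (p @ q) \<omega>)) u) us) / of_nat N"
    if ik: "i < N" "k < N" for i k
  proof -
    have "EE (\<lambda>\<omega>. x (e, i, k) \<omega> * (?W w k i \<omega> * C us \<omega>)) =
      (\<Sum>v\<in>entry_vars N. EE (\<lambda>\<omega>. x (e, i, k) \<omega> * x v \<omega>) *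
        EE (\<lambda>\<omega>. word_entry_deriv N w k i v (xs \<omega>) * C us \<omega> + ?W w k i \<omega> * ?D v \<omega>))"
      by (rule integration_by_parts[OF poly_deriv_mult[OF poly_deriv_word_entry[OF ik(2)] poly_deriv_centred_prod]
          finite_entry_vars entries]) (use ik in \<open>auto simp: entry_vars_def\<close>)
    also have "\<dots> = (\<Sum>f\<in>UNIV. s e f * EE (\<lambda>\<omega>. word_entry_deriv N w k i (f, k, i) (xs \<omega>) * C us \<omega> + ?W w k i \<omega> * ?D (f, k, i) \<omega>)) / of_nat N"
      by (rule covariance_contract[OF ik])
    also have "(\<lambda>f. s e f * EE (\<lambda>\<omega>. word_entry_deriv N w k i (f, k, i) (xs \<omega>) * C us \<omega> + ?W w k i \<omega> * ?D (f, k, i) \<omega>)) =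
      (\<lambda>f. split_sum (\<lambda>a g b. s e f * (of_bool (f = g) * EE (\<lambda>\<omega>. ?W a k k \<omega> * ?W b i i \<omega> * C us \<omega>))) w +
        split_sum (\<lambda>p u q. split_sum (\<lambda>a g b. s e f * (of_bool (f = g) * EE (\<lambda>\<omega>. ?W w k i \<omega> * ?W (b @ a) i k \<omega> * C (p @ q) \<omega>))) u) us)"
    proof
      fix f
      have "EE (\<lambda>\<omega>. word_entry_deriv N w k i (f, k, i) (xs \<omega>) * C us \<omega> + ?W w k i \<omega> * ?D (f, k, i) \<omega>) =
        EE (\<lambda>\<omega>. split_sum (\<lambda>a g b. of_bool (f = g) * (?W a k k \<omega> * ?W b i i \<omega> * C us \<omega>)) w +
          split_sum (\<lambda>p u q. split_sum (\<lambda>a g b. of_bool (f = g) * (?W w k i \<omega> * ?W (b @ a) i k \<omega> * C (p @ q) \<omega>)) u) us)"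
        by (simp add: word_entry_deriv_def word_trace_deriv_def split_sum_mult_left[symmetric]
            split_sum_mult_right[symmetric] mult_ac)
      also have "\<dots> = EE (\<lambda>\<omega>. split_sum (\<lambda>a g b. of_bool (f = g) * (?W a k k \<omega> * ?W b i i \<omega> * C us \<omega>)) w) +
          EE (\<lambda>\<omega>. split_sum (\<lambda>p u q. split_sum (\<lambda>a g b. of_bool (f = g) * (?W w k i \<omega> * ?W (b @ a) i k \<omega> * C (p @ q) \<omega>)) u) us)"
        by (intro EE_add fm ik)
      also have "EE (\<lambda>\<omega>. split_sum (\<lambda>a g b. of_bool (f = g) * (?W a k k \<omega> * ?W b i i \<omega> * C us \<omega>)) w) =
          split_sum (\<lambda>a g b. EE (\<lambda>\<omega>. of_bool (f = g) * (?W a k k \<omega> * ?W b i i \<omega> * C us \<omega>))) w"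
        by (intro EE_split_sum fm ik)
      also have "EE (\<lambda>\<omega>. split_sum (\<lambda>p u q. split_sum (\<lambda>a g b. of_bool (f = g) * (?W w k i \<omega> * ?W (b @ a) i k \<omega> * C (p @ q) \<omega>)) u) us) =
          split_sum (\<lambda>p u q. EE (\<lambda>\<omega>. split_sum (\<lambda>a g b. of_bool (f = g) * (?W w k i \<omega> * ?W (b @ a) i k \<omega> * C (p @ q) \<omega>)) u)) us"
        by (intro EE_split_sum fm ik)
      also have "\<dots> = split_sum (\<lambda>p u q. split_sum (\<lambda>a g b. EE (\<lambda>\<omega>. of_bool (f = g) * (?W w k i \<omega> * ?W (b @ a) i k \<omega> * C (p @ q) \<omega>))) u) us"
        by (intro split_sum_cong EE_split_sum fm ik)
      finally show "s e f * EE (\<lambda>\<omega>. word_entry_deriv N w k i (f, k, i) (xs \<omega>) * C us \<omega> + ?W w k i \<omega> * ?D (f, k, i) \<omega>) =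
        split_sum (\<lambda>a g b. s e f * (of_bool (f = g) * EE (\<lambda>\<omega>. ?W a k k \<omega> * ?W b i i \<omega> * C us \<omega>))) w +
        split_sum (\<lambda>p u q. split_sum (\<lambda>a g b. s e f * (of_bool (f = g) * EE (\<lambda>\<omega>. ?W w k i \<omega> * ?W (b @ a) i k \<omega> * C (p @ q) \<omega>))) u) us"
        by (simp add: split_sum_mult_left distrib_left)
    qed
    finally show ?thesis
      by (simp add: sum.distrib split_sum_sum[symmetric] sum_of_bool_letter)
  qed
  have "EE (\<lambda>\<omega>. T (e # w) \<omega> * C us \<omega>) = EE (\<lambda>\<omega>. \<Sum>i<N. \<Sum>k<N. x (e, i, k) \<omega> * (?W w k i \<omega> * C us \<omega>))"
    by (simp add: word_trace_def sum_distrib_right mult.assoc)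
  also have "\<dots> = (\<Sum>i<N. EE (\<lambda>\<omega>. \<Sum>k<N. x (e, i, k) \<omega> * (?W w k i \<omega> * C us \<omega>)))"
    by (intro EE_sum finite_moments_sum fm) (auto simp: entry_vars_def)
  also have "\<dots> = (\<Sum>i<N. \<Sum>k<N. EE (\<lambda>\<omega>. x (e, i, k) \<omega> * (?W w k i \<omega> * C us \<omega>)))"
    by (intro sum.cong refl EE_sum fm) (auto simp: entry_vars_def)
  also have "\<dots> = (\<Sum>i<N. \<Sum>k<N. (split_sum (\<lambda>a g b. s e g * EE (\<lambda>\<omega>. ?W a k k \<omega> * ?W b i i \<omega> * C us \<omega>)) w +
     split_sum (\<lambda>p u q. split_sum (\<lambda>a g b. s e g * EE (\<lambda>\<omega>. ?W w k i \<omega> * ?W (b @ a) i k \<omega> * C (p @ q) \<omega>)) u) us) / of_nat N)"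
    by (intro sum.cong refl ibp) auto
  also have "\<dots> = (split_sum (\<lambda>a g b. s e g * (\<Sum>i<N. \<Sum>k<N. EE (\<lambda>\<omega>. ?W a k k \<omega> * ?W b i i \<omega> * C us \<omega>))) w +
     split_sum (\<lambda>p u q. split_sum (\<lambda>a g b. s e g * (\<Sum>i<N. \<Sum>k<N. EE (\<lambda>\<omega>. ?W w k i \<omega> * ?W (b @ a) i k \<omega> * C (p @ q) \<omega>))) u) us) / of_nat N"
    by (simp add: sum_divide_distrib[symmetric] sum.distrib split_sum_sum[symmetric] sum_distrib_left)
  \<comment> \<open>Same trace: each of the two index sums closes one of the open pieces.\<close>
  also have "(\<lambda>a b. \<Sum>i<N. \<Sum>k<N. EE (\<lambda>\<omega>. ?W a k k \<omega> * ?W b i i \<omega> * C us \<omega>)) = (\<lambda>a b. EE (\<lambda>\<omega>. T a \<omega> * T b \<omega> * C us \<omega>))"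
  proof (intro ext)
    fix a b
    have "EE (\<lambda>\<omega>. T a \<omega> * T b \<omega> * C us \<omega>) = EE (\<lambda>\<omega>. \<Sum>i<N. \<Sum>k<N. ?W a k k \<omega> * ?W b i i \<omega> * C us \<omega>)"
    proof -
      have "T a \<omega> * T b \<omega> * C us \<omega> = (\<Sum>i<N. \<Sum>k<N. ?W a k k \<omega> * ?W b i i \<omega> * C us \<omega>)" for \<omega>
        unfolding word_trace_def sum_product unfolding sum_distrib_right by (rule sum.swap)
      then show ?thesis by simp
    qed
    also have "\<dots> = (\<Sum>i<N. EE (\<lambda>\<omega>. \<Sum>k<N. ?W a k k \<omega> * ?W b i i \<omega> * C us \<omega>))"
      by (intro EE_sum finite_moments_sum fm) auto
    also have "\<dots> = (\<Sum>i<N. \<Sum>k<N. EE (\<lambda>\<omega>. ?W a k k \<omega> * ?W b i i \<omega> * C us \<omega>))"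
      by (intro sum.cong refl EE_sum fm) auto
    finally show "(\<Sum>i<N. \<Sum>k<N. EE (\<lambda>\<omega>. ?W a k k \<omega> * ?W b i i \<omega> * C us \<omega>)) = EE (\<lambda>\<omega>. T a \<omega> * T b \<omega> * C us \<omega>)" by simp
  qed
  \<comment> \<open>Different trace: the two index sums join both open words into one closed
    word.\<close>
  also have "(\<lambda>p q a b. \<Sum>i<N. \<Sum>k<N. EE (\<lambda>\<omega>. ?W w k i \<omega> * ?W (b @ a) i k \<omega> * C (p @ q) \<omega>)) =
    (\<lambda>p q a b. EE (\<lambda>\<omega>. T (w @ b @ a) \<omega> * C (p @ q) \<omega>))"
  proof (intro ext)
    fix p q a b
    have "EE (\<lambda>\<omega>. T (w @ b @ a) \<omega> * C (p @ q) \<omega>) = EE (\<lambda>\<omega>. \<Sum>i<N. \<Sum>k<N. ?W w k i \<omega> * ?W (b @ a) i k \<omega> * C (p @ q) \<omega>)"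
    proof -
      have "T (w @ b @ a) \<omega> = (\<Sum>i<N. \<Sum>k<N. ?W w k i \<omega> * ?W (b @ a) i k \<omega>)" for \<omega>
        unfolding word_trace_def by (subst sum.swap) (simp add: word_entry_append)
      then show ?thesis by (simp add: sum_distrib_right)
    qed
    also have "\<dots> = (\<Sum>i<N. EE (\<lambda>\<omega>. \<Sum>k<N. ?W w k i \<omega> * ?W (b @ a) i k \<omega> * C (p @ q) \<omega>))"
      by (intro EE_sum finite_moments_sum fm) auto
    also have "\<dots> = (\<Sum>i<N. \<Sum>k<N. EE (\<lambda>\<omega>. ?W w k i \<omega> * ?W (b @ a) i k \<omega> * C (p @ q) \<omega>))"
      by (intro sum.cong refl EE_sum fm) auto
    finally show "(\<Sum>i<N. \<Sum>k<N. EE (\<lambda>\<omega>. ?W w k i \<omega> * ?W (b @ a) i k \<omega> * C (p @ q) \<omega>)) =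
      EE (\<lambda>\<omega>. T (w @ b @ a) \<omega> * C (p @ q) \<omega>)" by simp
  qed
  finally show ?thesis .
qed

lemma mean_C_Nil: "EE (C []) = 1"
  using prob_space by simp

lemma mean_C_empty_word: "EE (C ([] # us)) = 0"
  by (simp add: centred_prod_Cons word_trace_def)

text \<open>Each trace is replaced by its centred version plus \<open>N * tau\<close>. Products of
  two means carry the factor N after division and must disappear for a limit to exist.\<close>

lemma centred_loop_equation:
  "EE (C ((e # w) # us)) =
    split_sum (\<lambda>a g b. s e g * (EE (C (a # b # us)) / of_nat N + tau s b * EE (C (a # us)) + tau s a * EE (C (b # us)))) w +
    split_sum (\<lambda>p u q. split_sum (\<lambda>a g b. s e g *
      (EE (C ((w @ b @ a) # p @ q)) / of_nat N + tau s (w @ b @ a) * EE (C (p @ q)))) u) us"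
proof -
  note fm = finite_moments_mult fm_T fm_C finite_moments_cmult finite_moments_add
  have nz: "(of_nat N :: complex) \<noteq> 0" using N by simp
  have T1: "EE (\<lambda>\<omega>. T v \<omega> * C us \<omega>) = EE (C (v # us)) + of_nat N * tau s v * EE (C us)" for v us
  proof -
    have "EE (\<lambda>\<omega>. T v \<omega> * C us \<omega>) = EE (\<lambda>\<omega>. C (v # us) \<omega> + of_nat N * tau s v * C us \<omega>)"
      by (simp add: centred_prod_Cons algebra_simps)
    also have "\<dots> = EE (C (v # us)) + EE (\<lambda>\<omega>. of_nat N * tau s v * C us \<omega>)"
      by (intro EE_add fm)
    finally show ?thesis by simp
  qed
  have T2: "EE (\<lambda>\<omega>. T a \<omega> * T b \<omega> * C us \<omega>) = EE (C (a # b # us)) + of_nat N * tau s b * EE (C (a # us)) +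
      of_nat N * tau s a * EE (C (b # us)) + of_nat N * tau s a * (of_nat N * tau s b * EE (C us))" for a b
  proof -
    have "EE (\<lambda>\<omega>. T a \<omega> * T b \<omega> * C us \<omega>) =
      EE (\<lambda>\<omega>. T a \<omega> * C (b # us) \<omega> + of_nat N * tau s b * (T a \<omega> * C us \<omega>))"
      by (simp add: centred_prod_Cons algebra_simps)
    also have "\<dots> = EE (\<lambda>\<omega>. T a \<omega> * C (b # us) \<omega>) + EE (\<lambda>\<omega>. of_nat N * tau s b * (T a \<omega> * C us \<omega>))"
      by (intro EE_add fm)
    finally show ?thesis unfolding EE_cmult T1 by (simp add: algebra_simps)
  qed
  have "EE (C ((e # w) # us)) = EE (\<lambda>\<omega>. T (e # w) \<omega> * C us \<omega>) - of_nat N * tau s (e # w) * EE (C us)"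
    unfolding T1 by simp
  \<comment> \<open>Expanding the subtracted mean over the same splittings makes it cancel against
    the terms with \<open>tau s a * tau s b\<close> below.\<close>
  also have "tau s (e # w) = split_sum (\<lambda>a g b. s e g * tau s a * tau s b) w" by (rule tau_Cons)
  also have "EE (\<lambda>\<omega>. T (e # w) \<omega> * C us \<omega>) =
    split_sum (\<lambda>a g b. s e g * (EE (C (a # b # us)) / of_nat N + tau s b * EE (C (a # us)) + tau s a * EE (C (b # us))) +
      of_nat N * EE (C us) * (s e g * tau s a * tau s b)) w +
    split_sum (\<lambda>p u q. split_sum (\<lambda>a g b. s e g *
      (EE (C ((w @ b @ a) # p @ q)) / of_nat N + tau s (w @ b @ a) * EE (C (p @ q)))) u) us"
    unfolding loop_equation T1 T2 add_divide_distrib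
    unfolding divide_inverse split_sum_mult_right[symmetric]
    by (intro arg_cong2[where f = "(+)"] split_sum_cong) (use nz in \<open>auto simp: field_simps\<close>)
  finally show ?thesis
    by (simp only: split_sum_add split_sum_mult_left) (simp add: algebra_simps)
qed

end

subsection \<open>The large \<open>N\<close> limit\<close>

lemma tendsto_split_sum:
  assumes "\<And>a f b. w = a @ f # b \<Longrightarrow> ((\<lambda>N. F N a f b) \<longlongrightarrow> L a f b) net"
  shows "((\<lambda>N. split_sum (F N) w) \<longlongrightarrow> (split_sum L w :: complex)) net"
  unfolding split_sum_def by (intro tendsto_sum assms) (auto simp: id_take_nth_drop)

text \<open>Only the recursion is kept, with numbers in place of expectations, since the probability
  space changes with \<open>N\<close>.\<close>

locale loop_limit =
  fixes s :: "'e \<Rightarrow> 'e \<Rightarrow> complex" and c :: "nat \<Rightarrow> 'e list list \<Rightarrow> complex"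
  assumes c_Nil: "\<And>N. 1 \<le> N \<Longrightarrow> c N [] = 1"
    and c_empty_word: "\<And>N us. 1 \<le> N \<Longrightarrow> c N ([] # us) = 0"
    and c_Cons: "\<And>N e w us. 1 \<le> N \<Longrightarrow> c N ((e # w) # us) =
      split_sum (\<lambda>a g b. s e g * (c N (a # b # us) / of_nat N + tau s b * c N (a # us) + tau s a * c N (b # us))) w +
      split_sum (\<lambda>p u q. split_sum (\<lambda>a g b. s e g *
        (c N ((w @ b @ a) # p @ q) / of_nat N + tau s (w @ b @ a) * c N (p @ q))) u) us"
begin

definition cl :: "'e list list \<Rightarrow> complex" where "cl us = lim (\<lambda>N. c N us)"

lemma tendsto_cong_pos:
  "(\<And>N. 1 \<le> N \<Longrightarrow> f N = g N) \<Longrightarrow> (g \<longlongrightarrow> l) sequentially \<Longrightarrow> (f \<longlongrightarrow> (l::complex)) sequentially"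
  by (subst tendsto_cong[of f g]) (auto simp: eventually_sequentially)

text \<open>Every list on the right of the recursion has two letters fewer in total, so its moment
  converges by assumption; the summands divided by N then tend to 0.\<close>

lemma c_Cons_tendsto:
  assumes conv: "\<And>vs. sum_list (map length vs) < sum_list (map length ((e # w) # us)) \<Longrightarrow> convergent (\<lambda>N. c N vs)"
  shows "(\<lambda>N. c N ((e # w) # us)) \<longlonglongrightarrow>
    split_sum (\<lambda>a g b. s e g * (tau s b * cl (a # us) + tau s a * cl (b # us))) w +
    split_sum (\<lambda>p u q. split_sum (\<lambda>a g b. s e g * (tau s (w @ b @ a) * cl (p @ q))) u) us"
proof (rule tendsto_cong_pos[OF c_Cons], assumption)
  have lim: "(\<lambda>N. c N vs) \<longlonglongrightarrow> cl vs"
    if "sum_list (map length vs) < sum_list (map length ((e # w) # us))" for vs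
    using conv[OF that] by (simp add: cl_def convergent_LIMSEQ_iff)
  have lim0: "(\<lambda>N. c N vs / of_nat N) \<longlonglongrightarrow> 0"
    if "sum_list (map length vs) < sum_list (map length ((e # w) # us))" for vs
    using tendsto_mult[OF lim[OF that] lim_inverse_n] by (simp add: divide_inverse)
  show "(\<lambda>N. split_sum (\<lambda>a g b. s e g * (c N (a # b # us) / of_nat N + tau s b * c N (a # us) + tau s a * c N (b # us))) w +
      split_sum (\<lambda>p u q. split_sum (\<lambda>a g b. s e g *
        (c N ((w @ b @ a) # p @ q) / of_nat N + tau s (w @ b @ a) * c N (p @ q))) u) us) \<longlonglongrightarrow>
    split_sum (\<lambda>a g b. s e g * (tau s b * cl (a # us) + tau s a * cl (b # us))) w +
    split_sum (\<lambda>p u q. split_sum (\<lambda>a g b. s e g * (tau s (w @ b @ a) * cl (p @ q))) u) us"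
  proof (intro tendsto_add tendsto_split_sum)
    fix a g b assume w: "w = a @ g # b"
    have "(\<lambda>N. c N (a # b # us) / of_nat N + tau s b * c N (a # us) + tau s a * c N (b # us))
        \<longlonglongrightarrow> 0 + tau s b * cl (a # us) + tau s a * cl (b # us)"
      by (intro tendsto_add tendsto_mult_left lim lim0) (auto simp: w)
    then show "(\<lambda>N. s e g * (c N (a # b # us) / of_nat N + tau s b * c N (a # us) + tau s a * c N (b # us)))
        \<longlonglongrightarrow> s e g * (tau s b * cl (a # us) + tau s a * cl (b # us))"
      by (intro tendsto_mult_left) simp
  next
    fix p u q a g b assume us: "us = p @ u # q" and u: "u = a @ g # b"
    have "(\<lambda>N. c N ((w @ b @ a) # p @ q) / of_nat N + tau s (w @ b @ a) * c N (p @ q))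
        \<longlonglongrightarrow> 0 + tau s (w @ b @ a) * cl (p @ q)"
      by (intro tendsto_add tendsto_mult_left lim lim0) (auto simp: us u)
    then show "(\<lambda>N. s e g * (c N ((w @ b @ a) # p @ q) / of_nat N + tau s (w @ b @ a) * c N (p @ q)))
        \<longlonglongrightarrow> s e g * (tau s (w @ b @ a) * cl (p @ q))"
      by (intro tendsto_mult_left) simp
  qed
qed

text \<open>Induction on the total number of letters. The number of words would not do, because
  splitting increases it.\<close>

lemma c_convergent: "convergent (\<lambda>N. c N us)"
proof (induction "sum_list (map length us)" arbitrary: us rule: less_induct)
  case less
  consider "us = []" | us' where "us = [] # us'" | e w us' where "us = (e # w) # us'"
    by (metis neq_Nil_conv)
  then show ?case
  proof cases
    case 1
    have "(\<lambda>N. c N us) \<longlonglongrightarrow> 1" unfolding 1 by (rule tendsto_cong_pos[OF c_Nil]) auto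
    then show ?thesis by (rule convergentI)
  next
    case (2 us')
    have "(\<lambda>N. c N us) \<longlonglongrightarrow> 0" unfolding 2 by (rule tendsto_cong_pos[OF c_empty_word]) auto
    then show ?thesis by (rule convergentI)
  next
    case (3 e w us')
    show ?thesis unfolding 3 by (rule convergentI[OF c_Cons_tendsto]) (use less 3 in auto)
  qed
qed

lemma c_tendsto: "(\<lambda>N. c N us) \<longlonglongrightarrow> cl us"
  using c_convergent by (simp add: cl_def convergent_LIMSEQ_iff)

lemma cl_Nil: "cl [] = 1"
  by (rule LIMSEQ_unique[OF c_tendsto tendsto_cong_pos[OF c_Nil]]) auto

lemma cl_empty_word: "cl ([] # us) = 0"
  by (rule LIMSEQ_unique[OF c_tendsto tendsto_cong_pos[OF c_empty_word]]) auto

lemma cl_Cons: "cl ((e # w) # us) =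
    split_sum (\<lambda>a g b. s e g * (tau s b * cl (a # us) + tau s a * cl (b # us))) w +
    split_sum (\<lambda>p u q. split_sum (\<lambda>a g b. s e g * (tau s (w @ b @ a) * cl (p @ q))) u) us"
  by (rule LIMSEQ_unique[OF c_tendsto c_Cons_tendsto[OF c_convergent]])

text \<open>Without other factors the recursion has no source. So the expectation of a trace differs
  from \<open>N * tau\<close> by an error tending to 0, and centring at either gives the same
  limiting covariance.\<close>

lemma cl_single: "cl [w] = 0"
proof (induction "length w" arbitrary: w rule: less_induct)
  case less
  show ?case
  proof (cases w)
    case Nil
    then show ?thesis by (simp add: cl_empty_word)
  next
    case (Cons e v)
    have "split_sum (\<lambda>a g b. s e g * (tau s b * cl [a] + tau s a * cl [b])) v = split_sum (\<lambda>a g b. 0 :: complex) v"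
      by (rule split_sum_cong) (use less Cons in auto)
    also have "\<dots> = 0" by (simp add: split_sum_def)
    finally show ?thesis by (simp add: Cons cl_Cons)
  qed
qed

lemma cl_pair_Cons: "cl [e # w, u] =
    split_sum (\<lambda>a g b. s e g * (tau s b * cl [a, u] + tau s a * cl [b, u])) w +
    split_sum (\<lambda>a g b. s e g * tau s (w @ b @ a)) u"
  by (simp add: cl_Cons cl_Nil mult.assoc)

end

subsection \<open>Paths of letters\<close>

text \<open>Walks from \<open>k\<close> to \<open>q\<close> in \<open>m\<close> steps, each step
  being a pair of consecutive block indices. They index the expansion of an entry of the m-th power
  of a block matrix.\<close>

fun paths :: "nat \<Rightarrow> 'd \<Rightarrow> 'd \<Rightarrow> ('d::finite \<times> 'd) list set" where
  "paths 0 k q = (if k = q then {[]} else {})"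
| "paths (Suc m) k q = (\<Union>r. (#) (k, r) ` paths m r q)"

lemma finite_paths [simp]: "finite (paths m k q)"
  by (induction m arbitrary: k) auto

lemma length_paths: "w \<in> paths m k q \<Longrightarrow> length w = m"
  by (induction m arbitrary: k w) (auto split: if_splits)

lemma sum_paths_0 [simp]: "sum F (paths 0 k q) = (if k = q then F [] else 0)"
  by simp

lemma sum_paths_Suc [simp]: "sum F (paths (Suc m) k q) = (\<Sum>r\<in>UNIV. \<Sum>w\<in>paths m r q. F ((k, r) # w))"
  unfolding paths.simps by (subst sum.UNION_disjoint) (auto simp: sum.reindex)

declare paths.simps [simp del]

lemma sum_UNIV_times: "(\<Sum>k\<in>UNIV \<times> {..<N}. F k) = (\<Sum>r\<in>UNIV. \<Sum>k<N. F (r, k))"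
  for N :: nat
  by (simp add: sum.cartesian_product)

lemma power_on_paths:
  fixes A :: "'d::finite block_matrix"
  shows "power_on (UNIV \<times> {..<N}) A m (p, i) (q, j) =
    (\<Sum>w\<in>paths m p q. word_entry N (\<lambda>(e, i, j). A (fst e, i) (snd e, j)) w i j)"
proof (induction m arbitrary: p i)
  case 0
  then show ?case by simp
next
  case (Suc m)
  have "power_on (UNIV \<times> {..<N}) A (Suc m) (p, i) (q, j) =
    (\<Sum>r\<in>UNIV. \<Sum>k<N. A (p, i) (r, k) * (\<Sum>w\<in>paths m r q. word_entry N (\<lambda>(e, i, j). A (fst e, i) (snd e, j)) w k j))"
    by (simp add: sum_UNIV_times Suc)
  also have "\<dots> = (\<Sum>r\<in>UNIV. \<Sum>w\<in>paths m r q. \<Sum>k<N. A (p, i) (r, k) * word_entry N (\<lambda>(e, i, j). A (fst e, i) (snd e, j)) w k j)"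
    unfolding sum_distrib_left by (intro sum.cong refl sum.swap)
  finally show ?case by simp
qed

lemma block_trace_power_paths:
  "block_trace_power N A m =
    (\<Sum>p\<in>UNIV. \<Sum>w\<in>paths m p p. word_trace N (\<lambda>(e, i, j). A (fst e, i) (snd e, j)) w)"
proof -
  have "block_trace_power N A m = (\<Sum>p\<in>UNIV. \<Sum>i<N. \<Sum>w\<in>paths m p p. word_entry N (\<lambda>(e, i, j). A (fst e, i) (snd e, j)) w i i)"
    by (simp add: block_trace_power_def sum_UNIV_times power_on_paths)
  also have "\<dots> = (\<Sum>p\<in>UNIV. \<Sum>w\<in>paths m p p. word_trace N (\<lambda>(e, i, j). A (fst e, i) (snd e, j)) w)"
    unfolding word_trace_def by (intro sum.cong refl sum.swap)
  finally show ?thesis .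
qed

subsection \<open>Block Gaussian matrices\<close>

definition block_part :: "('a \<Rightarrow> 'd block_matrix) \<Rightarrow> 'd \<times> 'd \<times> nat \<times> nat \<times> (complex \<Rightarrow> real) \<Rightarrow> 'a \<Rightarrow> real" where
  "block_part X = (\<lambda>(p, q, i, j, part) \<omega>. part (X \<omega> (p, i) (q, j)))"

definition block_index :: "nat \<Rightarrow> ('d \<times> 'd \<times> nat \<times> nat \<times> (complex \<Rightarrow> real)) set" where
  "block_index N = UNIV \<times> UNIV \<times> {..<N} \<times> {..<N} \<times> {Re, Im}"

text \<open>The real span of all real and imaginary parts; joint Gaussianity says precisely that its
  members are Gaussian.\<close>

definition block_span :: "nat \<Rightarrow> ('a \<Rightarrow> 'd::finite block_matrix) \<Rightarrow> ('a \<Rightarrow> real) set" where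
  "block_span N X = {\<lambda>\<omega>. \<Sum>i\<in>block_index N. c i * block_part X i \<omega> | c. True}"

lemma block_gaussian_blocks:
  fixes X :: "'a \<Rightarrow> 'd::finite block_matrix"
  assumes bg: "block_gaussian \<sigma> N M X" and N: "1 \<le> N"
  shows "gaussian_blocks M (block_span N X) N (cov_letters \<sigma>) (\<lambda>(e, i, j) \<omega>. X \<omega> (fst e, i) (snd e, j))"
proof -
  interpret prob_space M using bg by (simp add: block_gaussian_def)
  let ?I = "block_index N :: ('d \<times> 'd \<times> nat \<times> nat \<times> (complex \<Rightarrow> real)) set"
  have fin: "finite ?I" by (simp add: block_index_def)
  have part_in_span: "block_part X i \<in> block_span N X" if "i \<in> ?I" for i
  proof -
    have "block_part X i \<omega> = (\<Sum>j\<in>?I. of_bool (j = i) * block_part X j \<omega>)" for \<omega>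
    proof -
      have "of_bool (j = i) * block_part X j \<omega> = (if j = i then block_part X i \<omega> else 0)" for j by auto
      then show ?thesis using fin that by simp
    qed
    then have "block_part X i = (\<lambda>\<omega>. \<Sum>j\<in>?I. of_bool (j = i) * block_part X j \<omega>)" by (rule ext)
    then show ?thesis unfolding block_span_def by (intro CollectI exI[of _ "\<lambda>j. of_bool (j = i)"] conjI TrueI)
  qed
  have gauss: "gaussian_rv M v" if "v \<in> block_span N X" for v
    using bg that unfolding block_gaussian_def jointly_gaussian_def block_span_def block_index_def block_part_def by blast
  have mean_part: "expectation (block_part X i) = 0" if "i \<in> ?I" for i
    using bg that unfolding block_gaussian_def block_index_def block_part_def by auto
  \<comment> \<open>A vanishing Bochner integral alone does not give integrability; this is taken
    from Gaussianity.\<close>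
  have int_part: "integrable M (block_part X i)" if "i \<in> ?I" for i
    using gaussian_rv_moments(1)[OF gauss[OF part_in_span[OF that]] mean_part[OF that], of 1] by simp
  have mean: "expectation v = 0" if v_span: "v \<in> block_span N X" for v
  proof -
    obtain c where v: "v = (\<lambda>\<omega>. \<Sum>i\<in>?I. c i * block_part X i \<omega>)" using v_span by (auto simp: block_span_def)
    have "expectation v = (\<Sum>i\<in>?I. expectation (\<lambda>\<omega>. c i * block_part X i \<omega>))"
      unfolding v by (intro Bochner_Integration.integral_sum integrable_mult_right int_part)
    then show ?thesis by (simp add: mean_part)
  qed
  have lin: "(\<lambda>\<omega>. u \<omega> + t * v \<omega>) \<in> block_span N X" if uv: "u \<in> block_span N X" "v \<in> block_span N X" for u v t
  proof -
    obtain c d where "u = (\<lambda>\<omega>. \<Sum>i\<in>?I. c i * block_part X i \<omega>)" "v = (\<lambda>\<omega>. \<Sum>i\<in>?I. d i * block_part X i \<omega>)"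
      using uv unfolding block_span_def by auto
    then have "(\<lambda>\<omega>. u \<omega> + t * v \<omega>) = (\<lambda>\<omega>. \<Sum>i\<in>?I. (c i + t * d i) * block_part X i \<omega>)"
      by (simp add: sum.distrib sum_distrib_left algebra_simps)
    then show ?thesis unfolding block_span_def by (intro CollectI exI[of _ "\<lambda>i. c i + t * d i"] conjI TrueI)
  qed
  interpret gaussian_space M "block_span N X" by unfold_locales (fact lin gauss mean)+
  show ?thesis
  proof
    show "1 \<le> N" by (rule N)
  next
    fix v :: "('d \<times> 'd) \<times> nat \<times> nat"
    assume v: "v \<in> entry_vars N"
    obtain p q i j where [simp]: "v = ((p, q), i, j)" by (metis prod.exhaust)
    have "(p, q, i, j, Re) \<in> ?I" "(p, q, i, j, Im) \<in> ?I" using v by (auto simp: entry_vars_def block_index_def)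
    from this[THEN part_in_span] show "(\<lambda>(e, i, j) \<omega>. X \<omega> (fst e, i) (snd e, j)) v \<in> CV"
      by (simp add: CV_def block_part_def)
  next
    fix i j k l e f assume "i < N" "j < N" "k < N" "l < N"
    then have "(\<integral>\<omega>. X \<omega> (fst e, i) (snd e, j) * X \<omega> (fst f, k) (snd f, l) \<partial>M) =
          1 / of_nat N * of_bool (i = l) * of_bool (j = k) * complex_of_real (\<sigma> (fst e) (snd e) (fst f) (snd f))"
      using bg by (simp add: block_gaussian_def)
    then show "(\<integral>\<omega>. (case (e, i, j) of (e, i, j) \<Rightarrow> \<lambda>\<omega>. X \<omega> (fst e, i) (snd e, j)) \<omega> *
        (case (f, k, l) of (e, i, j) \<Rightarrow> \<lambda>\<omega>. X \<omega> (fst e, i) (snd e, j)) \<omega> \<partial>M) =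
      of_bool (i = l) * of_bool (j = k) * cov_letters \<sigma> e f / of_nat N"
      by (simp add: cov_letters_def)
  qed
qed

text \<open>The limit is expressed through a function \<open>\<gamma>\<close> on pairs of words, of
  which only its recursion is passed on. This separates the random matrices from the analysis of
  generating functions.\<close>

theorem trace_cov_limit:
  fixes \<sigma> :: "'d::finite covariance"
  assumes block: "\<And>N. 1 \<le> N \<Longrightarrow> block_gaussian \<sigma> N (M N) (X N)"
  obtains \<gamma> :: "('d \<times> 'd) list \<Rightarrow> ('d \<times> 'd) list \<Rightarrow> complex" where
    "\<And>u. \<gamma> [] u = 0"
    "\<And>e w u. \<gamma> (e # w) u =
      split_sum (\<lambda>a g b. cov_letters \<sigma> e g * (tau (cov_letters \<sigma>) b * \<gamma> a u + tau (cov_letters \<sigma>) a * \<gamma> b u)) w +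
      split_sum (\<lambda>a g b. cov_letters \<sigma> e g * tau (cov_letters \<sigma>) (w @ b @ a)) u"
    "\<And>m n. trace_cov M X m n \<longlonglongrightarrow> (\<Sum>p\<in>UNIV. \<Sum>w\<in>paths m p p. \<Sum>q\<in>UNIV. \<Sum>u\<in>paths n q q. \<gamma> w u)"
proof -
  let ?s = "cov_letters \<sigma>"
  let ?x = "\<lambda>N (e, i, j) \<omega>. X N \<omega> (fst e, i) (snd e, j)"
  define c where "c N us = (\<integral>\<omega>. centred_prod (tau ?s) N us (\<lambda>v. ?x N v \<omega>) \<partial>M N)" for N us
  have gb: "gaussian_blocks (M N) (block_span N (X N)) N ?s (?x N)" if "1 \<le> N" for N
    using block_gaussian_blocks[OF block[OF that] that] .
  interpret loop_limit ?s c
  proof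
    fix N :: nat assume N: "1 \<le> N"
    interpret gaussian_blocks "M N" "block_span N (X N)" N ?s "?x N" by (rule gb[OF N])
    show "c N [] = 1" unfolding c_def by (rule mean_C_Nil)
    show "c N ([] # us) = 0" for us unfolding c_def by (rule mean_C_empty_word)
    show "c N ((e # w) # us) =
      split_sum (\<lambda>a g b. ?s e g * (c N (a # b # us) / of_nat N + tau ?s b * c N (a # us) + tau ?s a * c N (b # us))) w +
      split_sum (\<lambda>p u q. split_sum (\<lambda>a g b. ?s e g *
        (c N ((w @ b @ a) # p @ q) / of_nat N + tau ?s (w @ b @ a) * c N (p @ q))) u) us" for e w us
      unfolding c_def by (rule centred_loop_equation)
  qed
  have cov: "trace_cov M X m n N = (\<Sum>p\<in>UNIV. \<Sum>w\<in>paths m p p. \<Sum>q\<in>UNIV. \<Sum>u\<in>paths n q q. c N [w, u] - c N [w] * c N [u])"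
    if N: "1 \<le> N" for m n N
  proof -
    interpret gaussian_blocks "M N" "block_span N (X N)" N ?s "?x N" by (rule gb[OF N])
    have tr: "block_trace_power N (X N \<omega>) k = (\<Sum>p\<in>UNIV. \<Sum>w\<in>paths k p p. T w \<omega>)" for k \<omega>
    proof -
      have "(\<lambda>(e, i, j). X N \<omega> (fst e, i) (snd e, j)) = xs \<omega>" by (rule ext) (simp add: case_prod_beta)
      then show ?thesis unfolding block_trace_power_paths by simp
    qed
    have e1: "EE (\<lambda>\<omega>. \<Sum>p\<in>UNIV. \<Sum>w\<in>paths k p p. F w \<omega>) = (\<Sum>p\<in>UNIV. \<Sum>w\<in>paths k p p. EE (F w))"
      if "\<And>w. finite_moments (M N) (F w)" for k F
    proof -
      have "EE (\<lambda>\<omega>. \<Sum>p\<in>UNIV. \<Sum>w\<in>paths k p p. F w \<omega>) = (\<Sum>p\<in>UNIV. EE (\<lambda>\<omega>. \<Sum>w\<in>paths k p p. F w \<omega>))"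
        by (intro EE_sum finite_moments_sum that)
      also have "\<dots> = (\<Sum>p\<in>UNIV. \<Sum>w\<in>paths k p p. EE (F w))"
        by (intro sum.cong refl EE_sum that)
      finally show ?thesis .
    qed
    \<comment> \<open>A covariance does not change when constants are subtracted, so the centring
      \<open>N * tau\<close> may be inserted.\<close>
    have prod: "EE (\<lambda>\<omega>. T w \<omega> * T u \<omega>) - EE (T w) * EE (T u) = c N [w, u] - c N [w] * c N [u]" for w u
    proof -
      define cw cu where "cw = of_nat N * tau ?s w" and "cu = of_nat N * tau ?s u"
      have one: "EE (\<lambda>\<omega>. T v \<omega> - k) = EE (T v) - k" for v k
        using EE_add[OF fm_T finite_moments_const, of v "- k"] prob_space by simp
      have "c N [w, u] = EE (\<lambda>\<omega>. T w \<omega> * T u \<omega> + (- cu * T w \<omega> + (- cw * T u \<omega> + cw * cu)))"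
        by (simp add: c_def centred_prod_Cons cw_def cu_def algebra_simps)
      also have "\<dots> = EE (\<lambda>\<omega>. T w \<omega> * T u \<omega>) + EE (\<lambda>\<omega>. - cu * T w \<omega> + (- cw * T u \<omega> + cw * cu))"
        by (intro EE_add finite_moments_mult finite_moments_add finite_moments_const fm_T)
      also have "EE (\<lambda>\<omega>. - cu * T w \<omega> + (- cw * T u \<omega> + cw * cu)) = EE (\<lambda>\<omega>. - cu * T w \<omega>) + EE (\<lambda>\<omega>. - cw * T u \<omega> + cw * cu)"
        by (intro EE_add finite_moments_mult finite_moments_add finite_moments_const fm_T)
      also have "EE (\<lambda>\<omega>. - cw * T u \<omega> + cw * cu) = EE (\<lambda>\<omega>. - cw * T u \<omega>) + EE (\<lambda>\<omega>. cw * cu)"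
        by (intro EE_add finite_moments_mult finite_moments_add finite_moments_const fm_T)
      finally have "c N [w, u] = EE (\<lambda>\<omega>. T w \<omega> * T u \<omega>) - cu * EE (T w) - cw * EE (T u) + cw * cu"
        using prob_space by simp
      moreover have "c N [w] = EE (T w) - cw" "c N [u] = EE (T u) - cu"
        by (simp_all add: c_def centred_prod_Cons cw_def cu_def one)
      ultimately show ?thesis by (simp only:) (simp add: algebra_simps)
    qed
    have "EE (\<lambda>\<omega>. block_trace_power N (X N \<omega>) m * block_trace_power N (X N \<omega>) n) =
      EE (\<lambda>\<omega>. \<Sum>p\<in>UNIV. \<Sum>w\<in>paths m p p. \<Sum>q\<in>UNIV. \<Sum>u\<in>paths n q q. T w \<omega> * T u \<omega>)"
      unfolding tr sum_distrib_right unfolding sum_distrib_left ..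
    also have "\<dots> = (\<Sum>p\<in>UNIV. \<Sum>w\<in>paths m p p. \<Sum>q\<in>UNIV. \<Sum>u\<in>paths n q q. EE (\<lambda>\<omega>. T w \<omega> * T u \<omega>))"
      by (subst e1) (auto intro!: finite_moments_sum finite_moments_mult fm_T sum.cong e1)
    finally have "trace_cov M X m n N =
      (\<Sum>p\<in>UNIV. \<Sum>w\<in>paths m p p. \<Sum>q\<in>UNIV. \<Sum>u\<in>paths n q q. EE (\<lambda>\<omega>. T w \<omega> * T u \<omega>)) -
      (\<Sum>p\<in>UNIV. \<Sum>w\<in>paths m p p. EE (T w)) * (\<Sum>p\<in>UNIV. \<Sum>w\<in>paths n p p. EE (T w))"
      unfolding trace_cov_def Cov_def tr e1[OF fm_T] by simp
    also have "\<dots> = (\<Sum>p\<in>UNIV. \<Sum>w\<in>paths m p p. \<Sum>q\<in>UNIV. \<Sum>u\<in>paths n q q. EE (\<lambda>\<omega>. T w \<omega> * T u \<omega>) - EE (T w) * EE (T u))"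
      unfolding sum_distrib_right unfolding sum_distrib_left sum_subtractf ..
    finally show ?thesis unfolding prod .
  qed
  have "trace_cov M X m n \<longlonglongrightarrow> (\<Sum>p\<in>UNIV. \<Sum>w\<in>paths m p p. \<Sum>q\<in>UNIV. \<Sum>u\<in>paths n q q. cl [w, u])" for m n
  proof (rule tendsto_cong_pos[OF cov], assumption)
    show "(\<lambda>N. \<Sum>p\<in>UNIV. \<Sum>w\<in>paths m p p. \<Sum>q\<in>UNIV. \<Sum>u\<in>paths n q q. c N [w, u] - c N [w] * c N [u]) \<longlonglongrightarrow>
      (\<Sum>p\<in>UNIV. \<Sum>w\<in>paths m p p. \<Sum>q\<in>UNIV. \<Sum>u\<in>paths n q q. cl [w, u])"
    proof (intro tendsto_sum)
      fix w u
      have "(\<lambda>N. c N [w, u] - c N [w] * c N [u]) \<longlonglongrightarrow> cl [w, u] - cl [w] * cl [u]"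
        by (intro tendsto_diff tendsto_mult c_tendsto)
      then show "(\<lambda>N. c N [w, u] - c N [w] * c N [u]) \<longlonglongrightarrow> cl [w, u]" by (simp add: cl_single)
    qed
  qed
  then show thesis
    by (intro that[of "\<lambda>w u. cl [w, u]"] cl_empty_word cl_pair_Cons)
qed

subsection \<open>Matrices over a C*-algebra\<close>

lemma matrix_mult_nth: "(A ** B) $ p $ q = (\<Sum>k\<in>UNIV. A $ p $ k * B $ k $ q)"
  by (simp add: matrix_matrix_mult_def)

lemma matrix_vector_mult_nth: "(A *v x) $ p = (\<Sum>k\<in>UNIV. A $ p $ k * x $ k)"
  by (simp add: matrix_vector_mult_def)

lemma mat_nth: "mat c $ p $ q = (if p = q then c else 0)"
  by (simp add: mat_def)

lemma
  fixes A B C :: "'r::ring_1^'d::finite^'d"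
  shows matrix_diff_rdistrib: "(A - B) ** C = A ** C - B ** C"
    and matrix_diff_ldistrib: "C ** (A - B) = C ** A - C ** B"
    and matrix_add_rdistrib': "(A + B) ** C = A ** C + B ** C"
    and matrix_add_ldistrib': "C ** (A + B) = C ** A + C ** B"
  by (simp_all add: vec_eq_iff matrix_mult_nth algebra_simps sum.distrib sum_subtractf)

lemma matrix_inv_eqI:
  fixes A :: "'r::semiring_1^'d::finite^'d"
  assumes "A ** B = mat 1" "B ** A = mat 1"
  shows "matrix_inv A = B"
proof -
  have "A ** matrix_inv A = mat 1 \<and> matrix_inv A ** A = mat 1"
    unfolding matrix_inv_def by (rule someI[of _ B]) (use assms in auto)
  then show ?thesis by (metis assms(2) matrix_mul_assoc matrix_mul_lid matrix_mul_rid)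
qed

lemma matrix_inv_mult:
  fixes A :: "'r::semiring_1^'d::finite^'d"
  assumes "invertible A"
  shows "A ** matrix_inv A = mat 1" "matrix_inv A ** A = mat 1"
  using assms matrix_inv_eqI[of A] unfolding invertible_def by metis+

definition scale_mat :: "complex \<Rightarrow> 'b::cstar_algebra^'d^'d \<Rightarrow> 'b^'d^'d" where
  "scale_mat c A = (\<chi> p q. scaleC c (A $ p $ q))"

lemma scale_mat_nth [simp]: "scale_mat c A $ p $ q = scaleC c (A $ p $ q)"
  by (simp add: scale_mat_def)

lemma
  fixes A B :: "'b::cstar_algebra^'d::finite^'d"
  shows scale_mat_mult_left: "scale_mat c A ** B = scale_mat c (A ** B)"
    and scale_mat_mult_right: "A ** scale_mat c B = scale_mat c (A ** B)"
    and scale_mat_scale_mat: "scale_mat c (scale_mat c' A) = scale_mat (c * c') A"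
    and scale_mat_one: "scale_mat 1 A = A"
    and scale_mat_diff: "scale_mat c (A - B) = scale_mat c A - scale_mat c B"
    and mat_scaleC: "(mat (scaleC c 1) :: 'b^'d^'d) = scale_mat c (mat 1)"
  by (simp_all add: vec_eq_iff matrix_mult_nth scaleC_mult_left scaleC_mult_right scaleC_sum_right
      scaleC_scaleC mat_nth scaleC_diff_right)

fun matpow :: "'r::semiring_1^'d^'d \<Rightarrow> nat \<Rightarrow> 'r^'d^'d" where
  "matpow A 0 = mat 1"
| "matpow A (Suc n) = A ** matpow A n"

lemma matpow_Suc_right: "matpow A (Suc n) = matpow A n ** A"
  by (induction n) (simp_all add: matrix_mul_assoc)

lemma matpow_add: "matpow A (m + n) = matpow A m ** matpow A n"
  by (induction m) (simp_all add: matrix_mul_assoc)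

lemma matpow_scale_mat: "matpow (scale_mat c A) n = scale_mat (c ^ n) (matpow A n)"
  by (induction n) (simp_all add: scale_mat_one scale_mat_mult_left scale_mat_mult_right scale_mat_scale_mat mult.commute)

text \<open>A crude matrix norm, dominating every row sum; it controls powers entrywise and makes
  Neumann series converge entrywise.\<close>

definition entry_sum :: "'r::real_normed_vector^'d^'d \<Rightarrow> real" where
  "entry_sum A = (\<Sum>p\<in>UNIV. \<Sum>q\<in>UNIV. norm (A $ p $ q))"

lemma entry_sum_nonneg: "0 \<le> entry_sum A"
  by (simp add: entry_sum_def sum_nonneg)

lemma row_le_entry_sum: "(\<Sum>q\<in>UNIV. norm (A $ p $ q)) \<le> entry_sum A"
  unfolding entry_sum_def by (rule member_le_sum) (auto intro: sum_nonneg)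

lemma norm_entry_le: "norm (A $ p $ q) \<le> entry_sum A"
  by (rule order_trans[OF _ row_le_entry_sum[of A p]]) (rule member_le_sum, auto)

lemma entry_sum_scale_mat: "entry_sum (scale_mat c A) = cmod c * entry_sum A"
  by (simp add: entry_sum_def norm_scaleC sum_distrib_left)

lemma norm_matpow_le:
  fixes A :: "'r::real_normed_algebra_1^'d::finite^'d"
  shows "norm (matpow A n $ p $ q) \<le> entry_sum A ^ n"
proof (induction n arbitrary: p)
  case 0
  then show ?case by (simp add: mat_nth)
next
  case (Suc n)
  have "norm (matpow A (Suc n) $ p $ q) \<le> (\<Sum>k\<in>UNIV. norm (A $ p $ k) * entry_sum A ^ n)"
    by (simp add: matrix_mult_nth) (intro sum_norm_le order_trans[OF norm_mult_ineq] mult_left_mono Suc norm_ge_zero)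
  also have "\<dots> \<le> entry_sum A * entry_sum A ^ n"
    unfolding sum_distrib_right[symmetric]
    by (intro mult_right_mono row_le_entry_sum zero_le_power entry_sum_nonneg)
  finally show ?case by simp
qed

lemma neumann_series:
  fixes A :: "'b::cstar_algebra^'d::finite^'d"
  assumes "entry_sum A < 1"
  obtains F :: "'b^'d^'d" where "(mat 1 - A) ** F = mat 1" "F ** (mat 1 - A) = mat 1"
    "\<And>p q. (\<lambda>n. matpow A n $ p $ q) sums (F $ p $ q)"
    "\<And>p q. norm (F $ p $ q) \<le> 1 / (1 - entry_sum A)"
proof -
  have geo: "summable (\<lambda>n. entry_sum A ^ n)"
    using assms entry_sum_nonneg[of A] by (intro summable_geometric) auto
  have sn: "summable (\<lambda>n. norm (matpow A n $ p $ q))" for p q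
    by (rule summable_comparison_test[OF _ geo]) (auto simp: norm_matpow_le)
  define F where "F = (\<chi> p q. \<Sum>n. matpow A n $ p $ q)"
  have F: "(\<lambda>n. matpow A n $ p $ q) sums (F $ p $ q)" for p q
    using summable_norm_cancel[OF sn[of p q]] by (simp add: F_def summable_sums)
  have "norm (F $ p $ q) \<le> 1 / (1 - entry_sum A)" for p q
  proof -
    have "norm (F $ p $ q) \<le> (\<Sum>n. norm (matpow A n $ p $ q))"
      unfolding F_def using summable_norm[OF sn] by simp
    also have "\<dots> \<le> (\<Sum>n. entry_sum A ^ n)" by (intro suminf_le norm_matpow_le sn geo)
    also have "\<dots> = 1 / (1 - entry_sum A)" using assms entry_sum_nonneg[of A] by (intro suminf_geometric) auto
    finally show ?thesis .
  qed
  moreover have shift: "(\<lambda>n. matpow A (Suc n) $ p $ q) sums (F $ p $ q - mat 1 $ p $ q)" for p q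
    using F[of p q] by (subst sums_Suc_iff) simp
  have "(A ** F) $ p $ q = F $ p $ q - mat 1 $ p $ q" for p q
  proof -
    have "(\<lambda>n. \<Sum>k\<in>UNIV. A $ p $ k * matpow A n $ k $ q) sums (\<Sum>k\<in>UNIV. A $ p $ k * F $ k $ q)"
      by (intro sums_sum sums_mult F)
    then have "(\<lambda>n. matpow A (Suc n) $ p $ q) sums ((A ** F) $ p $ q)" by (simp add: matrix_mult_nth)
    then show ?thesis by (rule sums_unique2) (rule shift)
  qed
  then have "A ** F = F - mat 1" by (simp add: vec_eq_iff)
  then have "(mat 1 - A) ** F = mat 1" by (simp add: matrix_diff_rdistrib)
  moreover have "(F ** A) $ p $ q = F $ p $ q - mat 1 $ p $ q" for p q
  proof -
    have "(\<lambda>n. \<Sum>k\<in>UNIV. matpow A n $ p $ k * A $ k $ q) sums (\<Sum>k\<in>UNIV. F $ p $ k * A $ k $ q)"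
      by (intro sums_sum sums_mult2 F)
    then have "(\<lambda>n. matpow A (Suc n) $ p $ q) sums ((F ** A) $ p $ q)"
      by (simp only: matpow_Suc_right matrix_mult_nth)
    then show ?thesis by (rule sums_unique2) (rule shift)
  qed
  then have "F ** A = F - mat 1" by (simp add: vec_eq_iff)
  then have "F ** (mat 1 - A) = mat 1" by (simp add: matrix_diff_ldistrib)
  ultimately show thesis using that[of F] F by blast
qed

subsection \<open>The resolvent of a selfadjoint matrix\<close>

definition resolv :: "'b::cstar_algebra^'d^'d \<Rightarrow> complex \<Rightarrow> 'b^'d::finite^'d" where
  "resolv Y z = matrix_inv (resolvent_arg Y z)"

lemma resolvent_arg_eq: "resolvent_arg Y z = scale_mat z (mat 1) - Y"
  by (simp add: resolvent_arg_def mat_scaleC)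

lemma resolvent_arg_diff: "resolvent_arg Y z - resolvent_arg Y z' = scale_mat (z - z') (mat 1)"
  by (simp add: resolvent_arg_eq vec_eq_iff scaleC_diff_left)

lemma
  assumes "invertible (resolvent_arg Y z)"
  shows resolv_right: "resolvent_arg Y z ** resolv Y z = mat 1"
    and resolv_left: "resolv Y z ** resolvent_arg Y z = mat 1"
  using matrix_inv_mult[OF assms] by (simp_all add: resolv_def)

lemma resolv_eqI: "resolvent_arg Y z ** B = mat 1 \<Longrightarrow> B ** resolvent_arg Y z = mat 1 \<Longrightarrow> resolv Y z = B"
  unfolding resolv_def by (rule matrix_inv_eqI)

lemma resolv_equation:
  fixes Y :: "'b::cstar_algebra^'d::finite^'d"
  assumes "invertible (resolvent_arg Y z)"
  shows "(\<Sum>k\<in>UNIV. Y $ p $ k * resolv Y z $ k $ q) = scaleC z (resolv Y z $ p $ q) - mat 1 $ p $ q"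
proof -
  have "Y ** resolv Y z = scale_mat z (resolv Y z) - mat 1"
    using resolv_right[OF assms] unfolding resolvent_arg_eq
    by (simp add: matrix_diff_rdistrib scale_mat_mult_left algebra_simps)
  then show ?thesis by (simp add: matrix_mult_nth[symmetric])
qed

lemma resolvent_identity:
  fixes Y :: "'b::cstar_algebra^'d::finite^'d"
  assumes "invertible (resolvent_arg Y z)" "invertible (resolvent_arg Y z')"
  shows "resolv Y z - resolv Y z' = scale_mat (z' - z) (resolv Y z ** resolv Y z')"
proof -
  have "resolv Y z ** (resolvent_arg Y z' - resolvent_arg Y z) ** resolv Y z' = resolv Y z - resolv Y z'"
    using resolv_left[OF assms(1)] resolv_right[OF assms(2)]
    by (simp add: matrix_diff_ldistrib matrix_diff_rdistrib matrix_mul_assoc[symmetric])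
  then show ?thesis by (simp add: resolvent_arg_diff scale_mat_mult_left scale_mat_mult_right)
qed

text \<open>From the factorization \<open>z - Y = (z\<^sub>0 - Y) (1 - E)\<close> with
  \<open>E = (z\<^sub>0 - z) R(z\<^sub>0)\<close> and the Neumann series for \<open>1 - E\<close>.
  The explicit bound is needed for differentiability.\<close>

lemma resolv_perturb:
  fixes Y :: "'b::cstar_algebra^'d::finite^'d"
  assumes "invertible (resolvent_arg Y z\<^sub>0)" "cmod (z - z\<^sub>0) * entry_sum (resolv Y z\<^sub>0) < 1"
  shows "invertible (resolvent_arg Y z)"
    and "norm (resolv Y z $ p $ q) \<le>
      (\<Sum>k\<in>UNIV. 1 / (1 - cmod (z - z\<^sub>0) * entry_sum (resolv Y z\<^sub>0)) * norm (resolv Y z\<^sub>0 $ k $ q))"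
proof -
  define E where "E = scale_mat (z\<^sub>0 - z) (resolv Y z\<^sub>0)"
  have eE: "entry_sum E = cmod (z - z\<^sub>0) * entry_sum (resolv Y z\<^sub>0)"
    by (simp add: E_def entry_sum_scale_mat norm_minus_commute)
  then obtain F :: "'b^'d^'d" where F: "(mat 1 - E) ** F = mat 1" "F ** (mat 1 - E) = mat 1"
    and Fb: "\<And>p q. norm (F $ p $ q) \<le> 1 / (1 - entry_sum E)"
    using neumann_series[of E] assms(2) by metis
  have A: "resolvent_arg Y z = resolvent_arg Y z\<^sub>0 ** (mat 1 - E)"
    using resolv_right[OF assms(1)]
    by (simp add: E_def matrix_diff_ldistrib scale_mat_mult_right)
       (simp add: resolvent_arg_eq vec_eq_iff scaleC_diff_left)
  have right: "resolvent_arg Y z ** (F ** resolv Y z\<^sub>0) = mat 1"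
    unfolding A using F(1) resolv_right[OF assms(1)]
    by (metis matrix_mul_assoc matrix_mul_rid)
  have left: "(F ** resolv Y z\<^sub>0) ** resolvent_arg Y z = mat 1"
    unfolding A using F(2) resolv_left[OF assms(1)]
    by (metis matrix_mul_assoc matrix_mul_rid)
  show "invertible (resolvent_arg Y z)" unfolding invertible_def using left right by blast
  have "resolv Y z = F ** resolv Y z\<^sub>0" by (rule resolv_eqI[OF right left])
  then show "norm (resolv Y z $ p $ q) \<le>
      (\<Sum>k\<in>UNIV. 1 / (1 - cmod (z - z\<^sub>0) * entry_sum (resolv Y z\<^sub>0)) * norm (resolv Y z\<^sub>0 $ k $ q))"
    unfolding eE[symmetric] matrix_mult_nth[of F] \<open>resolv Y z = F ** resolv Y z\<^sub>0\<close>
    by (intro sum_norm_le order_trans[OF norm_mult_ineq] mult_right_mono Fb norm_ge_zero)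
qed

lemma resolv_large:
  fixes Y :: "'b::cstar_algebra^'d::finite^'d"
  assumes "entry_sum Y < cmod z"
  shows "invertible (resolvent_arg Y z)"
    and "(\<lambda>n. scaleC (1 / z ^ Suc n) (matpow Y n $ p $ q)) sums (resolv Y z $ p $ q)"
proof -
  have z: "z \<noteq> 0" using assms entry_sum_nonneg[of Y] by auto
  define E where "E = scale_mat (1 / z) Y"
  have "entry_sum E < 1" using assms z by (simp add: E_def entry_sum_scale_mat norm_divide divide_simps)
  then obtain F :: "'b^'d^'d" where F: "(mat 1 - E) ** F = mat 1" "F ** (mat 1 - E) = mat 1"
    and Fs: "\<And>p q. (\<lambda>n. matpow E n $ p $ q) sums (F $ p $ q)"
    using neumann_series[of E] by metis
  have A: "resolvent_arg Y z = scale_mat z (mat 1 - E)"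
    using z by (simp add: E_def resolvent_arg_eq scale_mat_diff scale_mat_scale_mat scale_mat_one)
  have right: "resolvent_arg Y z ** scale_mat (1 / z) F = mat 1"
    and left: "scale_mat (1 / z) F ** resolvent_arg Y z = mat 1"
    unfolding A using F z by (simp_all add: scale_mat_mult_left scale_mat_mult_right scale_mat_scale_mat scale_mat_one)
  show "invertible (resolvent_arg Y z)" unfolding invertible_def using left right by blast
  have R: "resolv Y z = scale_mat (1 / z) F" by (rule resolv_eqI[OF right left])
  have "(\<lambda>n. scaleC (1 / z) (matpow E n $ p $ q)) sums scaleC (1 / z) (F $ p $ q)"
    by (rule bounded_linear.sums[OF bounded_linear_scaleC Fs])
  then show "(\<lambda>n. scaleC (1 / z ^ Suc n) (matpow Y n $ p $ q)) sums (resolv Y z $ p $ q)"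
    by (simp add: R E_def matpow_scale_mat scaleC_scaleC power_one_over)
qed

text \<open>The imaginary part of \<open>\<Sum>p. x\<^sub>p\<^sup>* ((z - Y) x)\<^sub>p\<close> is \<open>Im z \<Sum>p. x\<^sub>p\<^sup>* x\<^sub>p\<close>, since \<open>Y\<close> is selfadjoint.\<close>

lemma resolvent_arg_bounded_below:
  fixes Y :: "'b::cstar_algebra^'d::finite^'d" and x :: "'b^'d"
  assumes sa: "\<And>p q. star (Y $ p $ q) = Y $ q $ p"
    and b: "\<And>p. norm ((resolvent_arg Y z *v x) $ p) \<le> b" and z: "Im z \<noteq> 0"
  shows "norm (x $ j) \<le> real CARD('d) * b / \<bar>Im z\<bar>"
proof -
  define y where "y = resolvent_arg Y z *v x"
  define n where "n = (\<Sum>p\<in>UNIV. star (x $ p) * x $ p)"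
  define k where "k = (\<Sum>p\<in>UNIV. \<Sum>q\<in>UNIV. star (x $ p) * Y $ p $ q * x $ q)"
  define D where "D = (\<Sum>p\<in>UNIV. star (x $ p) * y $ p)"
  have sn: "star n = n" by (simp add: n_def star_sum star_mult star_star)
  have "star k = (\<Sum>p\<in>UNIV. \<Sum>q\<in>UNIV. star (x $ q) * Y $ q $ p * x $ p)"
    by (simp add: k_def star_sum star_mult star_star sa mult.assoc)
  also have "\<dots> = k" unfolding k_def by (rule sum.swap)
  finally have sk: "star k = k" .
  have yp: "y $ p = scaleC z (x $ p) - (\<Sum>q\<in>UNIV. Y $ p $ q * x $ q)" for p
  proof -
    have "y $ p = (\<Sum>q\<in>UNIV. (if p = q then scaleC z (x $ q) else 0) - Y $ p $ q * x $ q)"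
      unfolding y_def matrix_vector_mult_nth
      by (intro sum.cong refl) (simp add: resolvent_arg_def mat_nth algebra_simps scaleC_mult_left)
    then show ?thesis by (simp add: sum_subtractf)
  qed
  have D: "D = scaleC z n - k"
    by (simp add: D_def yp n_def k_def right_diff_distrib sum_subtractf scaleC_sum_right scaleC_mult_right
        sum_distrib_left mult.assoc)
  have "D - star D = scaleC (z - cnj z) n"
    by (simp add: D star_diff star_scaleC sn sk scaleC_diff_left)
  then have "norm (scaleC (z - cnj z) n) \<le> norm D + norm (star D)"
    using norm_triangle_ineq4[of D "star D"] by simp
  then have 1: "\<bar>Im z\<bar> * norm n \<le> norm D"
    by (simp add: norm_scaleC complex_diff_cnj norm_mult)
  \<comment> \<open>For a coordinate of maximal norm the lower bound on \<open>norm n\<close> is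
    quadratic in that norm and the upper bound on \<open>norm D\<close> is linear, so one factor
    cancels.\<close>
  obtain i where i: "\<And>p. norm (x $ p) \<le> norm (x $ i)"
  proof -
    have "Max (range (\<lambda>p. norm (x $ p))) \<in> range (\<lambda>p. norm (x $ p))" by (intro Max_in) auto
    then obtain i where "Max (range (\<lambda>p. norm (x $ p))) = norm (x $ i)" by (rule rangeE)
    then show thesis using that[of i] by (metis Max_ge finite_class.finite_UNIV finite_imageI rangeI)
  qed
  have 2: "norm D \<le> (\<Sum>p\<in>(UNIV :: 'd set). norm (x $ i) * b)"
    unfolding D_def using b i
    by (intro sum_norm_le order_trans[OF norm_mult_ineq] mult_mono) (auto simp: y_def)
  have "(norm (x $ i))\<^sup>2 \<le> norm n"
    unfolding n_def by (rule norm_square_le_sum) auto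
  then have "\<bar>Im z\<bar> * (norm (x $ i))\<^sup>2 \<le> \<bar>Im z\<bar> * norm n" by (rule mult_left_mono) simp
  also note 1
  also note 2
  finally have "norm (x $ i) * (\<bar>Im z\<bar> * norm (x $ i)) \<le> norm (x $ i) * (real CARD('d) * b)"
    by (simp add: power2_eq_square mult_ac)
  moreover have "0 \<le> b" using b[of i] norm_ge_zero order_trans by blast
  ultimately have "\<bar>Im z\<bar> * norm (x $ i) \<le> real CARD('d) * b"
    by (cases "norm (x $ i) = 0") auto
  then have "norm (x $ i) \<le> real CARD('d) * b / \<bar>Im z\<bar>" using z by (simp add: pos_le_divide_eq mult.commute)
  then show ?thesis using i order_trans by blast
qed

lemma resolv_norm_le:
  fixes Y :: "'b::cstar_algebra^'d::finite^'d"
  assumes sa: "\<And>p q. star (Y $ p $ q) = Y $ q $ p"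
    and inv: "invertible (resolvent_arg Y z)" and z: "Im z \<noteq> 0"
  shows "norm (resolv Y z $ p $ q) \<le> real CARD('d) / \<bar>Im z\<bar>"
proof -
  define x :: "'b^'d" where "x = (\<chi> p. resolv Y z $ p $ q)"
  have "(resolvent_arg Y z *v x) $ k = mat 1 $ k $ q" for k
    by (simp add: resolv_right[OF inv, symmetric] matrix_vector_mult_nth matrix_mult_nth x_def)
  then have "norm ((resolvent_arg Y z *v x) $ k) \<le> 1" for k by (simp add: mat_nth)
  from resolvent_arg_bounded_below[OF sa this z, of p] show ?thesis by (simp add: x_def)
qed

text \<open>A lower bound on \<open>z - Y\<close> yields no inverse by itself. It does bound an
  existing inverse, so invertibility can be carried from far away down the vertical line through
  \<open>z\<close>, in steps proportional to the distance from the real axis.\<close>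

lemma resolvent_arg_invertible_nonreal:
  fixes Y :: "'b::cstar_algebra^'d::finite^'d"
  assumes sa: "\<And>p q. star (Y $ p $ q) = Y $ q $ p" and z: "Im z \<noteq> 0"
  shows "invertible (resolvent_arg Y z)"
proof -
  define d where "d = real CARD('d)"
  have d: "d \<ge> 1" by (simp add: d_def Suc_le_eq)
  \<comment> \<open>At height \<open>t0\<close> each of the \<open>d\<^sup>2\<close> resolvent
    entries is at most \<open>d / t0\<close>, so \<open>entry_sum\<close> is at most
    \<open>d ^ 3 / t0\<close>. A step of length \<open>t0 / (2 * d ^ 3)\<close>, which is
    \<open>(1 - q) * t0\<close>, keeps the perturbation at 1/2.\<close>
  define q where "q = 1 - 1 / (2 * d ^ 3)"
  have d3: "d ^ 3 \<ge> 1" using d by (rule one_le_power)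
  have d4: "1 < 2 * d ^ 3"
    by (rule less_le_trans[OF _ mult_left_mono[OF d3]]) auto
  have q: "0 < q" "q < 1" using d d4 by (simp_all add: q_def)
  define e where "e = sgn (Im z)"
  have e: "\<bar>e\<bar> = 1" using z by (simp add: e_def sgn_if)
  define T where "T = entry_sum Y + 1"
  have T: "T > 0" using entry_sum_nonneg[of Y] by (simp add: T_def)
  define P where "P t = Complex (Re z) (e * t)" for t
  have *: "\<forall>t \<ge> T * q ^ n. invertible (resolvent_arg Y (P t))" for n
  proof (induction n)
    case 0
    show ?case
    proof (intro allI impI)
      fix t assume "T * q ^ 0 \<le> t"
      then have "entry_sum Y < \<bar>Im (P t)\<bar>" using e T by (simp add: P_def abs_mult T_def)
      also have "\<dots> \<le> cmod (P t)" by (rule abs_Im_le_cmod)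
      finally show "invertible (resolvent_arg Y (P t))" by (rule resolv_large)
    qed
  next
    case (Suc n)
    show ?case
    proof (intro allI impI)
      fix t assume t: "T * q ^ Suc n \<le> t"
      define t0 where "t0 = t / q"
      have t0: "T * q ^ n \<le> t0" using t q by (simp add: t0_def pos_le_divide_eq mult_ac)
      have pos: "t0 > 0" using t0 T q by (smt (verit) mult_pos_pos zero_less_power)
      have inv: "invertible (resolvent_arg Y (P t0))" using Suc t0 by blast
      have "entry_sum (resolv Y (P t0)) \<le> (\<Sum>p\<in>(UNIV::'d set). \<Sum>q\<in>(UNIV::'d set). d / t0)"
        unfolding entry_sum_def d_def
        using resolv_norm_le[OF sa inv] pos e by (intro sum_mono) (auto simp: P_def abs_mult)
      also have "\<dots> = d ^ 3 / t0" by (simp add: d_def power3_eq_cube)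
      finally have es: "entry_sum (resolv Y (P t0)) \<le> d ^ 3 / t0" .
      have "P t - P t0 = \<i> * of_real (e * (t - t0))" by (simp add: P_def complex_eq_iff algebra_simps)
      then have "cmod (P t - P t0) = \<bar>t - t0\<bar>"
        by (simp only: norm_mult norm_ii norm_of_real abs_mult e mult_1)
      also have "t - t0 = - (t0 / (2 * d ^ 3))"
      proof -
        have "t = t0 * q" using q by (simp add: t0_def)
        then show ?thesis by (simp add: q_def algebra_simps)
      qed
      finally have c: "cmod (P t - P t0) = t0 / (2 * d ^ 3)" using pos d by simp
      have "cmod (P t - P t0) * entry_sum (resolv Y (P t0)) \<le> t0 / (2 * d ^ 3) * (d ^ 3 / t0)"
        unfolding c using es pos d by (intro mult_left_mono) auto
      also have "\<dots> < 1" using pos d by simp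
      finally show "invertible (resolvent_arg Y (P t))" by (rule resolv_perturb(1)[OF inv])
    qed
  qed
  have "(\<lambda>n. T * q ^ n) \<longlonglongrightarrow> T * 0" using q by (intro tendsto_mult_left LIMSEQ_power_zero) auto
  then have "\<forall>\<^sub>F n in sequentially. T * q ^ n < \<bar>Im z\<bar>" using z by (intro order_tendstoD) auto
  then obtain n where "T * q ^ n < \<bar>Im z\<bar>" by (auto simp: eventually_sequentially)
  then have "invertible (resolvent_arg Y (P \<bar>Im z\<bar>))" using *[of n] by auto
  moreover have "P \<bar>Im z\<bar> = z" by (simp add: P_def e_def complex_eq_iff sgn_mult_abs)
  ultimately show ?thesis by simp
qed

subsection \<open>Complex differentiability\<close>

text \<open>The values lie in a C*-algebra and not in a field, hence a Frechet derivative that is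
  required to be complex linear.\<close>

definition has_cderiv :: "(complex \<Rightarrow> 'b::cstar_algebra) \<Rightarrow> 'b \<Rightarrow> complex \<Rightarrow> bool" where
  "has_cderiv f D z \<longleftrightarrow> (f has_derivative (\<lambda>h. scaleC h D)) (at z)"

lemma bounded_linear_scaleC_left: "bounded_linear (\<lambda>h. scaleC h (x :: 'b::cstar_algebra))"
  by (rule bounded_linear_intro[where K = "norm x"])
     (auto simp: scaleC_add_left norm_scaleC scaleR_conv_of_real scaleC_scaleC[symmetric] scaleC_of_real)

text \<open>Using the resolvent identity twice leaves the quadratic remainder
  \<open>(z - y)^2 R(y) R(z)^2\<close>, and \<open>R(y)\<close> stays bounded near
  \<open>z\<close>.\<close>

lemma has_cderiv_resolv:
  fixes Y :: "'b::cstar_algebra^'d::finite^'d"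
  assumes inv: "invertible (resolvent_arg Y z)"
  shows "has_cderiv (\<lambda>z. resolv Y z $ p $ q) (- (resolv Y z ** resolv Y z) $ p $ q) z"
  unfolding has_cderiv_def
proof (rule has_derivativeI_sandwich)
  \<comment> \<open>Within radius \<open>1 / (2 * S)\<close> the Neumann factor of
    \<open>resolv_perturb\<close> is at most 2, the 2 in \<open>B\<close>; adding 1 keeps
    \<open>S\<close> positive.\<close>
  define S where "S = entry_sum (resolv Y z) + 1"
  have S: "S > 0" using entry_sum_nonneg[of "resolv Y z"] by (simp add: S_def)
  define B where "B = (\<Sum>k\<in>UNIV. \<Sum>l\<in>UNIV. 2 * norm (resolv Y z $ l $ k))"
  define C where "C = (\<Sum>k\<in>UNIV. B * norm ((resolv Y z ** resolv Y z) $ k $ q))"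
  show "0 < 1 / (2 * S)" using S by simp
  show "bounded_linear (\<lambda>h. scaleC h (- (resolv Y z ** resolv Y z) $ p $ q))"
    by (rule bounded_linear_scaleC_left)
  show "((\<lambda>y. C * dist y z) \<longlongrightarrow> 0) (at z)"
    by (rule tendsto_eq_intros | simp)+
  fix y assume y: "y \<noteq> z" "dist y z < 1 / (2 * S)"
  have small: "cmod (y - z) * entry_sum (resolv Y z) \<le> 1 / 2"
  proof -
    have "cmod (y - z) * entry_sum (resolv Y z) \<le> 1 / (2 * S) * S"
      using y S by (intro mult_mono) (auto simp: dist_norm S_def entry_sum_nonneg)
    then show ?thesis using S by simp
  qed
  then have inv': "invertible (resolvent_arg Y y)" by (intro resolv_perturb(1)[OF inv]) linarith
  have nb: "norm (resolv Y y $ p $ k) \<le> B" for k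
  proof -
    have "norm (resolv Y y $ p $ k) \<le> (\<Sum>l\<in>UNIV. 1 / (1 - cmod (y - z) * entry_sum (resolv Y z)) * norm (resolv Y z $ l $ k))"
      using small by (intro resolv_perturb(2)[OF inv]) linarith
    also have "\<dots> \<le> (\<Sum>l\<in>UNIV. 2 * norm (resolv Y z $ l $ k))"
      using small by (intro sum_mono mult_right_mono) (auto simp: divide_simps)
    also have "\<dots> \<le> B" unfolding B_def by (rule member_le_sum) (auto intro: sum_nonneg)
    finally show ?thesis .
  qed
  let ?R = "resolv Y z" and ?Ry = "resolv Y y"
  have "?Ry - ?R + scale_mat (y - z) (?R ** ?R) = scale_mat (z - y) ((?Ry - ?R) ** ?R)"
    unfolding resolvent_identity[OF inv' inv]
    by (subst (2) resolvent_identity[OF inv' inv, symmetric]) (simp add: vec_eq_iff matrix_diff_rdistrib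
        scaleC_diff_right scaleC_diff_left)
  also have "\<dots> = scale_mat ((z - y) * (z - y)) (?Ry ** (?R ** ?R))"
    unfolding resolvent_identity[OF inv' inv] by (simp add: scale_mat_mult_left scale_mat_scale_mat matrix_mul_assoc)
  finally have eq: "?Ry - ?R + scale_mat (y - z) (?R ** ?R) = scale_mat ((z - y) * (z - y)) (?Ry ** (?R ** ?R))" .
  have "?Ry $ p $ q - ?R $ p $ q - scaleC (y - z) (- (?R ** ?R) $ p $ q) =
    scaleC ((z - y) * (z - y)) ((?Ry ** (?R ** ?R)) $ p $ q)"
    using arg_cong[OF eq, of "\<lambda>A. A $ p $ q"] by (simp add: scaleC_minus_right)
  then have "norm (?Ry $ p $ q - ?R $ p $ q - scaleC (y - z) (- (?R ** ?R) $ p $ q)) =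
    cmod (y - z) * cmod (y - z) * norm (\<Sum>k\<in>UNIV. ?Ry $ p $ k * (?R ** ?R) $ k $ q)"
    by (simp add: norm_scaleC norm_mult norm_minus_commute matrix_mult_nth[of ?Ry])
  also have "norm (\<Sum>k\<in>UNIV. ?Ry $ p $ k * (?R ** ?R) $ k $ q) \<le> C"
    unfolding C_def by (intro sum_norm_le order_trans[OF norm_mult_ineq] mult_right_mono nb norm_ge_zero)
  finally have "norm (?Ry $ p $ q - ?R $ p $ q - scaleC (y - z) (- (?R ** ?R) $ p $ q)) \<le>
    cmod (y - z) * cmod (y - z) * C" by (simp add: mult_left_mono)
  then show "norm (?Ry $ p $ q - ?R $ p $ q - scaleC (y - z) (- (?R ** ?R) $ p $ q)) / norm (y - z) \<le> C * dist y z"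
    using y(1) by (simp add: dist_norm divide_simps mult_ac)
qed

subsection \<open>The slit plane\<close>

lemma open_slit_plane: "open (slit_plane K)"
  unfolding slit_plane_def
  by (intro open_Compl compact_imp_closed compact_continuous_image continuous_intros) auto

lemma connected_slit_plane: "connected (slit_plane K)"
  unfolding slit_plane_def
proof (rule connected_complement_bounded_convex)
  show "bounded (complex_of_real ` {- K..K})"
    by (intro compact_imp_bounded compact_continuous_image continuous_intros) auto
  show "convex (complex_of_real ` {- K..K})"
    by (intro convex_linear_image bounded_linear.linear[OF bounded_linear_of_real]) auto
qed simp

lemma large_in_slit_plane: "K < cmod z \<Longrightarrow> z \<in> slit_plane K"
  by (auto simp: slit_plane_def)

lemma slit_plane_invertible:
  fixes Y :: "'b::cstar_algebra^'d::finite^'d"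
  assumes sa: "\<And>p q. star (Y $ p $ q) = Y $ q $ p" and K: "entry_sum Y \<le> K" and z: "z \<in> slit_plane K"
  shows "invertible (resolvent_arg Y z)"
proof (cases "Im z = 0")
  case True
  then have "z = complex_of_real (Re z)" by (simp add: complex_eq_iff)
  then have "Re z \<notin> {-K..K}" using z by (metis ComplD image_eqI slit_plane_def)
  then have "K < cmod z" using abs_Re_le_cmod[of z] by auto
  then show ?thesis using K by (intro resolv_large(1)) simp
qed (rule resolvent_arg_invertible_nonreal[OF sa])

lemma slit_plane_continuation:
  assumes "f holomorphic_on slit_plane K" "g holomorphic_on slit_plane K"
    and "\<And>z. L < cmod z \<Longrightarrow> K < cmod z \<Longrightarrow> f z = g z" "z \<in> slit_plane K"
  shows "f z = g z"
proof (rule analytic_continuation_open[of "- cball 0 (max K L)" "slit_plane K" f g])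
  have "complex_of_real (max K L + \<bar>K\<bar> + 1 + \<bar>L\<bar>) \<in> - cball 0 (max K L)" by (auto simp del: of_real_add)
  then show "- cball (0::complex) (max K L) \<noteq> {}" by blast
  show "- cball 0 (max K L) \<subseteq> slit_plane K" by (auto intro!: large_in_slit_plane)
qed (use assms open_slit_plane connected_slit_plane in auto)

subsection \<open>Schwinger--Dyson equations\<close>

text \<open>Singling out step \<open>j\<close> of a walk leaves two independent walks, one ending
  where the step begins and one beginning where it ends.\<close>

lemma sum_paths_split_sum:
  fixes \<Phi> :: "('d::finite \<times> 'd) list \<Rightarrow> 'd \<times> 'd \<Rightarrow> ('d \<times> 'd) list \<Rightarrow> complex"
  shows "(\<Sum>w\<in>paths m k q. split_sum \<Phi> w) =
    (\<Sum>j<m. \<Sum>r\<in>UNIV. \<Sum>t\<in>UNIV. \<Sum>a\<in>paths j k r. \<Sum>b\<in>paths (m - Suc j) t q. \<Phi> a (r, t) b)"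
proof (induction m arbitrary: k \<Phi>)
  case 0
  then show ?case by simp
next
  case (Suc m)
  have "(\<Sum>w\<in>paths (Suc m) k q. split_sum \<Phi> w) =
    (\<Sum>i\<in>UNIV. \<Sum>w\<in>paths m i q. \<Phi> [] (k, i) w) + (\<Sum>i\<in>UNIV. \<Sum>w\<in>paths m i q. split_sum (\<lambda>a. \<Phi> ((k, i) # a)) w)"
    by (simp add: sum.distrib)
  also have "(\<Sum>i\<in>UNIV. \<Sum>w\<in>paths m i q. split_sum (\<lambda>a. \<Phi> ((k, i) # a)) w) =
    (\<Sum>i\<in>UNIV. \<Sum>j<m. \<Sum>r\<in>UNIV. \<Sum>t\<in>UNIV. \<Sum>a\<in>paths j i r. \<Sum>b\<in>paths (m - Suc j) t q. \<Phi> ((k, i) # a) (r, t) b)"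
    by (simp only: Suc)
  also have "\<dots> = (\<Sum>j<m. \<Sum>r\<in>UNIV. \<Sum>t\<in>UNIV. \<Sum>i\<in>UNIV. \<Sum>a\<in>paths j i r. \<Sum>b\<in>paths (m - Suc j) t q. \<Phi> ((k, i) # a) (r, t) b)"
    by (subst sum.swap, rule sum.cong[OF refl], subst sum.swap, rule sum.cong[OF refl], rule sum.swap)
  also have "(\<Sum>i\<in>UNIV. \<Sum>w\<in>paths m i q. \<Phi> [] (k, i) w) =
    (\<Sum>r\<in>UNIV. \<Sum>t\<in>UNIV. \<Sum>a\<in>paths 0 k r. \<Sum>b\<in>paths m t q. \<Phi> a (r, t) b)"
  proof -
    have "(\<Sum>t\<in>UNIV. \<Sum>a\<in>paths 0 k r. \<Sum>b\<in>paths m t q. \<Phi> a (r, t) b) =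
      (if k = r then \<Sum>t\<in>UNIV. \<Sum>b\<in>paths m t q. \<Phi> [] (k, t) b else 0)" for r by simp
    then show ?thesis by simp
  qed
  finally show ?case by (simp add: sum.lessThan_Suc_shift del: sum.lessThan_Suc sum_paths_0)
qed

lemma matpow_paths:
  fixes Y :: "'r::semiring_1^'d::finite^'d"
  shows "matpow Y n $ k $ q = (\<Sum>w\<in>paths n k q. word_val Y w)"
  by (induction n arbitrary: k) (simp_all add: mat_nth matrix_mult_nth sum_distrib_left)

text \<open>Removing one letter from a word of length n leaves pieces of lengths \<open>j\<close>
  and \<open>n - Suc j\<close>. Their exponents \<open>Suc j\<close> and \<open>n - j\<close> add up
  to \<open>Suc n\<close>, so convolutions of this kind become plain products.\<close>

lemma shifted_Cauchy_product:
  fixes f g :: "nat \<Rightarrow> complex"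
  assumes f: "(\<lambda>n. f n * x ^ Suc n) sums F" "summable (\<lambda>n. norm (f n * x ^ Suc n))"
    and g: "(\<lambda>n. g n * x ^ Suc n) sums G" "summable (\<lambda>n. norm (g n * x ^ Suc n))"
  shows "(\<lambda>n. (\<Sum>j<n. f j * g (n - Suc j)) * x ^ Suc n) sums (F * G)"
proof -
  have "(\<lambda>n. \<Sum>i\<le>n. (f i * x ^ Suc i) * (g (n - i) * x ^ Suc (n - i))) sums (F * G)"
    using Cauchy_product_sums[OF f(2) g(2)] f(1) g(1) by (simp add: sums_iff)
  moreover have "(\<Sum>i\<le>n. (f i * x ^ Suc i) * (g (n - i) * x ^ Suc (n - i))) =
    (\<Sum>j<Suc n. f j * g (Suc n - Suc j)) * x ^ Suc (Suc n)" for n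
  proof -
    have "x ^ Suc i * x ^ Suc (n - i) = x ^ Suc (Suc n)" if "i \<le> n" for i
      using that by (simp add: power_add[symmetric] del: power_Suc)
    then have "(f i * x ^ Suc i) * (g (n - i) * x ^ Suc (n - i)) = f i * g (n - i) * x ^ Suc (Suc n)" if "i \<le> n" for i
      using that by (metis (no_types, lifting) mult.assoc mult.left_commute)
    then show ?thesis unfolding sum_distrib_right lessThan_Suc_atMost by (intro sum.cong) auto
  qed
  ultimately have "(\<lambda>n. (\<Sum>j<Suc n. f j * g (Suc n - Suc j)) * x ^ Suc (Suc n)) sums (F * G)" by (simp only:)
  \<comment> \<open>The index shift costs nothing, since the term for n = 0 is an empty sum.\<close>
  then show ?thesis
    by (subst (asm) sums_Suc_iff[of "\<lambda>n. (\<Sum>j<n. f j * g (n - Suc j)) * x ^ Suc n"]) simp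
qed

text \<open>Covers \<open>\<psi>\<close> together with its compositions with left and right
  multiplications, to which the resolvent series and the derivative are applied.\<close>

definition functional :: "('b::cstar_algebra \<Rightarrow> complex) \<Rightarrow> bool" where
  "functional L \<longleftrightarrow> bounded_linear L \<and> (\<forall>c x. L (scaleC c x) = c * L x)"

lemma functional_linear: "functional L \<Longrightarrow> bounded_linear L"
  and functional_scaleC: "functional L \<Longrightarrow> L (scaleC c x) = c * L x"
  by (auto simp: functional_def)

lemma functional_mult_left:
  assumes "functional L" shows "functional (\<lambda>x. L (a * x))"
  using bounded_linear_compose[OF functional_linear[OF assms] bounded_linear_mult_right[of a]] assms
  by (auto simp: functional_def scaleC_mult_right)

lemma functional_mult_right:
  assumes "functional L" shows "functional (\<lambda>x. L (x * a))"
  using bounded_linear_compose[OF functional_linear[OF assms] bounded_linear_mult_left[of a]] assms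
  by (auto simp: functional_def scaleC_mult_left)

lemma functional_has_field_derivative:
  assumes "functional L" "has_cderiv f D z"
  shows "((\<lambda>z. L (f z)) has_field_derivative L D) (at z)"
proof -
  have "((\<lambda>z. L (f z)) has_derivative (\<lambda>h. L (scaleC h D))) (at z)"
    using bounded_linear.has_derivative[OF functional_linear[OF assms(1)] assms(2)[unfolded has_cderiv_def]] .
  moreover have "(\<lambda>h. L (scaleC h D)) = (*) (L D)"
    by (rule ext) (simp add: functional_scaleC[OF assms(1)] mult.commute)
  ultimately show ?thesis by (simp only: has_field_derivative_def)
qed

lemma functional_resolv_series:
  fixes Y :: "'b::cstar_algebra^'d::finite^'d"
  assumes "functional L" "entry_sum Y < cmod z"
  shows "(\<lambda>n. L (matpow Y n $ p $ q) * (1 / z) ^ Suc n) sums (L (resolv Y z $ p $ q))"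
    and "summable (\<lambda>n. norm (L (matpow Y n $ p $ q) * (1 / z) ^ Suc n))"
proof -
  have "(\<lambda>n. L (scaleC (1 / z ^ Suc n) (matpow Y n $ p $ q))) sums (L (resolv Y z $ p $ q))"
    by (rule bounded_linear.sums[OF functional_linear[OF assms(1)] resolv_large(2)[OF assms(2)]])
  then show "(\<lambda>n. L (matpow Y n $ p $ q) * (1 / z) ^ Suc n) sums (L (resolv Y z $ p $ q))"
    by (simp add: functional_scaleC[OF assms(1)] power_one_over mult.commute)
  obtain C where C: "C > 0" "\<And>x. norm (L x) \<le> norm x * C"
    using bounded_linear.pos_bounded[OF functional_linear[OF assms(1)]] by blast
  have z: "cmod z > 0" using assms(2) entry_sum_nonneg[of Y] by linarith
  define \<rho> where "\<rho> = entry_sum Y / cmod z"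
  have \<rho>: "0 \<le> \<rho>" "\<rho> < 1" using assms(2) z entry_sum_nonneg[of Y] by (auto simp: \<rho>_def)
  show "summable (\<lambda>n. norm (L (matpow Y n $ p $ q) * (1 / z) ^ Suc n))"
  proof (rule summable_comparison_test)
    show "summable (\<lambda>n. C / cmod z * \<rho> ^ n)" using \<rho> by (intro summable_mult summable_geometric) auto
    have "norm (L (matpow Y n $ p $ q) * (1 / z) ^ Suc n) \<le> C / cmod z * \<rho> ^ n" for n
    proof -
      have "norm (L (matpow Y n $ p $ q)) \<le> entry_sum Y ^ n * C"
        using C(2)[of "matpow Y n $ p $ q"] norm_matpow_le[of Y n p q] C(1)
        by (meson less_imp_le mult_right_mono order_trans)
      then have "norm (L (matpow Y n $ p $ q)) * (1 / cmod z) ^ Suc n \<le> entry_sum Y ^ n * C * (1 / cmod z) ^ Suc n"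
        by (rule mult_right_mono) simp
      then show ?thesis by (simp add: norm_mult norm_power norm_divide \<rho>_def power_divide field_simps)
    qed
    then show "\<exists>N. \<forall>n\<ge>N. norm (norm (L (matpow Y n $ p $ q) * (1 / z) ^ Suc n)) \<le> C / cmod z * \<rho> ^ n" by simp
  qed
qed

locale semicircular_matrix =
  fixes \<sigma> :: "'d::finite covariance" and \<psi> :: "'b::cstar_algebra \<Rightarrow> complex" and Y :: "'b^'d^'d"
  assumes state: "tracial_state \<psi>" and semicircular: "semicircular_family \<sigma> \<psi> Y"
begin

lemma fun_psi: "functional \<psi>"
  using state by (auto simp: functional_def bounded_linear_tracial_state tracial_state_scaleC)

lemma psi_sum: "\<psi> (sum f A) = (\<Sum>i\<in>A. \<psi> (f i))"
  using linear_sum[OF bounded_linear.linear[OF functional_linear[OF fun_psi]]] .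

lemmas psi_add = tracial_state_add[OF state] and psi_diff = tracial_state_diff[OF state]
  and psi_commute = tracial_state_commute[OF state] and psi_one = tracial_state_one[OF state]
  and psi_scaleC = tracial_state_scaleC[OF state]

lemma star_entry: "star (Y $ p $ q) = Y $ q $ p" and entry_sym: "Y $ p $ q = Y $ q $ p"
  using semicircular unfolding semicircular_family_def by metis+

abbreviation cv :: "'d \<times> 'd \<Rightarrow> 'd \<times> 'd \<Rightarrow> complex" where "cv \<equiv> cov_letters \<sigma>"

lemma psi_word: "\<psi> (word_val Y w) = tau cv w"
  by (rule semicircular_word[OF semicircular])

lemma cv_psi: "cv e f = \<psi> (Y $ fst e $ snd e * Y $ fst f $ snd f)"
  using psi_word[of "[e, f]"] by (simp add: tau_Cons)

text \<open>The symmetry of the family \<open>Y\<close> passes to \<open>\<sigma>\<close> through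
  its second moments. It reconciles the index order of the covariance with that of the matrix
  \<open>\<Sigma>\<close>.\<close>

lemma cov_sym: "\<sigma> p k r t = \<sigma> p k t r"
proof -
  have "complex_of_real (\<sigma> p k r t) = complex_of_real (\<sigma> p k t r)"
    using cv_psi[of "(p, k)" "(r, t)"] cv_psi[of "(p, k)" "(t, r)"] entry_sym[of r t]
    by (simp add: cov_letters_def)
  then show ?thesis by (simp only: of_real_eq_iff)
qed

text \<open>The recursion of \<open>tau\<close> for the first letter \<open>(p, k)\<close>: its
  partner lies either in the first or in the second power, which gives the two convolutions.\<close>

lemma schwinger_dyson_matpow:
  "\<psi> (Y $ p $ k * (matpow Y m $ k $ q * matpow Y n $ s $ u)) = (\<Sum>r\<in>UNIV. \<Sum>t\<in>UNIV. cv (p, k) (r, t) *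
    ((\<Sum>j<m. \<psi> (matpow Y j $ k $ r) * \<psi> (matpow Y (m - Suc j) $ t $ q * matpow Y n $ s $ u)) +
     (\<Sum>j<n. \<psi> (matpow Y m $ k $ q * matpow Y j $ s $ r) * \<psi> (matpow Y (n - Suc j) $ t $ u))))"
proof -
  have one: "\<psi> (matpow Y j $ k $ r) = (\<Sum>a\<in>paths j k r. tau cv a)" for j k r
    by (simp add: matpow_paths psi_sum psi_word)
  have prod: "matpow Y j $ k $ r * matpow Y n $ s $ u = (\<Sum>a\<in>paths j k r. \<Sum>b\<in>paths n s u. word_val Y (a @ b))"
    for j k r n s u
    by (simp add: matpow_paths sum_product word_val_append)
  have two: "\<psi> (matpow Y j $ k $ r * matpow Y n $ s $ u) = (\<Sum>a\<in>paths j k r. \<Sum>b\<in>paths n s u. tau cv (a @ b))"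
    for j k r n s u
    by (simp add: prod psi_sum psi_word)
  have "\<psi> (Y $ p $ k * (matpow Y m $ k $ q * matpow Y n $ s $ u)) =
    (\<Sum>w\<in>paths m k q. \<Sum>v\<in>paths n s u. tau cv ((p, k) # w @ v))"
    by (simp only: prod sum_distrib_left psi_sum psi_word[symmetric]) simp
  also have "\<dots> = (\<Sum>w\<in>paths m k q. \<Sum>v\<in>paths n s u. split_sum (\<lambda>a f b. cv (p, k) f * tau cv a * tau cv (b @ v)) w) +
     (\<Sum>w\<in>paths m k q. \<Sum>v\<in>paths n s u. split_sum (\<lambda>a f b. cv (p, k) f * tau cv (w @ a) * tau cv b) v)"
    by (simp add: tau_Cons split_sum_append sum.distrib)
  also have "(\<Sum>w\<in>paths m k q. \<Sum>v\<in>paths n s u. split_sum (\<lambda>a f b. cv (p, k) f * tau cv a * tau cv (b @ v)) w) =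
    (\<Sum>w\<in>paths m k q. split_sum (\<lambda>a f b. \<Sum>v\<in>paths n s u. cv (p, k) f * tau cv a * tau cv (b @ v)) w)"
    by (simp add: split_sum_sum)
  also have "\<dots> = (\<Sum>j<m. \<Sum>r\<in>UNIV. \<Sum>t\<in>UNIV. cv (p, k) (r, t) * (\<psi> (matpow Y j $ k $ r) * \<psi> (matpow Y (m - Suc j) $ t $ q * matpow Y n $ s $ u)))"
    unfolding sum_paths_split_sum one two sum_product
    by (simp add: sum_distrib_left sum_distrib_right mult.assoc)
  also have "\<dots> = (\<Sum>r\<in>UNIV. \<Sum>t\<in>UNIV. \<Sum>j<m. cv (p, k) (r, t) * (\<psi> (matpow Y j $ k $ r) * \<psi> (matpow Y (m - Suc j) $ t $ q * matpow Y n $ s $ u)))"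
    by (subst sum.swap, rule sum.cong[OF refl], rule sum.swap)
  also have "(\<Sum>w\<in>paths m k q. \<Sum>v\<in>paths n s u. split_sum (\<lambda>a f b. cv (p, k) f * tau cv (w @ a) * tau cv b) v) =
    (\<Sum>v\<in>paths n s u. split_sum (\<lambda>a f b. \<Sum>w\<in>paths m k q. cv (p, k) f * tau cv (w @ a) * tau cv b) v)"
    by (subst sum.swap) (simp add: split_sum_sum)
  also have "\<dots> = (\<Sum>j<n. \<Sum>r\<in>UNIV. \<Sum>t\<in>UNIV. \<Sum>a\<in>paths j s r. \<Sum>b\<in>paths (n - Suc j) t u. \<Sum>w\<in>paths m k q. cv (p, k) (r, t) * tau cv (w @ a) * tau cv b)"
    by (rule sum_paths_split_sum)
  also have "\<dots> = (\<Sum>j<n. \<Sum>r\<in>UNIV. \<Sum>t\<in>UNIV. cv (p, k) (r, t) * (\<psi> (matpow Y m $ k $ q * matpow Y j $ s $ r) * \<psi> (matpow Y (n - Suc j) $ t $ u)))"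
  proof (intro sum.cong refl)
    fix j r t
    have "(\<Sum>a\<in>paths j s r. \<Sum>b\<in>paths (n - Suc j) t u. \<Sum>w\<in>paths m k q. cv (p, k) (r, t) * tau cv (w @ a) * tau cv b) =
      (\<Sum>a\<in>paths j s r. \<Sum>w\<in>paths m k q. \<Sum>b\<in>paths (n - Suc j) t u. cv (p, k) (r, t) * tau cv (w @ a) * tau cv b)"
      by (rule sum.cong[OF refl], rule sum.swap)
    also have "\<dots> = (\<Sum>w\<in>paths m k q. \<Sum>a\<in>paths j s r. \<Sum>b\<in>paths (n - Suc j) t u. cv (p, k) (r, t) * tau cv (w @ a) * tau cv b)"
      by (rule sum.swap)
    also have "\<dots> = cv (p, k) (r, t) * (\<psi> (matpow Y m $ k $ q * matpow Y j $ s $ r) * \<psi> (matpow Y (n - Suc j) $ t $ u))"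
      unfolding one two by (simp only: sum_distrib_left[symmetric] sum_distrib_right[symmetric] mult.assoc)
    finally show "(\<Sum>a\<in>paths j s r. \<Sum>b\<in>paths (n - Suc j) t u. \<Sum>w\<in>paths m k q. cv (p, k) (r, t) * tau cv (w @ a) * tau cv b) =
      cv (p, k) (r, t) * (\<psi> (matpow Y m $ k $ q * matpow Y j $ s $ r) * \<psi> (matpow Y (n - Suc j) $ t $ u))" .
  qed
  also have "\<dots> = (\<Sum>r\<in>UNIV. \<Sum>t\<in>UNIV. \<Sum>j<n. cv (p, k) (r, t) * (\<psi> (matpow Y m $ k $ q * matpow Y j $ s $ r) * \<psi> (matpow Y (n - Suc j) $ t $ u)))"
    by (subst sum.swap, rule sum.cong[OF refl], rule sum.swap)
  finally show ?thesis by (simp add: sum.distrib distrib_left sum_distrib_left)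
qed

abbreviation R :: "complex \<Rightarrow> 'b^'d^'d" where "R \<equiv> resolv Y"

abbreviation G :: "complex \<Rightarrow> 'd matrix1" where "G \<equiv> cauchy_transform \<psi> Y"

lemma G_nth: "G z $ p $ q = \<psi> (R z $ p $ q)"
  by (simp add: cauchy_transform_def resolv_def)

definition K\<^sub>0 :: real where "K\<^sub>0 = entry_sum Y"

lemma K0_nonneg: "0 \<le> K\<^sub>0" by (simp add: K\<^sub>0_def entry_sum_nonneg)

lemmas series = functional_resolv_series(1)[where Y = Y, folded K\<^sub>0_def]
  and series_abs = functional_resolv_series(2)[where Y = Y, folded K\<^sub>0_def]

lemma schwinger_dyson_one_large:
  assumes "K\<^sub>0 < cmod z"
  shows "\<psi> (Y $ p $ k * R z $ k $ q) = (\<Sum>r\<in>UNIV. \<Sum>t\<in>UNIV. cv (p, k) (r, t) * (G z $ k $ r * G z $ t $ q))"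
proof -
  note ser = series[OF fun_psi assms] series_abs[OF fun_psi assms]
  have trm: "\<psi> (Y $ p $ k * matpow Y m $ k $ q) = (\<Sum>r\<in>UNIV. \<Sum>t\<in>UNIV. cv (p, k) (r, t) *
    (\<Sum>j<m. \<psi> (matpow Y j $ k $ r) * \<psi> (matpow Y (m - Suc j) $ t $ q)))" for m
    using schwinger_dyson_matpow[of p k m q 0 q q] by (simp add: mat_nth)
  have "(\<lambda>m. \<psi> (Y $ p $ k * matpow Y m $ k $ q) * (1 / z) ^ Suc m) sums \<psi> (Y $ p $ k * R z $ k $ q)"
    by (rule series[OF functional_mult_left[OF fun_psi] assms])
  moreover have "(\<lambda>m. \<Sum>r\<in>UNIV. \<Sum>t\<in>UNIV. cv (p, k) (r, t) *
      ((\<Sum>j<m. \<psi> (matpow Y j $ k $ r) * \<psi> (matpow Y (m - Suc j) $ t $ q)) * (1 / z) ^ Suc m)) sums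
      (\<Sum>r\<in>UNIV. \<Sum>t\<in>UNIV. cv (p, k) (r, t) * (G z $ k $ r * G z $ t $ q))"
    unfolding G_nth by (intro sums_sum sums_mult shifted_Cauchy_product ser)
  ultimately show ?thesis
    unfolding trm sum_distrib_right mult.assoc by (rule sums_unique2)
qed

text \<open>The series in \<open>1 / w\<close> is summed first with \<open>m\<close> fixed, then the
  series in \<open>1 / z\<close>; no double series occurs.\<close>

lemma schwinger_dyson_two_large:
  assumes z: "K\<^sub>0 < cmod z" and w: "K\<^sub>0 < cmod w"
  shows "\<psi> (Y $ p $ k * (R z $ k $ q * R w $ s $ u)) = (\<Sum>r\<in>UNIV. \<Sum>t\<in>UNIV. cv (p, k) (r, t) *
    (G z $ k $ r * \<psi> (R z $ t $ q * R w $ s $ u) + \<psi> (R z $ k $ q * R w $ s $ r) * G w $ t $ u))"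
proof -
  note fl = functional_mult_left functional_mult_right fun_psi
  have step: "\<psi> (Y $ p $ k * (matpow Y m $ k $ q * R w $ s $ u)) = (\<Sum>r\<in>UNIV. \<Sum>t\<in>UNIV. cv (p, k) (r, t) *
    ((\<Sum>j<m. \<psi> (matpow Y j $ k $ r) * \<psi> (matpow Y (m - Suc j) $ t $ q * R w $ s $ u)) +
     \<psi> (matpow Y m $ k $ q * R w $ s $ r) * G w $ t $ u))" for m
  proof -
    have "(\<lambda>n. \<psi> (Y $ p $ k * (matpow Y m $ k $ q * matpow Y n $ s $ u)) * (1 / w) ^ Suc n) sums
        \<psi> (Y $ p $ k * (matpow Y m $ k $ q * R w $ s $ u))"
      by (rule series[where L = "\<lambda>x. \<psi> (Y $ p $ k * (matpow Y m $ k $ q * x))", OF _ w])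
         (intro functional_mult_left[where L = "\<lambda>x. \<psi> (Y $ p $ k * x)"] fl)
    moreover have "(\<lambda>n. \<Sum>r\<in>UNIV. \<Sum>t\<in>UNIV. cv (p, k) (r, t) *
      ((\<Sum>j<m. \<psi> (matpow Y j $ k $ r) * (\<psi> (matpow Y (m - Suc j) $ t $ q * matpow Y n $ s $ u) * (1 / w) ^ Suc n)) +
       (\<Sum>j<n. \<psi> (matpow Y m $ k $ q * matpow Y j $ s $ r) * \<psi> (matpow Y (n - Suc j) $ t $ u)) * (1 / w) ^ Suc n)) sums
      (\<Sum>r\<in>UNIV. \<Sum>t\<in>UNIV. cv (p, k) (r, t) *
    ((\<Sum>j<m. \<psi> (matpow Y j $ k $ r) * \<psi> (matpow Y (m - Suc j) $ t $ q * R w $ s $ u)) +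
     \<psi> (matpow Y m $ k $ q * R w $ s $ r) * G w $ t $ u))"
      unfolding G_nth by (intro sums_sum sums_mult sums_add shifted_Cauchy_product series series_abs w fl)
    ultimately show ?thesis
      unfolding schwinger_dyson_matpow sum_distrib_right mult.assoc distrib_right by (rule sums_unique2)
  qed
  have "(\<lambda>m. \<psi> (Y $ p $ k * (matpow Y m $ k $ q * R w $ s $ u)) * (1 / z) ^ Suc m) sums
      \<psi> (Y $ p $ k * (R z $ k $ q * R w $ s $ u))"
    by (rule series[where L = "\<lambda>x. \<psi> (Y $ p $ k * (x * R w $ s $ u))", OF _ z])
       (intro functional_mult_right[where L = "\<lambda>x. \<psi> (Y $ p $ k * x)"] fl)
  moreover have "(\<lambda>m. \<Sum>r\<in>UNIV. \<Sum>t\<in>UNIV. cv (p, k) (r, t) *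
    ((\<Sum>j<m. \<psi> (matpow Y j $ k $ r) * \<psi> (matpow Y (m - Suc j) $ t $ q * R w $ s $ u)) * (1 / z) ^ Suc m +
     (\<psi> (matpow Y m $ k $ q * R w $ s $ r) * (1 / z) ^ Suc m) * G w $ t $ u)) sums
    (\<Sum>r\<in>UNIV. \<Sum>t\<in>UNIV. cv (p, k) (r, t) *
    (G z $ k $ r * \<psi> (R z $ t $ q * R w $ s $ u) + \<psi> (R z $ k $ q * R w $ s $ r) * G w $ t $ u))"
    unfolding G_nth
    by (intro sums_sum sums_mult sums_mult2 sums_add shifted_Cauchy_product series series_abs z fl
        series[where L = "\<lambda>x. \<psi> (x * R w $ s $ _)"] series_abs[where L = "\<lambda>x. \<psi> (x * R w $ s $ _)"])
  moreover have "\<psi> (Y $ p $ k * (matpow Y m $ k $ q * R w $ s $ u)) * (1 / z) ^ Suc m =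
    (\<Sum>r\<in>UNIV. \<Sum>t\<in>UNIV. cv (p, k) (r, t) *
    ((\<Sum>j<m. \<psi> (matpow Y j $ k $ r) * \<psi> (matpow Y (m - Suc j) $ t $ q * R w $ s $ u)) * (1 / z) ^ Suc m +
     (\<psi> (matpow Y m $ k $ q * R w $ s $ r) * (1 / z) ^ Suc m) * G w $ t $ u))" for m
    unfolding step by (simp only: sum_distrib_right sum_distrib_left distrib_right distrib_left mult_ac)
  ultimately show ?thesis by (simp only: sums_unique2)
qed

end

subsection \<open>Continuation to the slit plane\<close>

context semicircular_matrix begin

abbreviation slit :: "complex set" where "slit \<equiv> slit_plane K\<^sub>0"

lemma inv_slit: "z \<in> slit \<Longrightarrow> invertible (resolvent_arg Y z)"
  by (rule slit_plane_invertible[OF star_entry, where K = K\<^sub>0]) (auto simp: K\<^sub>0_def)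

lemma functional_R_derivative:
  assumes "functional L" "z \<in> slit"
  shows "((\<lambda>z. L (R z $ p $ q)) has_field_derivative - L ((R z ** R z) $ p $ q)) (at z)"
proof -
  have "L (- (R z ** R z) $ p $ q) = - L ((R z ** R z) $ p $ q)"
    using linear_neg[OF bounded_linear.linear[OF functional_linear[OF assms(1)]]] by simp
  then show ?thesis
    using functional_has_field_derivative[OF assms(1) has_cderiv_resolv[OF inv_slit[OF assms(2)], of p q]] by simp
qed

lemma functional_R_holomorphic:
  assumes "functional L"
  shows "(\<lambda>z. L (R z $ p $ q)) holomorphic_on slit"
  unfolding holomorphic_on_def field_differentiable_def
  using functional_R_derivative[OF assms] has_field_derivative_at_within by blast

lemma G_holomorphic: "(\<lambda>z. G z $ p $ q) holomorphic_on slit"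
  unfolding G_nth by (rule functional_R_holomorphic[OF fun_psi])

lemma schwinger_dyson_one:
  assumes "z \<in> slit"
  shows "\<psi> (Y $ p $ k * R z $ k $ q) = (\<Sum>r\<in>UNIV. \<Sum>t\<in>UNIV. cv (p, k) (r, t) * (G z $ k $ r * G z $ t $ q))"
proof (rule slit_plane_continuation[OF _ _ _ assms, where L = K\<^sub>0])
  show "(\<lambda>z. \<psi> (Y $ p $ k * R z $ k $ q)) holomorphic_on slit"
    by (rule functional_R_holomorphic[OF functional_mult_left[OF fun_psi]])
qed (intro holomorphic_intros G_holomorphic schwinger_dyson_one_large; simp)+

text \<open>Continuation one variable at a time: in \<open>z\<close> for fixed large
  \<open>w\<close>, then in \<open>w\<close> for fixed \<open>z\<close> anywhere in the slit
  plane.\<close>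

lemma schwinger_dyson_two:
  assumes "z \<in> slit" "w \<in> slit"
  shows "\<psi> (Y $ p $ k * (R z $ k $ q * R w $ s $ u)) = (\<Sum>r\<in>UNIV. \<Sum>t\<in>UNIV. cv (p, k) (r, t) *
    (G z $ k $ r * \<psi> (R z $ t $ q * R w $ s $ u) + \<psi> (R z $ k $ q * R w $ s $ r) * G w $ t $ u))"
proof -
  note fl = functional_mult_left[OF fun_psi] functional_mult_right[OF fun_psi]
  have large: "\<psi> (Y $ p $ k * (R z $ k $ q * R w $ s $ u)) = (\<Sum>r\<in>UNIV. \<Sum>t\<in>UNIV. cv (p, k) (r, t) *
    (G z $ k $ r * \<psi> (R z $ t $ q * R w $ s $ u) + \<psi> (R z $ k $ q * R w $ s $ r) * G w $ t $ u))"
    if w: "K\<^sub>0 < cmod w" for w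
  proof (rule slit_plane_continuation[OF _ _ _ assms(1), where L = K\<^sub>0])
    show "(\<lambda>z. \<psi> (Y $ p $ k * (R z $ k $ q * R w $ s $ u))) holomorphic_on slit"
      by (rule functional_R_holomorphic[OF functional_mult_right[OF fl(1)]])
  qed (intro holomorphic_intros G_holomorphic functional_R_holomorphic fl schwinger_dyson_two_large w; simp)+
  show ?thesis
  proof (rule slit_plane_continuation[OF _ _ large assms(2), where L = K\<^sub>0])
    show "(\<lambda>w. \<psi> (Y $ p $ k * (R z $ k $ q * R w $ s $ u))) holomorphic_on slit"
      by (rule functional_R_holomorphic[OF functional_mult_left[OF fl(1)]])
  qed (intro holomorphic_intros G_holomorphic functional_R_holomorphic fl; simp)+
qed

section \<open>Symmetry of the Cauchy transform and of its derivative\<close>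

lemma matpow_star: "star (matpow Y n $ p $ q) = matpow Y n $ q $ p"
proof (induction n arbitrary: p q)
  case 0
  then show ?case by (simp add: mat_nth)
next
  case (Suc n)
  have "star (matpow Y (Suc n) $ p $ q) = (\<Sum>k\<in>UNIV. matpow Y n $ q $ k * Y $ k $ p)"
    by (simp add: matrix_mult_nth star_sum star_mult Suc star_entry)
  then show ?case by (simp only: matpow_Suc_right matrix_mult_nth)
qed

lemma tau_real: "tau cv w \<in> \<real>"
proof (induction "length w" arbitrary: w rule: less_induct)
  case less
  show ?case
  proof (cases w)
    case (Cons e v)
    show ?thesis unfolding Cons tau.simps
      by (intro sum_in_Reals Reals_mult less) (auto simp: Cons cov_letters_def)
  qed simp
qed

text \<open>Moments of entries of powers are real because \<open>tau\<close> is, and the involution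
  exchanges the two indices. Hence every coefficient of the expansion at infinity is symmetric, and
  continuation does the rest.\<close>

lemma G_sym: 
  assumes "z \<in> slit"
  shows "G z $ p $ q = G z $ q $ p"
proof (rule slit_plane_continuation[OF G_holomorphic G_holomorphic _ assms, where L = K\<^sub>0])
  fix z assume z: "K\<^sub>0 < cmod z"
  have "\<psi> (matpow Y n $ p $ q) = \<psi> (matpow Y n $ q $ p)" for n
  proof -
    have "\<psi> (matpow Y n $ p $ q) \<in> \<real>"
      by (simp add: matpow_paths psi_sum psi_word) (intro sum_in_Reals tau_real)
    then have "cnj (\<psi> (matpow Y n $ p $ q)) = \<psi> (matpow Y n $ p $ q)" by (simp add: Reals_cnj_iff)
    then show ?thesis using tracial_state_star[OF state, of "matpow Y n $ p $ q"] by (simp add: matpow_star)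
  qed
  then show "G z $ p $ q = G z $ q $ p"
    unfolding G_nth using series[OF fun_psi z, of p q] series[OF fun_psi z, of q p] by (simp add: sums_iff)
qed

text \<open>This is minus the derivative of \<open>G\<close>.\<close>

definition P :: "complex \<Rightarrow> 'd matrix1" where "P z = (\<chi> p q. \<psi> ((R z ** R z) $ p $ q))"

lemma P_nth: "P z $ p $ q = \<psi> ((R z ** R z) $ p $ q)"
  by (simp add: P_def)

lemma G_derivative: "z \<in> slit \<Longrightarrow> ((\<lambda>z. G z $ p $ q) has_field_derivative - (P z $ p $ q)) (at z)"
  unfolding G_nth P_nth by (rule functional_R_derivative[OF fun_psi])

lemma P_sym: 
  assumes "z \<in> slit"
  shows "P z $ p $ q = P z $ q $ p"
proof -
  have "((\<lambda>z. G z $ p $ q) has_field_derivative - (P z $ q $ p)) (at z)"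
    by (rule has_field_derivative_transform_within_open[OF G_derivative[OF assms] open_slit_plane assms])
       (rule G_sym)
  from DERIV_unique[OF this G_derivative[OF assms]] show ?thesis by simp
qed

subsection \<open>The linear system for the two-resolvent function\<close>

text \<open>This is \<open>z - \<eta> (G z)\<close> for the covariance map \<open>\<eta>\<close>.
  That it inverts \<open>G z\<close> is the fixed point equation \<open>G = T\<^sub>z(G)\<close>,
  here a consequence of the one-resolvent equation.\<close>

definition Linv :: "complex \<Rightarrow> 'd matrix1" where
  "Linv z = mat z - (\<chi> p t. \<Sum>k\<in>UNIV. \<Sum>r\<in>UNIV. cv (p, k) (r, t) * G z $ k $ r)"

lemma Linv_row:
  "(\<Sum>t\<in>UNIV. Linv z $ p $ t * F t) =
    z * F p - (\<Sum>k\<in>UNIV. \<Sum>r\<in>UNIV. \<Sum>t\<in>UNIV. cv (p, k) (r, t) * (G z $ k $ r * F t))"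
proof -
  have "(\<Sum>t\<in>UNIV. Linv z $ p $ t * F t) = (\<Sum>t\<in>UNIV. (if p = t then z * F p else 0) -
    (\<Sum>k\<in>UNIV. \<Sum>r\<in>UNIV. cv (p, k) (r, t) * (G z $ k $ r * F t)))"
    by (intro sum.cong refl) (simp add: Linv_def mat_nth left_diff_distrib sum_distrib_right mult.assoc)
  also have "\<dots> = z * F p - (\<Sum>t\<in>UNIV. \<Sum>k\<in>UNIV. \<Sum>r\<in>UNIV. cv (p, k) (r, t) * (G z $ k $ r * F t))"
    by (simp add: sum_subtractf)
  also have "(\<Sum>t\<in>UNIV. \<Sum>k\<in>UNIV. \<Sum>r\<in>UNIV. cv (p, k) (r, t) * (G z $ k $ r * F t)) =
    (\<Sum>k\<in>UNIV. \<Sum>r\<in>UNIV. \<Sum>t\<in>UNIV. cv (p, k) (r, t) * (G z $ k $ r * F t))"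
    by (subst sum.swap, rule sum.cong[OF refl], rule sum.swap)
  finally show ?thesis .
qed

lemma psi_resolv_equation:
  assumes "z \<in> slit"
  shows "(\<Sum>k\<in>UNIV. \<psi> (Y $ p $ k * (R z $ k $ q * x))) = z * \<psi> (R z $ p $ q * x) - (if p = q then \<psi> x else 0)"
proof -
  have "(\<Sum>k\<in>UNIV. \<psi> (Y $ p $ k * (R z $ k $ q * x))) = \<psi> ((\<Sum>k\<in>UNIV. Y $ p $ k * R z $ k $ q) * x)"
    by (simp add: psi_sum sum_distrib_right mult.assoc)
  then show ?thesis
    unfolding resolv_equation[OF inv_slit[OF assms]]
    by (cases "p = q") (simp_all add: mat_nth left_diff_distrib psi_diff psi_scaleC scaleC_mult_left)
qed

lemma Linv_G:
  assumes "z \<in> slit"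
  shows "Linv z ** G z = mat 1" "G z ** Linv z = mat 1"
proof -
  have "(Linv z ** G z) $ p $ q = mat 1 $ p $ q" for p q
  proof -
    have "(\<Sum>k\<in>UNIV. \<Sum>r\<in>UNIV. \<Sum>t\<in>UNIV. cv (p, k) (r, t) * (G z $ k $ r * G z $ t $ q)) =
      z * G z $ p $ q - mat 1 $ p $ q"
      using psi_resolv_equation[OF assms, of p q 1]
      by (simp add: schwinger_dyson_one[OF assms] mat_nth psi_one G_nth)
    then show ?thesis unfolding matrix_mult_nth Linv_row by (simp only:) simp
  qed
  then show "Linv z ** G z = mat 1" by (simp add: vec_eq_iff)
  then show "G z ** Linv z = mat 1" by (simp add: matrix_left_right_inverse)
qed

text \<open>The second resolvent enters with its indices exchanged. In this arrangement the
  contractions of the Schwinger--Dyson equation are ordinary products of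
  \<open>d\<^sup>2\<close>-dimensional matrices with \<open>\<Sigma>\<close> and the Kronecker
  product.\<close>

definition B :: "complex \<Rightarrow> complex \<Rightarrow> 'd matrix2" where
  "B z w = matrix4 (\<lambda>p q u s. \<psi> (R z $ p $ q * R w $ s $ u))"

lemma B_nth: "B z w $ (p, u) $ (q, s) = \<psi> (R z $ p $ q * R w $ s $ u)"
  by (simp add: B_def matrix4_def)

lemma kron_nth: "kron A C $ (p, u) $ (q, s) = A $ p $ q * C $ u $ s"
  by (simp add: kron_def matrix4_def)

lemma Sigma_nth: "Sigma_mat \<sigma> $ (p, t) $ (k, r) = cv (p, k) (r, t)"
  by (simp add: Sigma_mat_def matrix4_def cov_letters_def) (rule cov_sym)

lemma sum_UNIV_pair: "(\<Sum>a\<in>UNIV. F a) = (\<Sum>p\<in>UNIV. \<Sum>q\<in>UNIV. F (p, q))"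
  for F :: "'x::finite \<times> 'y::finite \<Rightarrow> complex"
  by (simp add: sum.cartesian_product UNIV_Times_UNIV[symmetric] del: UNIV_Times_UNIV)

lemma Linv_B:
  assumes "z \<in> slit" "w \<in> slit"
  shows "(\<Sum>t\<in>UNIV. Linv z $ p $ t * \<psi> (R z $ t $ q * R w $ s $ u)) = (if p = q then G w $ s $ u else 0) +
    (\<Sum>k\<in>UNIV. \<Sum>r\<in>UNIV. \<Sum>t\<in>UNIV. cv (p, k) (r, t) * (\<psi> (R z $ k $ q * R w $ s $ r) * G w $ t $ u))"
proof -
  have arith: "A + C = x - d \<Longrightarrow> x - A = d + C" for A C x d :: complex
    by (simp add: algebra_simps)
  have "(\<Sum>k\<in>UNIV. \<Sum>r\<in>UNIV. \<Sum>t\<in>UNIV. cv (p, k) (r, t) * (G z $ k $ r * \<psi> (R z $ t $ q * R w $ s $ u))) +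
    (\<Sum>k\<in>UNIV. \<Sum>r\<in>UNIV. \<Sum>t\<in>UNIV. cv (p, k) (r, t) * (\<psi> (R z $ k $ q * R w $ s $ r) * G w $ t $ u)) =
    z * \<psi> (R z $ p $ q * R w $ s $ u) - (if p = q then G w $ s $ u else 0)"
    using psi_resolv_equation[OF assms(1), of p q "R w $ s $ u"]
    unfolding schwinger_dyson_two[OF assms] distrib_left sum.distrib G_nth[symmetric] .
  then show ?thesis unfolding Linv_row by (rule arith)
qed

text \<open>Multiply the system of \<open>Linv_B\<close> by \<open>G z\<close> from the left; the
  symmetry of \<open>G w\<close> puts the remaining factor into the index order of the Kronecker
  product.\<close>

lemma B_equation:
  assumes "z \<in> slit" "w \<in> slit"
  shows "B z w = kron (G z) (G w) + kron (G z) (G w) ** (Sigma_mat \<sigma> ** B z w)"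
proof -
  have "B z w $ (p, u) $ (q, s) = (kron (G z) (G w) + kron (G z) (G w) ** (Sigma_mat \<sigma> ** B z w)) $ (p, u) $ (q, s)" for p u q s
  proof -
    have "B z w $ (p, u) $ (q, s) = (\<Sum>t\<in>UNIV. (G z ** Linv z) $ p $ t * \<psi> (R z $ t $ q * R w $ s $ u))"
    proof -
      have "(\<Sum>t\<in>UNIV. (G z ** Linv z) $ p $ t * \<psi> (R z $ t $ q * R w $ s $ u)) =
        (\<Sum>t\<in>UNIV. if p = t then \<psi> (R z $ p $ q * R w $ s $ u) else 0)"
        unfolding Linv_G[OF assms(1)] by (intro sum.cong refl) (simp add: mat_nth)
      then show ?thesis by (simp add: B_nth)
    qed
    also have "\<dots> = (\<Sum>l\<in>UNIV. G z $ p $ l * (\<Sum>t\<in>UNIV. Linv z $ l $ t * \<psi> (R z $ t $ q * R w $ s $ u)))"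
      unfolding matrix_mult_nth sum_distrib_left sum_distrib_right by (subst sum.swap) (simp add: mult.assoc)
    also have "\<dots> = (\<Sum>l\<in>UNIV. (if l = q then G z $ p $ l * G w $ s $ u else 0) +
      G z $ p $ l * (\<Sum>k\<in>UNIV. \<Sum>r\<in>UNIV. \<Sum>t\<in>UNIV. cv (l, k) (r, t) * (\<psi> (R z $ k $ q * R w $ s $ r) * G w $ t $ u)))"
      unfolding Linv_B[OF assms] by (intro sum.cong refl) (simp add: distrib_left)
    also have "\<dots> = G z $ p $ q * G w $ u $ s +
      (\<Sum>l\<in>UNIV. \<Sum>t\<in>UNIV. G z $ p $ l * G w $ u $ t * (\<Sum>k\<in>UNIV. \<Sum>r\<in>UNIV. cv (l, k) (r, t) * \<psi> (R z $ k $ q * R w $ s $ r)))"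
    proof -
      have "(\<Sum>k\<in>UNIV. \<Sum>r\<in>UNIV. \<Sum>t\<in>UNIV. cv (l, k) (r, t) * (\<psi> (R z $ k $ q * R w $ s $ r) * G w $ t $ u)) =
        (\<Sum>t\<in>UNIV. G w $ u $ t * (\<Sum>k\<in>UNIV. \<Sum>r\<in>UNIV. cv (l, k) (r, t) * \<psi> (R z $ k $ q * R w $ s $ r)))" for l
      proof -
        have "(\<Sum>k\<in>UNIV. \<Sum>r\<in>UNIV. \<Sum>t\<in>UNIV. cv (l, k) (r, t) * (\<psi> (R z $ k $ q * R w $ s $ r) * G w $ t $ u)) =
          (\<Sum>t\<in>UNIV. \<Sum>k\<in>UNIV. \<Sum>r\<in>UNIV. cv (l, k) (r, t) * (\<psi> (R z $ k $ q * R w $ s $ r) * G w $ t $ u))"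
          by (subst (2) sum.swap, rule sum.cong[OF refl], rule sum.swap)
        then show ?thesis
          by (simp add: sum_distrib_left G_sym[OF assms(2), of _ u] mult_ac)
      qed
      then show ?thesis by (simp add: sum.distrib G_sym[OF assms(2), of s u] sum_distrib_left mult.assoc)
    qed
    finally show ?thesis
      by (simp add: kron_nth matrix_mult_nth sum_UNIV_pair Sigma_nth B_nth)
  qed
  then show ?thesis by (simp add: vec_eq_iff split_paired_all)
qed

text \<open>Multiplying the equation of \<open>B\<close> by \<open>\<Sigma>\<close> gives
  \<open>(1 - \<Sigma> K) (1 + \<Sigma> B) = 1\<close>, and a one-sided inverse of a finite complex
  matrix is two-sided. No smallness enters, so this holds on the whole slit plane.\<close>

lemma H_arg_mult:
  assumes "z \<in> slit" "w \<in> slit"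
  shows "H_arg (Sigma_mat \<sigma>) G z w ** (mat 1 + Sigma_mat \<sigma> ** B z w) = mat 1"
    and "(mat 1 + Sigma_mat \<sigma> ** B z w) ** H_arg (Sigma_mat \<sigma>) G z w = mat 1"
proof -
  let ?S = "Sigma_mat \<sigma>" and ?K = "kron (G z) (G w)"
  have "?S ** B z w = ?S ** ?K + ?S ** (?K ** (?S ** B z w))"
    by (subst B_equation[OF assms]) (simp add: matrix_add_ldistrib')
  then have "?S ** B z w - ?S ** (?K ** (?S ** B z w)) = ?S ** ?K" by (simp only: diff_eq_eq)
  then show *: "H_arg (Sigma_mat \<sigma>) G z w ** (mat 1 + Sigma_mat \<sigma> ** B z w) = mat 1"
    by (simp add: H_arg_def matrix_diff_rdistrib matrix_add_ldistrib' matrix_mul_assoc[symmetric])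
  show "(mat 1 + Sigma_mat \<sigma> ** B z w) ** H_arg (Sigma_mat \<sigma>) G z w = mat 1"
    using * by (simp add: matrix_left_right_inverse)
qed

lemma H_arg_invertible: "z \<in> slit \<Longrightarrow> w \<in> slit \<Longrightarrow> invertible (H_arg (Sigma_mat \<sigma>) G z w)"
  unfolding invertible_def using H_arg_mult by blast

lemma matrix_inv_H_arg:
  "z \<in> slit \<Longrightarrow> w \<in> slit \<Longrightarrow> matrix_inv (H_arg (Sigma_mat \<sigma>) G z w) = mat 1 + Sigma_mat \<sigma> ** B z w"
  by (rule matrix_inv_eqI[OF H_arg_mult])

lemma calH_eq: "z \<in> slit \<Longrightarrow> w \<in> slit \<Longrightarrow>
    calH (Sigma_mat \<sigma>) G z w = (mat 1 + Sigma_mat \<sigma> ** B z w) ** Sigma_mat \<sigma>"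
  by (simp add: calH_def matrix_inv_H_arg)

lemma calGD_eq: "z \<in> slit \<Longrightarrow> w \<in> slit \<Longrightarrow> calGD (Sigma_mat \<sigma>) G z w = B z w"
  by (simp add: calGD_def matrix_inv_H_arg matrix_add_ldistrib' B_equation[symmetric])

text \<open>The same system with the factors in the other order, obtained through the inverse; it is
  the form used to eliminate \<open>K\<close> on the right of \<open>B\<close>.\<close>

lemma B_equation':
  assumes "z \<in> slit" "w \<in> slit"
  shows "B z w = kron (G z) (G w) + B z w ** (Sigma_mat \<sigma> ** kron (G z) (G w))"
proof -
  let ?S = "Sigma_mat \<sigma>" and ?K = "kron (G z) (G w)"
  have "?K ** ((mat 1 + ?S ** B z w) ** H_arg ?S G z w) = ?K" by (simp add: H_arg_mult[OF assms])
  then have "B z w ** H_arg ?S G z w = ?K"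
    using B_equation[OF assms] by (simp add: matrix_mul_assoc matrix_add_ldistrib')
  then show ?thesis by (simp add: H_arg_def matrix_diff_ldistrib algebra_simps)
qed

subsection \<open>Analyticity of the second-order Cauchy transform\<close>

definition bderiv2 :: "(complex \<times> complex \<Rightarrow> 'b) \<Rightarrow> complex \<times> complex \<Rightarrow> bool" where
  "bderiv2 f x \<longleftrightarrow> (\<exists>a b. (f has_derivative (\<lambda>h. scaleC (fst h) a + scaleC (snd h) b)) (at x))"

definition cderiv2 :: "(complex \<times> complex \<Rightarrow> complex) \<Rightarrow> complex \<times> complex \<Rightarrow> bool" where
  "cderiv2 f x \<longleftrightarrow> (\<exists>u v. (f has_derivative (\<lambda>h. u * fst h + v * snd h)) (at x))"

lemma bderiv2_R_fst: "fst x \<in> slit \<Longrightarrow> bderiv2 (\<lambda>y. R (fst y) $ p $ q) x"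
proof -
  assume "fst x \<in> slit"
  from has_cderiv_resolv[OF inv_slit[OF this], of p q]
  have "((\<lambda>z. R z $ p $ q) has_derivative (\<lambda>h. scaleC h (- (R (fst x) ** R (fst x)) $ p $ q))) (at (fst x))"
    by (simp add: has_cderiv_def)
  from has_derivative_compose[OF has_derivative_fst[OF has_derivative_ident] this] show ?thesis
    unfolding bderiv2_def by (intro exI[of _ "- (R (fst x) ** R (fst x)) $ p $ q"] exI[of _ 0]) simp
qed

lemma bderiv2_R_snd: "snd x \<in> slit \<Longrightarrow> bderiv2 (\<lambda>y. R (snd y) $ p $ q) x"
proof -
  assume "snd x \<in> slit"
  from has_cderiv_resolv[OF inv_slit[OF this], of p q]
  have "((\<lambda>z. R z $ p $ q) has_derivative (\<lambda>h. scaleC h (- (R (snd x) ** R (snd x)) $ p $ q))) (at (snd x))"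
    by (simp add: has_cderiv_def)
  from has_derivative_compose[OF has_derivative_snd[OF has_derivative_ident] this] show ?thesis
    unfolding bderiv2_def by (intro exI[of _ 0] exI[of _ "- (R (snd x) ** R (snd x)) $ p $ q"]) simp
qed

lemma bderiv2_mult:
  assumes "bderiv2 f x" "bderiv2 g x"
  shows "bderiv2 (\<lambda>y. f y * g y) x"
proof -
  obtain a b c d where "(f has_derivative (\<lambda>h. scaleC (fst h) a + scaleC (snd h) b)) (at x)"
    "(g has_derivative (\<lambda>h. scaleC (fst h) c + scaleC (snd h) d)) (at x)"
    using assms by (auto simp: bderiv2_def)
  from has_derivative_mult[OF this]
  have "((\<lambda>y. f y * g y) has_derivative (\<lambda>h. scaleC (fst h) (f x * c + a * g x) + scaleC (snd h) (f x * d + b * g x))) (at x)"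
    by (simp add: distrib_left distrib_right scaleC_mult_left scaleC_mult_right scaleC_add_right add_ac)
  then show ?thesis unfolding bderiv2_def by blast
qed

lemma cderiv2_psi:
  assumes "bderiv2 f x"
  shows "cderiv2 (\<lambda>y. \<psi> (f y)) x"
proof -
  obtain a b where "(f has_derivative (\<lambda>h. scaleC (fst h) a + scaleC (snd h) b)) (at x)"
    using assms by (auto simp: bderiv2_def)
  from bounded_linear.has_derivative[OF functional_linear[OF fun_psi] this]
  have "((\<lambda>y. \<psi> (f y)) has_derivative (\<lambda>h. \<psi> a * fst h + \<psi> b * snd h)) (at x)"
    by (simp add: psi_add psi_scaleC mult.commute)
  then show ?thesis unfolding cderiv2_def by blast
qed

lemma cderiv2_const: "cderiv2 (\<lambda>y. c) x"
  unfolding cderiv2_def by (intro exI[of _ 0]) simp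

lemma cderiv2_add:
  assumes "cderiv2 f x" "cderiv2 g x"
  shows "cderiv2 (\<lambda>y. f y + g y) x"
proof -
  obtain a b c d where "(f has_derivative (\<lambda>h. a * fst h + b * snd h)) (at x)"
    "(g has_derivative (\<lambda>h. c * fst h + d * snd h)) (at x)"
    using assms by (auto simp: cderiv2_def)
  from has_derivative_add[OF this]
  have "((\<lambda>y. f y + g y) has_derivative (\<lambda>h. (a + c) * fst h + (b + d) * snd h)) (at x)"
    by (simp add: algebra_simps)
  then show ?thesis unfolding cderiv2_def by blast
qed

lemma cderiv2_mult:
  assumes "cderiv2 f x" "cderiv2 g x"
  shows "cderiv2 (\<lambda>y. f y * g y) x"
proof -
  obtain a b c d where "(f has_derivative (\<lambda>h. a * fst h + b * snd h)) (at x)"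
    "(g has_derivative (\<lambda>h. c * fst h + d * snd h)) (at x)"
    using assms by (auto simp: cderiv2_def)
  from has_derivative_mult[OF this]
  have "((\<lambda>y. f y * g y) has_derivative (\<lambda>h. (f x * c + a * g x) * fst h + (f x * d + b * g x) * snd h)) (at x)"
    by (simp add: algebra_simps)
  then show ?thesis unfolding cderiv2_def by blast
qed

lemma cderiv2_sum: "(\<And>i. i \<in> I \<Longrightarrow> cderiv2 (f i) x) \<Longrightarrow> cderiv2 (\<lambda>y. \<Sum>i\<in>I. f i y) x"
  by (induction I rule: infinite_finite_induct) (auto intro: cderiv2_const cderiv2_add)

definition mderiv2 :: "(complex \<times> complex \<Rightarrow> complex^'n^'m) \<Rightarrow> complex \<times> complex \<Rightarrow> bool" where
  "mderiv2 F x \<longleftrightarrow> (\<forall>a b. cderiv2 (\<lambda>y. F y $ a $ b) x)"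

lemma mderiv2_const: "mderiv2 (\<lambda>y. A) x"
  by (simp add: mderiv2_def cderiv2_const)

lemma mderiv2_add: "mderiv2 F x \<Longrightarrow> mderiv2 F' x \<Longrightarrow> mderiv2 (\<lambda>y. F y + F' y) x"
  by (simp add: mderiv2_def cderiv2_add)

lemma mderiv2_mult: "mderiv2 F x \<Longrightarrow> mderiv2 F' x \<Longrightarrow> mderiv2 (\<lambda>y. F y ** F' y) x"
  by (simp add: mderiv2_def matrix_mult_nth cderiv2_sum cderiv2_mult)

lemma
  fixes F :: "complex \<times> complex \<Rightarrow> 'd matrix2"
  assumes "mderiv2 F x"
  shows mderiv2_Theta: "mderiv2 (\<lambda>y. Theta (F y)) x"
    and mderiv2_Gamma_tr: "mderiv2 (\<lambda>y. Gamma_tr (F y)) x"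
    and mderiv2_Phi: "mderiv2 (\<lambda>y. Phi (F y)) x"
    and mderiv2_transpose: "mderiv2 (\<lambda>y. transpose (F y)) x"
  using assms by (simp_all add: mderiv2_def Phi_def Theta_def Gamma_tr_def matrix4_def entry4_def transpose_def)

lemma mderiv2_kron: "mderiv2 F x \<Longrightarrow> mderiv2 F' x \<Longrightarrow> mderiv2 (\<lambda>y. kron (F y) (F' y)) x"
  by (simp add: mderiv2_def kron_def matrix4_def cderiv2_mult)

lemma mderiv2_G:
  assumes "x \<in> slit \<times> slit"
  shows "mderiv2 (\<lambda>y. G (fst y)) x" "mderiv2 (\<lambda>y. G (snd y)) x"
  using assms by (auto simp: mderiv2_def G_nth intro!: cderiv2_psi bderiv2_R_fst bderiv2_R_snd)

lemma mderiv2_B: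
  assumes "x \<in> slit \<times> slit"
  shows "mderiv2 (\<lambda>y. B (fst y) (snd y)) x" "mderiv2 (\<lambda>y. B (fst y) (fst y)) x" "mderiv2 (\<lambda>y. B (snd y) (snd y)) x"
  using assms by (auto simp: mderiv2_def B_nth intro!: cderiv2_psi bderiv2_mult bderiv2_R_fst bderiv2_R_snd)

text \<open>On the slit plane the matrix inverses are polynomials in \<open>\<Sigma>\<close> and
  \<open>B\<close>, so only products and sums of entries of resolvent type have to be
  differentiated.\<close>

lemma calG2_analytic: "analytic2_on (calG2 (Sigma_mat \<sigma>) G) (slit \<times> slit)"
  unfolding analytic2_on_def
proof (intro conjI ballI allI)
  show "open (slit \<times> slit)" by (intro open_Times open_slit_plane)
  fix x a b assume x: "x \<in> slit \<times> slit"
  let ?S = "Sigma_mat \<sigma>"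
  let ?H = "\<lambda>y. (mat 1 + ?S ** B (fst y) (snd y)) ** ?S"
  let ?F = "\<lambda>y. Theta (B (fst y) (fst y) ** (Theta (?H y) +
    Phi (Gamma_tr (?H y) ** Gamma_tr (kron (G (fst y)) (G (snd y))) ** Gamma_tr (?H y))) ** transpose (B (snd y) (snd y)))"
  have "mderiv2 ?F x"
    by (intro mderiv2_Theta mderiv2_mult mderiv2_add mderiv2_Phi mderiv2_Gamma_tr mderiv2_kron mderiv2_transpose
        mderiv2_const mderiv2_G mderiv2_B x)
  then obtain u v where uv: "((\<lambda>y. ?F y $ a $ b) has_derivative (\<lambda>h. u * fst h + v * snd h)) (at x)"
    unfolding mderiv2_def cderiv2_def by blast
  have "((\<lambda>y. calG2 ?S G (fst y) (snd y) $ a $ b) has_derivative (\<lambda>h. u * fst h + v * snd h)) (at x)"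
  proof (rule has_derivative_transform_within_open[OF uv _ x])
    show "open (slit \<times> slit)" by (intro open_Times open_slit_plane)
    fix y assume "y \<in> slit \<times> slit"
    then have "fst y \<in> slit" "snd y \<in> slit" by auto
    then show "?F y $ a $ b = calG2 ?S G (fst y) (snd y) $ a $ b"
      by (simp add: calG2_def calH_eq calGD_eq)
  qed
  then show "\<exists>u v. ((\<lambda>y. calG2 ?S G (fst y) (snd y) $ a $ b) has_derivative (\<lambda>h. u * fst h + v * snd h)) (at x)"
    by blast
qed

end

subsection \<open>Bounds for the limiting covariances\<close>

text \<open>Both sums are the cofactor of \<open>\<rho> - \<kappa>\<close> in
  \<open>\<rho> ^ l - \<kappa> ^ l\<close>, and \<open>\<rho> - \<kappa>\<close> is at least
  1.\<close>

lemma geometric_convolution_le: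
  fixes \<kappa> \<rho> :: real
  assumes "0 \<le> \<kappa>" "\<kappa> + 1 \<le> \<rho>"
  shows "(\<Sum>j<l. \<kappa> ^ (l - Suc j) * \<rho> ^ j) \<le> \<rho> ^ l" "(\<Sum>j<l. \<kappa> ^ j * \<rho> ^ (l - Suc j)) \<le> \<rho> ^ l"
proof -
  define S where "S = (\<Sum>j<l. \<kappa> ^ (l - Suc j) * \<rho> ^ j)"
  define S' where "S' = (\<Sum>j<l. \<rho> ^ (l - Suc j) * \<kappa> ^ j)"
  have nn: "0 \<le> S" "0 \<le> S'" unfolding S_def S'_def using assms by (auto intro!: sum_nonneg)
  have k: "0 \<le> \<kappa> ^ l" using assms by simp
  have "\<rho> ^ l - \<kappa> ^ l = (\<rho> - \<kappa>) * S" "\<kappa> ^ l - \<rho> ^ l = (\<kappa> - \<rho>) * S'"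
    unfolding S_def S'_def by (rule power_diff_sumr2)+
  moreover have "1 * S \<le> (\<rho> - \<kappa>) * S" "1 * S' \<le> (\<rho> - \<kappa>) * S'"
    using assms nn by (intro mult_right_mono; simp)+
  ultimately have "S \<le> \<rho> ^ l" "S' \<le> \<rho> ^ l" using k by (auto simp: algebra_simps)
  then show "(\<Sum>j<l. \<kappa> ^ (l - Suc j) * \<rho> ^ j) \<le> \<rho> ^ l" "(\<Sum>j<l. \<kappa> ^ j * \<rho> ^ (l - Suc j)) \<le> \<rho> ^ l"
    by (simp_all add: S_def S'_def mult.commute)
qed

lemma card_paths_le: "card (paths m k q :: ('d::finite \<times> 'd) list set) \<le> CARD('d) ^ m"
proof (induction m arbitrary: k)
  case 0
  then show ?case by (simp add: paths.simps)
next
  case (Suc m)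
  have "card (paths (Suc m) k q) = (\<Sum>w\<in>paths (Suc m) k q. 1)" by simp
  also have "\<dots> = (\<Sum>r\<in>UNIV. card (paths m r q))" unfolding sum_paths_Suc by simp
  also have "\<dots> \<le> (\<Sum>r\<in>(UNIV::'d set). CARD('d) ^ m)" by (intro sum_mono Suc)
  finally show ?case by simp
qed

lemma norm_sum_paths_le:
  fixes F :: "('d::finite \<times> 'd) list \<Rightarrow> complex"
  assumes "\<And>w. w \<in> paths m k q \<Longrightarrow> norm (F w) \<le> b" "0 \<le> b"
  shows "norm (\<Sum>w\<in>paths m k q. F w) \<le> real CARD('d) ^ m * b"
proof -
  have "norm (\<Sum>w\<in>paths m k q. F w) \<le> (\<Sum>w\<in>paths m k q. b)" by (rule sum_norm_le) (rule assms(1))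
  also have "\<dots> = real (card (paths m k q)) * b" by simp
  also have "\<dots> \<le> real CARD('d) ^ m * b"
    using card_paths_le[of m k q] assms(2) by (intro mult_right_mono) (auto simp flip: of_nat_power)
  finally show ?thesis .
qed

locale second_order = semicircular_matrix \<sigma> \<psi> Y
  for \<sigma> :: "'d::finite covariance" and \<psi> :: "'b::cstar_algebra \<Rightarrow> complex" and Y :: "'b^'d^'d" +
  fixes \<gamma> :: "('d \<times> 'd) list \<Rightarrow> ('d \<times> 'd) list \<Rightarrow> complex"
  assumes gamma_Nil: "\<gamma> [] u = 0"
    and gamma_Cons: "\<gamma> (e # w) u =
      split_sum (\<lambda>a g b. cov_letters \<sigma> e g * (tau (cov_letters \<sigma>) b * \<gamma> a u + tau (cov_letters \<sigma>) a * \<gamma> b u)) w +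
      split_sum (\<lambda>a g b. cov_letters \<sigma> e g * tau (cov_letters \<sigma>) (w @ b @ a)) u"
begin

text \<open>The 1 is added so that powers of \<open>\<kappa>\<close> increase with the
  exponent.\<close>

definition \<kappa> :: real where "\<kappa> = K\<^sub>0 + 1"
text \<open>Growth rate for \<open>\<gamma>\<close> in the length of its first word. It has to
  dominate \<open>12 * \<kappa>\<^sup>2\<close>, the constant of the recursion, as well as
  \<open>\<kappa> + 1\<close>, the gap needed for the convolutions.\<close>

definition \<rho> :: real where "\<rho> = 20 * \<kappa>\<^sup>2"

lemma kappa_ge: "1 \<le> \<kappa>" by (simp add: \<kappa>_def K0_nonneg)

lemma rho_ge: "\<kappa> + 1 \<le> \<rho>"
proof -
  have "1 * \<kappa> \<le> \<kappa> * \<kappa>" using kappa_ge by (intro mult_right_mono) auto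
  then show ?thesis using kappa_ge unfolding \<rho>_def power2_eq_square by linarith
qed

lemma norm_word_val: "norm (word_val Y w) \<le> \<kappa> ^ length w"
proof (induction w)
  case (Cons e w)
  have "norm (Y $ fst e $ snd e) \<le> \<kappa>" using norm_entry_le[of Y "fst e" "snd e"] by (simp add: \<kappa>_def K\<^sub>0_def)
  then show ?case using Cons kappa_ge
    by (auto intro!: order_trans[OF norm_mult_ineq] mult_mono)
qed simp

lemma norm_tau: "norm (tau cv w) \<le> 2 * \<kappa> ^ length w"
  using tracial_state_norm_le[OF state, of "word_val Y w"] norm_word_val[of w] by (simp add: psi_word)

lemma norm_cv: "norm (cv e f) \<le> 2 * \<kappa>\<^sup>2"
  using norm_tau[of "[e, f]"] by (simp add: tau_Cons power2_eq_square)

text \<open>Induction on the first word with the second fixed. The factor \<open>length u\<close>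
  counts the terms of the source, and the rate \<open>\<rho>\<close> absorbs the convolutions with
  \<open>tau\<close>.\<close>

lemma norm_gamma: "norm (\<gamma> w u) \<le> real (length u) * \<kappa> ^ length u * \<rho> ^ length w"
proof (induction "length w" arbitrary: w rule: less_induct)
  case less
  define X where "X = real (length u) * \<kappa> ^ length u"
  have X: "0 \<le> X" using kappa_ge by (simp add: X_def)
  have \<rho>: "0 \<le> \<rho>" "\<kappa> \<le> \<rho>" using rho_ge kappa_ge by linarith+
  have \<kappa>: "0 \<le> \<kappa>" using kappa_ge by simp
  show ?case
  proof (cases w)
    case Nil
    then show ?thesis using kappa_ge by (simp add: gamma_Nil)
  next
    case (Cons e v)
    let ?l = "length v"
    have IH: "norm (\<gamma> a u) \<le> X * \<rho> ^ length a" if "length a < length w" for a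
      using less[OF that] by (simp add: X_def)
    have "norm (split_sum (\<lambda>a g b. cv e g * (tau cv b * \<gamma> a u + tau cv a * \<gamma> b u)) v) \<le>
      (\<Sum>j<?l. 2 * \<kappa>\<^sup>2 * ((2 * \<kappa> ^ (?l - Suc j)) * (X * \<rho> ^ j) + (2 * \<kappa> ^ j) * (X * \<rho> ^ (?l - Suc j))))"
      unfolding split_sum_def
    proof (intro sum_norm_le)
      fix j assume j: "j \<in> {..<?l}"
      have "norm (tau cv (drop (Suc j) v) * \<gamma> (take j v) u) \<le> (2 * \<kappa> ^ (?l - Suc j)) * (X * \<rho> ^ j)"
        unfolding norm_mult using norm_tau[of "drop (Suc j) v"] IH[of "take j v"] j Cons \<kappa>
        by (intro mult_mono) auto
      moreover have "norm (tau cv (take j v) * \<gamma> (drop (Suc j) v) u) \<le> (2 * \<kappa> ^ j) * (X * \<rho> ^ (?l - Suc j))"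
        unfolding norm_mult using norm_tau[of "take j v"] IH[of "drop (Suc j) v"] j Cons \<kappa>
        by (intro mult_mono) auto
      ultimately have "norm (tau cv (drop (Suc j) v) * \<gamma> (take j v) u + tau cv (take j v) * \<gamma> (drop (Suc j) v) u) \<le>
        (2 * \<kappa> ^ (?l - Suc j)) * (X * \<rho> ^ j) + (2 * \<kappa> ^ j) * (X * \<rho> ^ (?l - Suc j))"
        by (intro order_trans[OF norm_triangle_ineq] add_mono)
      then show "norm (cv e (v ! j) * (tau cv (drop (Suc j) v) * \<gamma> (take j v) u + tau cv (take j v) * \<gamma> (drop (Suc j) v) u)) \<le>
        2 * \<kappa>\<^sup>2 * ((2 * \<kappa> ^ (?l - Suc j)) * (X * \<rho> ^ j) + (2 * \<kappa> ^ j) * (X * \<rho> ^ (?l - Suc j)))"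
        unfolding norm_mult by (intro mult_mono norm_cv) auto
    qed
    also have "\<dots> = 4 * \<kappa>\<^sup>2 * X * ((\<Sum>j<?l. \<kappa> ^ (?l - Suc j) * \<rho> ^ j) + (\<Sum>j<?l. \<kappa> ^ j * \<rho> ^ (?l - Suc j)))"
      by (simp add: sum.distrib[symmetric] sum_distrib_left algebra_simps)
    also have "\<dots> \<le> 4 * \<kappa>\<^sup>2 * X * (\<rho> ^ ?l + \<rho> ^ ?l)"
      using X \<kappa> rho_ge by (intro mult_left_mono add_mono geometric_convolution_le) auto
    finally have 1: "norm (split_sum (\<lambda>a g b. cv e g * (tau cv b * \<gamma> a u + tau cv a * \<gamma> b u)) v) \<le> 8 * \<kappa>\<^sup>2 * X * \<rho> ^ ?l"
      by simp
    have "norm (split_sum (\<lambda>a g b. cv e g * tau cv (v @ b @ a)) u) \<le> (\<Sum>j<length u. 2 * \<kappa>\<^sup>2 * (2 * (\<kappa> ^ length u * \<rho> ^ ?l)))"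
      unfolding split_sum_def
    proof (intro sum_norm_le)
      fix j assume j: "j \<in> {..<length u}"
      have "norm (tau cv (v @ drop (Suc j) u @ take j u)) \<le> 2 * \<kappa> ^ (?l + (length u - 1))"
        using norm_tau[of "v @ drop (Suc j) u @ take j u"] j by simp
      also have "\<kappa> ^ (?l + (length u - 1)) \<le> \<kappa> ^ (length u + ?l)" using kappa_ge by (intro power_increasing) auto
      also have "\<dots> \<le> \<kappa> ^ length u * \<rho> ^ ?l"
        unfolding power_add using \<kappa> \<rho> by (intro mult_left_mono power_mono) auto
      finally show "norm (cv e (u ! j) * tau cv (v @ drop (Suc j) u @ take j u)) \<le> 2 * \<kappa>\<^sup>2 * (2 * (\<kappa> ^ length u * \<rho> ^ ?l))"
        unfolding norm_mult by (intro mult_mono norm_cv) auto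
    qed
    also have "\<dots> = 4 * \<kappa>\<^sup>2 * X * \<rho> ^ ?l" by (simp add: X_def)
    finally have 2: "norm (split_sum (\<lambda>a g b. cv e g * tau cv (v @ b @ a)) u) \<le> 4 * \<kappa>\<^sup>2 * X * \<rho> ^ ?l" .
    \<comment> \<open>The convolutions contribute 8 and the source 4; together they explain the 12
      below \<open>\<rho>\<close>.\<close>
    have "norm (\<gamma> w u) \<le> 8 * \<kappa>\<^sup>2 * X * \<rho> ^ ?l + 4 * \<kappa>\<^sup>2 * X * \<rho> ^ ?l"
      unfolding Cons gamma_Cons by (rule order_trans[OF norm_triangle_ineq add_mono[OF 1 2]])
    also have "\<dots> = 12 * \<kappa>\<^sup>2 * (X * \<rho> ^ ?l)" by simp
    also have "\<dots> \<le> \<rho> * (X * \<rho> ^ ?l)"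
      using X \<rho> by (intro mult_right_mono) (auto simp: \<rho>_def)
    finally show ?thesis by (simp add: Cons X_def mult_ac)
  qed
qed

text \<open>The first walk is left open, from \<open>p\<close> to \<open>q\<close>, while the second
  is closed and summed. With two traces the recursion would not close, since removing letters from
  the first word yields open pieces.\<close>

definition cov_paths :: "nat \<Rightarrow> nat \<Rightarrow> 'd \<Rightarrow> 'd \<Rightarrow> complex" where
  "cov_paths m n p q = (\<Sum>w\<in>paths m p q. \<Sum>v\<in>UNIV. \<Sum>u\<in>paths n v v. \<gamma> w u)"

definition dd :: real where "dd = real CARD('d)"

lemma dd_ge: "1 \<le> dd" by (simp add: dd_def Suc_le_eq)

lemma norm_cov_paths: "norm (cov_paths m n p q) \<le> dd * (dd * \<rho>) ^ m * (real n * (dd * \<kappa>) ^ n)"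
proof -
  have \<kappa>\<rho>: "0 \<le> \<kappa>" "0 \<le> \<rho>" using kappa_ge rho_ge by linarith+
  have "norm (cov_paths m n p q) \<le> real CARD('d) ^ m * (\<Sum>v\<in>(UNIV::'d set). real CARD('d) ^ n * (real n * \<kappa> ^ n * \<rho> ^ m))"
    unfolding cov_paths_def
  proof (rule norm_sum_paths_le, rule sum_norm_le)
    fix w v assume w: "w \<in> paths m p q"
    show "norm (\<Sum>u\<in>paths n v v. \<gamma> w u) \<le> real CARD('d) ^ n * (real n * \<kappa> ^ n * \<rho> ^ m)"
    proof (rule norm_sum_paths_le)
      fix u assume "u \<in> paths n v v"
      then show "norm (\<gamma> w u) \<le> real n * \<kappa> ^ n * \<rho> ^ m"
        using norm_gamma[of w u] length_paths[OF w] length_paths[of u n v v] by simp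
    qed (use \<kappa>\<rho> in simp)
  qed (use \<kappa>\<rho> in \<open>simp add: sum_nonneg\<close>)
  also have "\<dots> = dd * (dd * \<rho>) ^ m * (real n * (dd * \<kappa>) ^ n)"
    by (simp add: dd_def power_mult_distrib mult_ac)
  finally show ?thesis .
qed

lemma cov_paths_0: "cov_paths 0 n p q = 0"
  by (simp add: cov_paths_def gamma_Nil)

subsection \<open>Recursion and generating function in the first variable\<close>

text \<open>The two convolutions record whether the covariance sits before or behind the partner of
  the first letter. In the last term the partner lies in the closed walk, which is thereby cut open
  and appended.\<close>

lemma cov_paths_Suc:
  "cov_paths (Suc m) n p q = (\<Sum>k\<in>UNIV. \<Sum>r\<in>UNIV. \<Sum>t\<in>UNIV. cv (p, k) (r, t) *
     ((\<Sum>j<m. cov_paths j n k r * \<psi> (matpow Y (m - Suc j) $ t $ q)) +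
      (\<Sum>j<m. \<psi> (matpow Y j $ k $ r) * cov_paths (m - Suc j) n t q) +
      of_nat n * \<psi> (matpow Y m $ k $ q * matpow Y (n - 1) $ t $ r)))"
proof -
  define U where "U F = (\<Sum>v\<in>UNIV. \<Sum>u\<in>paths n v v. F u)" for F :: "('d \<times> 'd) list \<Rightarrow> complex"
  have one: "\<psi> (matpow Y j $ k $ r) = (\<Sum>a\<in>paths j k r. tau cv a)" for j k r
    by (simp add: matpow_paths psi_sum psi_word)
  have three: "\<psi> (matpow Y m $ k $ q * (matpow Y i $ t $ v * matpow Y j $ v $ r)) =
    (\<Sum>w\<in>paths m k q. \<Sum>b\<in>paths i t v. \<Sum>a\<in>paths j v r. tau cv (w @ b @ a))" for k i t v j r
  proof -
    have "matpow Y m $ k $ q * (matpow Y i $ t $ v * matpow Y j $ v $ r) =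
      (\<Sum>w\<in>paths m k q. \<Sum>b\<in>paths i t v. \<Sum>a\<in>paths j v r. word_val Y (w @ b @ a))"
      unfolding matpow_paths sum_distrib_left sum_distrib_right word_val_append mult.assoc
      by (subst (2) sum.swap) (subst sum.swap, rule sum.cong[OF refl], rule sum.swap)
    then show ?thesis by (simp only: psi_sum psi_word)
  qed
  have U_add: "U (\<lambda>u. F u + F' u) = U F + U F'" for F F' by (simp add: U_def sum.distrib)
  have U_mult: "U (\<lambda>u. c * F u) = c * U F" for c F by (simp add: U_def sum_distrib_left)
  have U_split: "U (\<lambda>u. split_sum (\<lambda>a g b. F u a g b) w) = split_sum (\<lambda>a g b. U (\<lambda>u. F u a g b)) w" for F w
    by (simp add: U_def split_sum_sum)
  have "cov_paths (Suc m) n p q = (\<Sum>k\<in>UNIV. (\<Sum>w\<in>paths m k q. U (\<lambda>u. \<gamma> ((p, k) # w) u)))"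
    by (simp add: cov_paths_def U_def)
  also have "\<dots> = (\<Sum>k\<in>UNIV. (\<Sum>r\<in>UNIV. \<Sum>t\<in>UNIV. cv (p, k) (r, t) *
     ((\<Sum>j<m. cov_paths j n k r * \<psi> (matpow Y (m - Suc j) $ t $ q)) +
      (\<Sum>j<m. \<psi> (matpow Y j $ k $ r) * cov_paths (m - Suc j) n t q) +
      of_nat n * \<psi> (matpow Y m $ k $ q * matpow Y (n - 1) $ t $ r))))"
  proof (rule sum.cong[OF refl])
    fix k
    have "(\<Sum>w\<in>paths m k q. U (\<lambda>u. \<gamma> ((p, k) # w) u)) =
      (\<Sum>w\<in>paths m k q. split_sum (\<lambda>a g b. cv (p, k) g * (tau cv b * U (\<gamma> a) + tau cv a * U (\<gamma> b))) w) +
      (\<Sum>w\<in>paths m k q. U (split_sum (\<lambda>a g b. cv (p, k) g * tau cv (w @ b @ a))))"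
      unfolding gamma_Cons by (simp add: U_add U_split U_mult sum.distrib)
    also have "(\<Sum>w\<in>paths m k q. split_sum (\<lambda>a g b. cv (p, k) g * (tau cv b * U (\<gamma> a) + tau cv a * U (\<gamma> b))) w) =
      (\<Sum>j<m. \<Sum>r\<in>UNIV. \<Sum>t\<in>UNIV. cv (p, k) (r, t) *
        (cov_paths j n k r * \<psi> (matpow Y (m - Suc j) $ t $ q) + \<psi> (matpow Y j $ k $ r) * cov_paths (m - Suc j) n t q))"
      unfolding sum_paths_split_sum one
    proof (intro sum.cong refl)
      fix j r t
      have cp: "cov_paths j' n k' r' = (\<Sum>a\<in>paths j' k' r'. U (\<gamma> a))" for j' k' r'
        by (simp add: cov_paths_def U_def)
      show "(\<Sum>a\<in>paths j k r. \<Sum>b\<in>paths (m - Suc j) t q. cv (p, k) (r, t) * (tau cv b * U (\<gamma> a) + tau cv a * U (\<gamma> b))) =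
        cv (p, k) (r, t) * (cov_paths j n k r * sum (tau cv) (paths (m - Suc j) t q) +
          sum (tau cv) (paths j k r) * cov_paths (m - Suc j) n t q)"
        unfolding cp sum_product
        by (simp add: sum.distrib sum_distrib_left distrib_left mult_ac)
    qed
    also have "\<dots> = (\<Sum>r\<in>UNIV. \<Sum>t\<in>UNIV. cv (p, k) (r, t) *
        ((\<Sum>j<m. cov_paths j n k r * \<psi> (matpow Y (m - Suc j) $ t $ q)) + (\<Sum>j<m. \<psi> (matpow Y j $ k $ r) * cov_paths (m - Suc j) n t q)))"
      by (subst sum.swap, rule sum.cong[OF refl], subst sum.swap)
         (simp add: sum.distrib[symmetric] sum_distrib_left)
    also have "(\<Sum>w\<in>paths m k q. U (split_sum (\<lambda>a g b. cv (p, k) g * tau cv (w @ b @ a)))) =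
      (\<Sum>r\<in>UNIV. \<Sum>t\<in>UNIV. cv (p, k) (r, t) * (of_nat n * \<psi> (matpow Y m $ k $ q * matpow Y (n - 1) $ t $ r)))"
    proof -
      have "(\<Sum>w\<in>paths m k q. U (split_sum (\<lambda>a g b. cv (p, k) g * tau cv (w @ b @ a)))) =
        (\<Sum>v\<in>UNIV. \<Sum>u\<in>paths n v v. split_sum (\<lambda>a g b. \<Sum>w\<in>paths m k q. cv (p, k) g * tau cv (w @ b @ a)) u)"
        unfolding U_def split_sum_sum by (subst sum.swap, rule sum.cong[OF refl], rule sum.swap)
      also have "\<dots> = (\<Sum>v\<in>UNIV. \<Sum>j<n. \<Sum>r\<in>UNIV. \<Sum>t\<in>UNIV.
          cv (p, k) (r, t) * \<psi> (matpow Y m $ k $ q * (matpow Y (n - Suc j) $ t $ v * matpow Y j $ v $ r)))"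
        unfolding sum_paths_split_sum three
      proof (intro sum.cong refl)
        fix v j r t
        have "(\<Sum>a\<in>paths j v r. \<Sum>b\<in>paths (n - Suc j) t v. \<Sum>w\<in>paths m k q. cv (p, k) (r, t) * tau cv (w @ b @ a)) =
          (\<Sum>b\<in>paths (n - Suc j) t v. \<Sum>a\<in>paths j v r. \<Sum>w\<in>paths m k q. cv (p, k) (r, t) * tau cv (w @ b @ a))"
          by (rule sum.swap)
        also have "\<dots> = (\<Sum>b\<in>paths (n - Suc j) t v. \<Sum>w\<in>paths m k q. \<Sum>a\<in>paths j v r. cv (p, k) (r, t) * tau cv (w @ b @ a))"
          by (rule sum.cong[OF refl], rule sum.swap)
        also have "\<dots> = (\<Sum>w\<in>paths m k q. \<Sum>b\<in>paths (n - Suc j) t v. \<Sum>a\<in>paths j v r. cv (p, k) (r, t) * tau cv (w @ b @ a))"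
          by (rule sum.swap)
        finally show "(\<Sum>a\<in>paths j v r. \<Sum>b\<in>paths (n - Suc j) t v. \<Sum>w\<in>paths m k q. cv (p, k) (r, t) * tau cv (w @ b @ a)) =
          cv (p, k) (r, t) * (\<Sum>w\<in>paths m k q. \<Sum>b\<in>paths (n - Suc j) t v. \<Sum>a\<in>paths j v r. tau cv (w @ b @ a))"
          by (simp add: sum_distrib_left)
      qed
      also have "\<dots> = (\<Sum>r\<in>UNIV. \<Sum>t\<in>UNIV. \<Sum>j<n. \<Sum>v\<in>UNIV.
          cv (p, k) (r, t) * \<psi> (matpow Y m $ k $ q * (matpow Y (n - Suc j) $ t $ v * matpow Y j $ v $ r)))"
        by (subst sum.swap, subst (2) sum.swap, subst sum.swap, rule sum.cong[OF refl],
            subst (2) sum.swap, subst sum.swap, rule refl)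
      \<comment> \<open>Summing over the base point \<open>v\<close> glues both arcs of the closed
        walk into one walk of \<open>n - 1\<close> steps. The term no longer depends on the cut
        \<open>j\<close>, whence the factor \<open>n\<close>.\<close>
      also have "\<dots> = (\<Sum>r\<in>UNIV. \<Sum>t\<in>UNIV. \<Sum>j<n. cv (p, k) (r, t) * \<psi> (matpow Y m $ k $ q * matpow Y (n - 1) $ t $ r))"
      proof (intro sum.cong refl)
        fix r t j assume "j \<in> {..<n}"
        then have "n - 1 = (n - Suc j) + j" by auto
        then have "matpow Y (n - 1) $ t $ r = (\<Sum>v\<in>UNIV. matpow Y (n - Suc j) $ t $ v * matpow Y j $ v $ r)"
          by (simp only: matpow_add matrix_mult_nth)
        then show "(\<Sum>v\<in>UNIV. cv (p, k) (r, t) * \<psi> (matpow Y m $ k $ q * (matpow Y (n - Suc j) $ t $ v * matpow Y j $ v $ r))) =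
          cv (p, k) (r, t) * \<psi> (matpow Y m $ k $ q * matpow Y (n - 1) $ t $ r)"
          by (simp add: sum_distrib_left psi_sum)
      qed
      finally show ?thesis by (simp add: mult.left_commute)
    qed
    finally show "(\<Sum>w\<in>paths m k q. U (\<lambda>u. \<gamma> ((p, k) # w) u)) = (\<Sum>r\<in>UNIV. \<Sum>t\<in>UNIV. cv (p, k) (r, t) *
     ((\<Sum>j<m. cov_paths j n k r * \<psi> (matpow Y (m - Suc j) $ t $ q)) +
      (\<Sum>j<m. \<psi> (matpow Y j $ k $ r) * cov_paths (m - Suc j) n t q) +
      of_nat n * \<psi> (matpow Y m $ k $ q * matpow Y (n - 1) $ t $ r)))"
      by (simp add: sum.distrib distrib_left)
  qed
  finally show ?thesis .
qed

text \<open>Exceeds the growth rate \<open>dd * \<rho>\<close> in the first variable. The factor 2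
  also covers \<open>2 * dd * \<kappa>\<close> in the second, where it absorbs the linear factor
  \<open>n\<close>.\<close>

definition K\<^sub>1 :: real where "K\<^sub>1 = 2 * dd * \<rho>"

lemma K1_ge: "K\<^sub>0 \<le> K\<^sub>1" "0 < K\<^sub>1" "2 * dd * \<kappa> \<le> K\<^sub>1" "dd * \<rho> < K\<^sub>1"
proof -
  have 1: "1 * \<rho> \<le> dd * \<rho>" using dd_ge rho_ge kappa_ge by (intro mult_right_mono) auto
  have 2: "dd * \<kappa> \<le> dd * \<rho>" using dd_ge rho_ge by (intro mult_left_mono) auto
  show "K\<^sub>0 \<le> K\<^sub>1" "0 < K\<^sub>1" "2 * dd * \<kappa> \<le> K\<^sub>1" "dd * \<rho> < K\<^sub>1"
    using 1 2 rho_ge kappa_ge unfolding K\<^sub>1_def \<kappa>_def by linarith+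
qed

text \<open>The generating function is formed in the first variable only; \<open>n\<close> stays a
  parameter until the linear system is solved.\<close>

definition Chat :: "nat \<Rightarrow> complex \<Rightarrow> 'd \<Rightarrow> 'd \<Rightarrow> complex" where
  "Chat n z p q = (\<Sum>m. cov_paths m n p q * (1 / z) ^ Suc m)"

lemma
  assumes z: "K\<^sub>1 < cmod z"
  shows Chat_abs: "summable (\<lambda>m. norm (cov_paths m n p q * (1 / z) ^ Suc m))"
    and Chat_sums: "(\<lambda>m. cov_paths m n p q * (1 / z) ^ Suc m) sums Chat n z p q"
proof -
  have zp: "cmod z > 0" using z K1_ge by linarith
  define b where "b = real n * (dd * \<kappa>) ^ n"
  define r where "r = dd * \<rho> / cmod z"
  have r: "0 \<le> r" "r < 1" using z zp K1_ge dd_ge rho_ge kappa_ge by (auto simp: r_def)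
  show *: "summable (\<lambda>m. norm (cov_paths m n p q * (1 / z) ^ Suc m))"
  proof (rule summable_comparison_test)
    show "summable (\<lambda>m. dd * b / cmod z * r ^ m)" using r by (intro summable_mult summable_geometric) auto
    have "norm (cov_paths m n p q * (1 / z) ^ Suc m) \<le> dd * b / cmod z * r ^ m" for m
    proof -
      have "norm (cov_paths m n p q) * (1 / cmod z) ^ Suc m \<le> dd * (dd * \<rho>) ^ m * b * (1 / cmod z) ^ Suc m"
        using norm_cov_paths[of m n p q] by (intro mult_right_mono) (auto simp: b_def)
      then show ?thesis by (simp add: norm_mult norm_power norm_divide r_def power_divide field_simps)
    qed
    then show "\<exists>N. \<forall>m\<ge>N. norm (norm (cov_paths m n p q * (1 / z) ^ Suc m)) \<le> dd * b / cmod z * r ^ m" by simp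
  qed
  show "(\<lambda>m. cov_paths m n p q * (1 / z) ^ Suc m) sums Chat n z p q"
    unfolding Chat_def using summable_norm_cancel[OF *] by (rule summable_sums)
qed

definition source :: "nat \<Rightarrow> complex \<Rightarrow> 'd \<Rightarrow> 'd \<Rightarrow> complex" where
  "source n z p q = (\<Sum>k\<in>UNIV. \<Sum>r\<in>UNIV. \<Sum>t\<in>UNIV. cv (p, k) (r, t) *
     (of_nat n * \<psi> (R z $ k $ q * matpow Y (n - 1) $ t $ r)))"

lemma Chat_equation:
  assumes z: "K\<^sub>1 < cmod z"
  shows "z * Chat n z p q = (\<Sum>k\<in>UNIV. \<Sum>r\<in>UNIV. \<Sum>t\<in>UNIV. cv (p, k) (r, t) *
    (Chat n z k r * G z $ t $ q + G z $ k $ r * Chat n z t q + of_nat n * \<psi> (R z $ k $ q * matpow Y (n - 1) $ t $ r)))"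
proof -
  have z0: "K\<^sub>0 < cmod z" and nz: "z \<noteq> 0" using z K1_ge by auto
  \<comment> \<open>The term for the empty walk is 0, so the series may start at index 1 and
    multiplication by \<open>z\<close> undoes the shift.\<close>
  have "(\<lambda>m. cov_paths (Suc m) n p q * (1 / z) ^ Suc (Suc m)) sums Chat n z p q"
    using Chat_sums[OF z, of n p q] by (subst sums_Suc_iff) (simp add: cov_paths_0)
  then have "(\<lambda>m. z * (cov_paths (Suc m) n p q * (1 / z) ^ Suc (Suc m))) sums (z * Chat n z p q)"
    by (rule sums_mult)
  moreover have "z * (cov_paths (Suc m) n p q * (1 / z) ^ Suc (Suc m)) =
    (\<Sum>k\<in>UNIV. \<Sum>r\<in>UNIV. \<Sum>t\<in>UNIV. cv (p, k) (r, t) *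
     ((\<Sum>j<m. cov_paths j n k r * \<psi> (matpow Y (m - Suc j) $ t $ q)) * (1 / z) ^ Suc m +
      (\<Sum>j<m. \<psi> (matpow Y j $ k $ r) * cov_paths (m - Suc j) n t q) * (1 / z) ^ Suc m +
      of_nat n * (\<psi> (matpow Y m $ k $ q * matpow Y (n - 1) $ t $ r) * (1 / z) ^ Suc m)))" for m
  proof -
    have "z * (cov_paths (Suc m) n p q * (1 / z) ^ Suc (Suc m)) = cov_paths (Suc m) n p q * (1 / z) ^ Suc m"
      using nz by simp
    then show ?thesis
      unfolding cov_paths_Suc by (simp only: sum_distrib_right sum_distrib_left distrib_left distrib_right mult_ac)
  qed
  moreover have "(\<lambda>m. \<Sum>k\<in>UNIV. \<Sum>r\<in>UNIV. \<Sum>t\<in>UNIV. cv (p, k) (r, t) *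
     ((\<Sum>j<m. cov_paths j n k r * \<psi> (matpow Y (m - Suc j) $ t $ q)) * (1 / z) ^ Suc m +
      (\<Sum>j<m. \<psi> (matpow Y j $ k $ r) * cov_paths (m - Suc j) n t q) * (1 / z) ^ Suc m +
      of_nat n * (\<psi> (matpow Y m $ k $ q * matpow Y (n - 1) $ t $ r) * (1 / z) ^ Suc m))) sums
    (\<Sum>k\<in>UNIV. \<Sum>r\<in>UNIV. \<Sum>t\<in>UNIV. cv (p, k) (r, t) *
    (Chat n z k r * G z $ t $ q + G z $ k $ r * Chat n z t q + of_nat n * \<psi> (R z $ k $ q * matpow Y (n - 1) $ t $ r)))"
    unfolding G_nth
    by (intro sums_sum sums_mult sums_add shifted_Cauchy_product Chat_sums Chat_abs z fun_psi z0
        series[OF fun_psi] series_abs[OF fun_psi]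
        series[where L = "\<lambda>x. \<psi> (x * matpow Y (n - 1) $ _ $ _)"] functional_mult_right)
  ultimately show ?thesis by (simp only: sums_unique2)
qed

lemma Linv_Chat:
  assumes "K\<^sub>1 < cmod z"
  shows "(\<Sum>t\<in>UNIV. Linv z $ p $ t * Chat n z t q) =
    (\<Sum>k\<in>UNIV. \<Sum>r\<in>UNIV. \<Sum>t\<in>UNIV. cv (p, k) (r, t) * (Chat n z k r * G z $ t $ q)) + source n z p q"
  unfolding Linv_row Chat_equation[OF assms] source_def distrib_left sum.distrib by simp

lemma slit_large: "K\<^sub>1 < cmod z \<Longrightarrow> z \<in> slit"
  using K1_ge by (intro large_in_slit_plane) auto

text \<open>The right factor \<open>Linv z\<close> is arranged so that applying
  \<open>kron (G z) (G z)\<close> returns \<open>G z\<close> times the source.\<close>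

definition source_vec :: "nat \<Rightarrow> complex \<Rightarrow> complex^('d \<times> 'd)" where
  "source_vec n z = (\<chi> a. \<Sum>s\<in>UNIV. source n z (fst a) s * Linv z $ s $ snd a)"

text \<open>As a vector, \<open>Chat\<close> satisfies \<open>V = K \<Sigma> V + K f\<close>, the
  same linear system as \<open>B\<close> with \<open>f\<close> attached on the right, so the
  solution is \<open>B f\<close>.\<close>

lemma Chat_solution:
  assumes z: "K\<^sub>1 < cmod z"
  shows "Chat n z p q = (B z z *v source_vec n z) $ (p, q)"
proof -
  note zs = slit_large[OF z]
  define V :: "complex^('d \<times> 'd)" where "V = (\<chi> a. Chat n z (fst a) (snd a))"
  let ?f = "source_vec n z" and ?S = "Sigma_mat \<sigma>" and ?K = "kron (G z) (G z)"
  have "V $ (p, q) = (?K *v (?S *v V) + ?K *v ?f) $ (p, q)" for p q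
  proof -
    have "V $ (p, q) = (\<Sum>t\<in>UNIV. (G z ** Linv z) $ p $ t * Chat n z t q)"
    proof -
      have "(\<Sum>t\<in>UNIV. (G z ** Linv z) $ p $ t * Chat n z t q) = (\<Sum>t\<in>UNIV. if p = t then Chat n z p q else 0)"
        unfolding Linv_G[OF zs] by (intro sum.cong refl) (simp add: mat_nth)
      then show ?thesis by (simp add: V_def)
    qed
    also have "\<dots> = (\<Sum>l\<in>UNIV. G z $ p $ l * (\<Sum>t\<in>UNIV. Linv z $ l $ t * Chat n z t q))"
      unfolding matrix_mult_nth sum_distrib_left sum_distrib_right by (subst sum.swap) (simp add: mult.assoc)
    also have "\<dots> = (\<Sum>l\<in>UNIV. G z $ p $ l * (\<Sum>k\<in>UNIV. \<Sum>r\<in>UNIV. \<Sum>t\<in>UNIV. cv (l, k) (r, t) * (Chat n z k r * G z $ t $ q))) +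
      (\<Sum>l\<in>UNIV. G z $ p $ l * source n z l q)"
      unfolding Linv_Chat[OF z] distrib_left sum.distrib ..
    also have "(\<Sum>l\<in>UNIV. G z $ p $ l * source n z l q) = (?K *v ?f) $ (p, q)"
    proof -
      have "(?K *v ?f) $ (p, q) = (\<Sum>l\<in>UNIV. \<Sum>t\<in>UNIV. \<Sum>s\<in>UNIV. G z $ p $ l * source n z l s * (Linv z $ s $ t * G z $ t $ q))"
        by (simp add: matrix_vector_mult_nth sum_UNIV_pair kron_nth source_vec_def G_sym[OF zs, of q] sum_distrib_left mult_ac)
      also have "\<dots> = (\<Sum>l\<in>UNIV. \<Sum>s\<in>UNIV. G z $ p $ l * source n z l s * (Linv z ** G z) $ s $ q)"
        unfolding matrix_mult_nth sum_distrib_left by (rule sum.cong[OF refl], rule sum.swap)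
      also have "\<dots> = (\<Sum>l\<in>UNIV. \<Sum>s\<in>UNIV. if s = q then G z $ p $ l * source n z l q else 0)"
        unfolding Linv_G[OF zs] by (intro sum.cong refl) (simp add: mat_nth)
      finally show ?thesis by simp
    qed
    also have "(\<Sum>l\<in>UNIV. G z $ p $ l * (\<Sum>k\<in>UNIV. \<Sum>r\<in>UNIV. \<Sum>t\<in>UNIV. cv (l, k) (r, t) * (Chat n z k r * G z $ t $ q))) =
      (?K *v (?S *v V)) $ (p, q)"
    proof -
      have "(\<Sum>k\<in>UNIV. \<Sum>r\<in>UNIV. \<Sum>t\<in>UNIV. cv (l, k) (r, t) * (Chat n z k r * G z $ t $ q)) =
        (\<Sum>t\<in>UNIV. \<Sum>k\<in>UNIV. \<Sum>r\<in>UNIV. cv (l, k) (r, t) * (Chat n z k r * G z $ t $ q))" for l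
        by (subst (2) sum.swap, rule sum.cong[OF refl], rule sum.swap)
      then show ?thesis
        by (simp add: matrix_vector_mult_nth sum_UNIV_pair kron_nth Sigma_nth V_def G_sym[OF zs, of q] sum_distrib_left mult_ac)
    qed
    finally show ?thesis by simp
  qed
  then have V: "V = ?K *v (?S *v V) + ?K *v ?f" by (simp add: vec_eq_iff split_paired_all)
  \<comment> \<open>Substituting \<open>K f = V - K \<Sigma> V\<close> into
    \<open>B f = K f + B \<Sigma> K f\<close> leaves V, because the other terms combine to
    \<open>(B - K - B \<Sigma> K) \<Sigma> V = 0\<close>.\<close>
  have "B z z *v ?f = (?K + B z z ** (?S ** ?K)) *v ?f" using B_equation'[OF zs zs] by simp
  also have "\<dots> = ?K *v ?f + B z z *v (?S *v (?K *v ?f))"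
    by (simp add: matrix_vector_mult_add_rdistrib matrix_vector_mul_assoc matrix_mul_assoc)
  also have "?K *v ?f = V - ?K *v (?S *v V)" using V by (simp add: algebra_simps)
  also have "V - ?K *v (?S *v V) + B z z *v (?S *v (V - ?K *v (?S *v V))) =
    V + B z z *v (?S *v V) - (?K + B z z ** (?S ** ?K)) *v (?S *v V)"
    by (simp add: matrix_vector_mult_add_rdistrib matrix_vector_mult_diff_distrib matrix_vector_mul_assoc matrix_mul_assoc
        matrix_add_rdistrib')
  also have "\<dots> = V" using B_equation'[OF zs zs] by simp
  finally show ?thesis by (simp add: V_def)
qed

text \<open>Traciality moves the second resolvent to the front, where the sum over \<open>p\<close>
  becomes a matrix product.\<close>

lemma sum_B_diagonal:
  assumes "z \<in> slit"
  shows "(\<Sum>p\<in>UNIV. B z z $ (p, p) $ (a, b)) = P z $ a $ b"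
proof -
  have "(\<Sum>p\<in>UNIV. B z z $ (p, p) $ (a, b)) = (\<Sum>p\<in>UNIV. \<psi> (R z $ b $ p * R z $ p $ a))"
    unfolding B_nth by (intro sum.cong refl psi_commute)
  then show ?thesis by (subst P_sym[OF assms]) (simp add: P_nth matrix_mult_nth psi_sum)
qed

lemma trace_Chat:
  assumes z: "K\<^sub>1 < cmod z"
  shows "(\<Sum>p\<in>UNIV. Chat n z p p) = (\<Sum>a\<in>UNIV. \<Sum>b\<in>UNIV. P z $ a $ b * (\<Sum>s\<in>UNIV. source n z a s * Linv z $ s $ b))"
proof -
  have "(\<Sum>p\<in>UNIV. Chat n z p p) = (\<Sum>p\<in>UNIV. \<Sum>a\<in>UNIV. \<Sum>b\<in>UNIV. B z z $ (p, p) $ (a, b) * (\<Sum>s\<in>UNIV. source n z a s * Linv z $ s $ b))"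
    unfolding Chat_solution[OF z] by (simp add: matrix_vector_mult_nth sum_UNIV_pair source_vec_def)
  also have "\<dots> = (\<Sum>a\<in>UNIV. \<Sum>b\<in>UNIV. \<Sum>p\<in>UNIV. B z z $ (p, p) $ (a, b) * (\<Sum>s\<in>UNIV. source n z a s * Linv z $ s $ b))"
    by (subst sum.swap, rule sum.cong[OF refl], rule sum.swap)
  finally show ?thesis
    unfolding sum_distrib_right[symmetric] sum_B_diagonal[OF slit_large[OF z]] .
qed

end

subsection \<open>Generating function in the second variable\<close>

context second_order begin

text \<open>The Cauchy square of the Neumann series has \<open>k + 1\<close> equal summands in
  degree \<open>k\<close>. These multiplicities are exactly the factors \<open>n\<close> from the
  cuts of a closed walk, so the source sums to the square of the resolvent.\<close>

lemma resolv_square_series: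
  assumes L: "functional L" and w: "K\<^sub>0 < cmod w"
  shows "(\<lambda>n. of_nat n * L (matpow Y (n - 1) $ t $ r) * (1 / w) ^ Suc n) sums L ((R w ** R w) $ t $ r)"
proof -
  define a where "a p q n = scaleC (1 / w ^ Suc n) (matpow Y n $ p $ q)" for p q n
  have wp: "cmod w > 0" using w K0_nonneg by linarith
  define \<theta> where "\<theta> = K\<^sub>0 / cmod w"
  have \<theta>: "0 \<le> \<theta>" "\<theta> < 1" using w wp K0_nonneg by (auto simp: \<theta>_def)
  have a_sums: "a p q sums (R w $ p $ q)" for p q
    unfolding a_def using resolv_large(2)[OF w[unfolded K\<^sub>0_def]] .
  have a_abs: "summable (\<lambda>n. norm (a p q n))" for p q
  proof (rule summable_comparison_test)
    show "summable (\<lambda>n. 1 / cmod w * \<theta> ^ n)" using \<theta> by (intro summable_mult summable_geometric) auto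
    have "norm (a p q n) \<le> 1 / cmod w * \<theta> ^ n" for n
    proof -
      have "1 / cmod w ^ Suc n * norm (matpow Y n $ p $ q) \<le> 1 / cmod w ^ Suc n * K\<^sub>0 ^ n"
        unfolding K\<^sub>0_def by (intro mult_left_mono norm_matpow_le) simp
      then show ?thesis by (simp add: a_def norm_scaleC norm_divide norm_mult norm_power \<theta>_def power_divide)
    qed
    then show "\<exists>N. \<forall>n\<ge>N. norm (norm (a p q n)) \<le> 1 / cmod w * \<theta> ^ n" by simp
  qed
  have "(\<lambda>k. \<Sum>v\<in>UNIV. \<Sum>i\<le>k. a t v i * a v r (k - i)) sums (\<Sum>v\<in>UNIV. R w $ t $ v * R w $ v $ r)"
    using Cauchy_product_sums[OF a_abs a_abs] a_sums by (intro sums_sum) (simp add: sums_iff)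
  moreover have "(\<Sum>v\<in>UNIV. \<Sum>i\<le>k. a t v i * a v r (k - i)) = scaleC (of_nat (Suc k) / w ^ Suc (Suc k)) (matpow Y k $ t $ r)" for k
  proof -
    have "(\<Sum>v\<in>UNIV. \<Sum>i\<le>k. a t v i * a v r (k - i)) = (\<Sum>i\<le>k. \<Sum>v\<in>UNIV. a t v i * a v r (k - i))"
      by (rule sum.swap)
    also have "\<dots> = (\<Sum>i\<le>k. scaleC (1 / w ^ Suc (Suc k)) (matpow Y k $ t $ r))"
    proof (rule sum.cong[OF refl])
      fix i assume "i \<in> {..k}"
      then have k: "k = i + (k - i)" by simp
      have p: "1 / w ^ Suc i * (1 / w ^ Suc (k - i)) = 1 / w ^ Suc (Suc k)"
      proof -
        have "w ^ Suc i * w ^ Suc (k - i) = w ^ Suc (Suc k)"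
          using k by (simp add: power_add[symmetric] del: power_Suc)
        then show ?thesis by (simp only: times_divide_times_eq mult_1)
      qed
      have "(\<Sum>v\<in>UNIV. a t v i * a v r (k - i)) =
        (\<Sum>v\<in>UNIV. scaleC (1 / w ^ Suc i * (1 / w ^ Suc (k - i))) (matpow Y i $ t $ v * matpow Y (k - i) $ v $ r))"
        by (simp only: a_def scaleC_mult_left scaleC_mult_right scaleC_scaleC mult.commute[of "1 / w ^ Suc (k - i)"])
      also have "\<dots> = scaleC (1 / w ^ Suc (Suc k)) (matpow Y (i + (k - i)) $ t $ r)"
        unfolding p by (simp only: scaleC_sum_right[symmetric] matpow_add matrix_mult_nth)
      finally show "(\<Sum>v\<in>UNIV. a t v i * a v r (k - i)) = scaleC (1 / w ^ Suc (Suc k)) (matpow Y k $ t $ r)"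
        using k by simp
    qed
    also have "\<dots> = of_nat (Suc k) *\<^sub>R scaleC (1 / w ^ Suc (Suc k)) (matpow Y k $ t $ r)"
      by (simp add: scaleR_conv_of_real)
    also have "\<dots> = scaleC (complex_of_real (of_nat (Suc k)) * (1 / w ^ Suc (Suc k))) (matpow Y k $ t $ r)"
      by (simp only: scaleC_of_real[symmetric] scaleC_scaleC)
    finally show ?thesis by simp
  qed
  ultimately have "(\<lambda>k. scaleC (of_nat (Suc k) / w ^ Suc (Suc k)) (matpow Y k $ t $ r)) sums ((R w ** R w) $ t $ r)"
    by (simp only: matrix_mult_nth)
  from bounded_linear.sums[OF functional_linear[OF L] this]
  have "(\<lambda>k. of_nat (Suc k) * L (matpow Y (Suc k - 1) $ t $ r) * (1 / w) ^ Suc (Suc k)) sums L ((R w ** R w) $ t $ r)"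
    by (simp add: functional_scaleC[OF L] power_one_over field_simps)
  then show ?thesis
    by (subst (asm) sums_Suc_iff[of "\<lambda>n. of_nat n * L (matpow Y (n - 1) $ t $ r) * (1 / w) ^ Suc n"]) simp
qed

definition source2 :: "complex \<Rightarrow> complex \<Rightarrow> 'd \<Rightarrow> 'd \<Rightarrow> complex" where
  "source2 z w p q = (\<Sum>k\<in>UNIV. \<Sum>r\<in>UNIV. \<Sum>t\<in>UNIV. cv (p, k) (r, t) * \<psi> (R z $ k $ q * (R w ** R w) $ t $ r))"

lemma source_sums:
  assumes w: "K\<^sub>0 < cmod w"
  shows "(\<lambda>n. source n z p q * (1 / w) ^ Suc n) sums source2 z w p q"
proof -
  have "(\<lambda>n. \<Sum>k\<in>UNIV. \<Sum>r\<in>UNIV. \<Sum>t\<in>UNIV. cv (p, k) (r, t) *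
      (of_nat n * \<psi> (R z $ k $ q * matpow Y (n - 1) $ t $ r) * (1 / w) ^ Suc n)) sums source2 z w p q"
    unfolding source2_def
    by (intro sums_sum sums_mult resolv_square_series[where L = "\<lambda>x. \<psi> (R z $ _ $ q * x)"] functional_mult_left fun_psi w)
  then show ?thesis unfolding source_def by (simp only: sum_distrib_right mult.assoc)
qed

section \<open>Summation of the double series\<close>

definition alpha_lim :: "nat \<Rightarrow> nat \<Rightarrow> complex" where
  "alpha_lim m n = (\<Sum>p\<in>UNIV. cov_paths m n p p)"

definition G2_value :: "complex \<Rightarrow> complex \<Rightarrow> complex" where
  "G2_value z w = (\<Sum>a\<in>UNIV. \<Sum>b\<in>UNIV. P z $ a $ b * (\<Sum>s\<in>UNIV. source2 z w a s * Linv z $ s $ b))"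

lemma alpha_lim_sums:
  assumes "K\<^sub>1 < cmod z"
  shows "(\<lambda>m. alpha_lim m n * (1 / z) ^ Suc m) sums (\<Sum>p\<in>UNIV. Chat n z p p)"
  unfolding alpha_lim_def sum_distrib_right by (intro sums_sum Chat_sums assms)

lemma trace_Chat_sums:
  assumes "K\<^sub>1 < cmod z" "K\<^sub>1 < cmod w"
  shows "(\<lambda>n. (\<Sum>p\<in>UNIV. Chat n z p p) * (1 / w) ^ Suc n) sums G2_value z w"
proof -
  have "(\<lambda>n. \<Sum>a\<in>UNIV. \<Sum>b\<in>UNIV. P z $ a $ b * (\<Sum>s\<in>UNIV. source n z a s * (1 / w) ^ Suc n * Linv z $ s $ b)) sums G2_value z w"
    unfolding G2_value_def using assms K1_ge by (intro sums_sum sums_mult sums_mult2 source_sums) auto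
  then show ?thesis
    unfolding trace_Chat[OF assms(1)] by (simp only: sum_distrib_right sum_distrib_left mult_ac)
qed

lemma norm_alpha_lim: "norm (alpha_lim m n) \<le> dd\<^sup>2 * (dd * \<rho>) ^ m * (2 * dd * \<kappa>) ^ n"
proof -
  have \<kappa>\<rho>: "0 \<le> \<kappa>" "0 \<le> \<rho>" using kappa_ge rho_ge by linarith+
  have "norm (alpha_lim m n) \<le> (\<Sum>p\<in>(UNIV::'d set). dd * (dd * \<rho>) ^ m * (real n * (dd * \<kappa>) ^ n))"
    unfolding alpha_lim_def by (intro sum_norm_le norm_cov_paths)
  also have "\<dots> = dd\<^sup>2 * (dd * \<rho>) ^ m * (real n * (dd * \<kappa>) ^ n)" by (simp add: dd_def power2_eq_square)
  \<comment> \<open>The linear factor is traded for \<open>2 ^ n\<close>, which makes the bound a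
    product of two geometric sequences.\<close>
  also have "\<dots> \<le> dd\<^sup>2 * (dd * \<rho>) ^ m * (2 ^ n * (dd * \<kappa>) ^ n)"
    using \<kappa>\<rho> dd_ge by (intro mult_left_mono mult_right_mono) (auto intro: less_imp_le of_nat_less_two_power)
  finally show ?thesis by (simp add: power_mult_distrib mult_ac)
qed

lemma summable_on_product_bound:
  fixes h :: "nat \<Rightarrow> nat \<Rightarrow> complex" and A B :: "nat \<Rightarrow> real"
  assumes h: "\<And>x y. norm (h x y) \<le> A x * B y" and A: "summable A" "\<And>x. 0 \<le> A x" and B: "summable B" "\<And>x. 0 \<le> B x"
  shows "(\<lambda>(x, y). norm (h x y)) summable_on (S \<times> T)"
proof -
  have "(\<lambda>(x, y). A x * B y) summable_on (UNIV \<times> UNIV)"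
  proof (rule summable_on_SigmaI)
    show "((\<lambda>y. case (x, y) of (x, y) \<Rightarrow> A x * B y) has_sum A x * suminf B) UNIV" for x
      using has_sum_cmult_right[OF sums_nonneg_imp_has_sum[OF summable_sums[OF B(1)] B(2)], of "A x"] by simp
    show "(\<lambda>x. A x * suminf B) summable_on UNIV"
      using A B by (intro summable_nonneg_imp_summable_on summable_mult2) (auto intro!: mult_nonneg_nonneg suminf_nonneg)
  qed (use A B in auto)
  then have "(\<lambda>(x, y). norm (h x y)) summable_on (UNIV \<times> UNIV)"
    by (rule summable_on_comparison_test) (use h in auto)
  then show ?thesis by (rule summable_on_subset_banach) auto
qed

lemma G2_alpha_lim:
  assumes z: "K\<^sub>1 < cmod z" and w: "K\<^sub>1 < cmod w"
  shows "(\<lambda>(m, n). norm (G2_term alpha_lim z w m n)) summable_on ({1..} \<times> {1..})"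
    and "G2 alpha_lim z w = G2_value z w"
proof -
  have zw: "cmod z > 0" "cmod w > 0" using z w K1_ge by linarith+
  have \<kappa>\<rho>: "0 \<le> \<kappa>" "0 \<le> \<rho>" "0 \<le> dd" using kappa_ge rho_ge dd_ge by linarith+
  define h where "h m n = G2_term alpha_lim z w m n" for m n
  have h_eq: "h m n = alpha_lim m n * (1 / z) ^ Suc m * (1 / w) ^ Suc n" for m n
    by (simp add: h_def G2_term_def power_one_over divide_simps)
  define A where "A m = dd\<^sup>2 / cmod z * (dd * \<rho> / cmod z) ^ m" for m
  define E where "E n = 1 / cmod w * (2 * dd * \<kappa> / cmod w) ^ n" for n
  have A: "summable A" "\<And>m. 0 \<le> A m"
    using z zw K1_ge \<kappa>\<rho>
    by (auto simp: A_def[abs_def] intro!: summable_mult summable_geometric mult_nonneg_nonneg divide_nonneg_nonneg zero_le_power)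
  have E: "summable E" "\<And>n. 0 \<le> E n"
    using w zw K1_ge \<kappa>\<rho>
    by (auto simp: E_def[abs_def] intro!: summable_mult summable_geometric mult_nonneg_nonneg divide_nonneg_nonneg zero_le_power)
  have bound: "norm (h m n) \<le> A m * E n" for m n
  proof -
    have "norm (h m n) = norm (alpha_lim m n) * ((1 / cmod z) ^ Suc m * (1 / cmod w) ^ Suc n)"
      by (simp add: h_eq norm_mult norm_power norm_divide)
    also have "\<dots> \<le> dd\<^sup>2 * (dd * \<rho>) ^ m * (2 * dd * \<kappa>) ^ n * ((1 / cmod z) ^ Suc m * (1 / cmod w) ^ Suc n)"
      by (intro mult_right_mono norm_alpha_lim) auto
    also have "\<dots> = A m * E n" by (simp add: A_def E_def power_divide)
    finally show ?thesis .
  qed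
  have bound': "norm (h m n) \<le> E n * A m" for m n using bound[of m n] by (simp add: mult.commute)
  \<comment> \<open>Together with \<open>t 0 = 0\<close> this allows the sums over positive indices
    to be extended to all naturals, where the ordinary series start.\<close>
  have h0: "h 0 n = 0" for n by (simp add: h_eq alpha_lim_def cov_paths_0)
  show s1: "(\<lambda>(m, n). norm (G2_term alpha_lim z w m n)) summable_on ({1..} \<times> {1..})"
    unfolding h_def[symmetric] by (rule summable_on_product_bound[OF bound A E])
  have s2: "(\<lambda>(m, n). h m n) summable_on ({1..} \<times> {1..})"
    by (rule abs_summable_summable) (use s1 in \<open>simp add: h_def case_prod_unfold\<close>)
  have "(\<lambda>(n, m). norm (h m n)) summable_on (UNIV \<times> UNIV)"
    by (rule summable_on_product_bound[where h = "\<lambda>n m. h m n", OF bound' E A])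
  then have s3: "(\<lambda>(n, m). h m n) summable_on (UNIV \<times> UNIV)"
    by - (rule abs_summable_summable, simp add: case_prod_unfold)
  define t where "t n = (\<Sum>p\<in>UNIV. Chat n z p p) * (1 / w) ^ Suc n" for n
  have inner: "infsum (\<lambda>m. h m n) {1..} = t n" "infsum (\<lambda>m. h m n) UNIV = t n" for n
  proof -
    have "(\<lambda>m. h m n) sums t n"
      unfolding h_eq t_def by (intro sums_mult2 alpha_lim_sums z)
    moreover have "summable (\<lambda>m. norm (h m n))"
      by (rule summable_comparison_test[OF _ summable_mult2[OF A(1), of "E n"]]) (use bound in auto)
    ultimately have "((\<lambda>m. h m n) has_sum t n) UNIV" by (intro norm_summable_imp_has_sum)
    then show U: "infsum (\<lambda>m. h m n) UNIV = t n" by (rule infsumI)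
    have "infsum (\<lambda>m. h m n) {1..} = infsum (\<lambda>m. h m n) UNIV"
      by (rule infsum_cong_neutral) (auto simp: h0 not_le)
    then show "infsum (\<lambda>m. h m n) {1..} = t n" using U by simp
  qed
  have t0: "t 0 = 0" by (simp add: t_def trace_Chat[OF z] source_def)
  have "t summable_on UNIV"
    using summable_on_Sigma_banach[OF s3] by (simp add: inner)
  then have "(t has_sum infsum t UNIV) UNIV" by (rule has_sum_infsum)
  then have "t sums infsum t UNIV" by (rule has_sum_imp_sums)
  moreover have "t sums G2_value z w" unfolding t_def by (rule trace_Chat_sums[OF z w])
  ultimately have t: "infsum t UNIV = G2_value z w" by (rule sums_unique2)
  \<comment> \<open>\<open>G2\<close> has the sum over \<open>n\<close> inside, whereas the closed
    form is known after summing over \<open>m\<close> first; absolute summability permits the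
    exchange.\<close>
  have "G2 alpha_lim z w = infsum (\<lambda>n. infsum (\<lambda>m. h m n) {1..}) {1..}"
    unfolding G2_def h_def[symmetric] by (rule infsum_swap_banach[OF s2])
  also have "\<dots> = infsum t {1..}" by (simp only: inner)
  also have "\<dots> = infsum t UNIV" by (rule infsum_cong_neutral) (auto simp: t0 not_le)
  finally show "G2 alpha_lim z w = G2_value z w" by (simp add: t)
qed

subsection \<open>Identification with the trace\<close>

definition Bp :: "complex \<Rightarrow> complex \<Rightarrow> 'd matrix2" where
  "Bp z w = matrix4 (\<lambda>p q u s. \<psi> (R z $ p $ q * (R w ** R w) $ s $ u))"

lemma Bp_nth: "Bp z w $ (p, u) $ (q, s) = \<psi> (R z $ p $ q * (R w ** R w) $ s $ u)"
  by (simp add: Bp_def matrix4_def)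

text \<open>\<open>Bp\<close> is minus the derivative of \<open>B\<close> in its second variable, so differentiating the linear
  system of \<open>B\<close> yields one for \<open>Bp\<close>.\<close>

lemma B_derivative:
  assumes "w \<in> slit"
  shows "((\<lambda>w. B z w $ i $ j) has_field_derivative - (Bp z w $ i $ j)) (at w)"
proof -
  obtain p u q s where ij: "i = (p, u)" "j = (q, s)" by (cases i, cases j) auto
  show ?thesis
    unfolding ij B_nth Bp_nth by (rule functional_R_derivative[OF functional_mult_left[OF fun_psi] assms])
qed

lemma kron_G_derivative:
  assumes "w \<in> slit"
  shows "((\<lambda>w. kron (G z) (G w) $ i $ j) has_field_derivative - (kron (G z) (P w) $ i $ j)) (at w)"
proof -
  obtain p u q s where ij: "i = (p, u)" "j = (q, s)" by (cases i, cases j) auto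
  show ?thesis
    unfolding ij kron_nth using DERIV_cmult[OF G_derivative[OF assms], of "G z $ p $ q"] by simp
qed

lemma Bp_equation:
  assumes "z \<in> slit" "w \<in> slit"
  shows "Bp z w = kron (G z) (P w) + kron (G z) (P w) ** (Sigma_mat \<sigma> ** B z w) +
    kron (G z) (G w) ** (Sigma_mat \<sigma> ** Bp z w)"
proof -
  let ?S = "Sigma_mat \<sigma>"
  have "Bp z w $ i $ j = (kron (G z) (P w) + kron (G z) (P w) ** (?S ** B z w) + kron (G z) (G w) ** (?S ** Bp z w)) $ i $ j" for i j
  proof -
    have SB: "((\<lambda>w. (?S ** B z w) $ a $ j) has_field_derivative - ((?S ** Bp z w) $ a $ j)) (at w)" for a
    proof -
      have "((\<lambda>w. \<Sum>c\<in>UNIV. ?S $ a $ c * B z w $ c $ j) has_field_derivative (\<Sum>c\<in>UNIV. ?S $ a $ c * - (Bp z w $ c $ j))) (at w)"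
        by (intro DERIV_sum DERIV_cmult B_derivative assms)
      then show ?thesis by (simp add: matrix_mult_nth sum_negf)
    qed
    have "((\<lambda>w. kron (G z) (G w) $ i $ j + (\<Sum>a\<in>UNIV. kron (G z) (G w) $ i $ a * (?S ** B z w) $ a $ j)) has_field_derivative
      - (kron (G z) (P w) $ i $ j) + (\<Sum>a\<in>UNIV. - (kron (G z) (P w) $ i $ a) * (?S ** B z w) $ a $ j +
        - ((?S ** Bp z w) $ a $ j) * kron (G z) (G w) $ i $ a)) (at w)"
      by (intro DERIV_add DERIV_sum DERIV_mult kron_G_derivative SB assms)
    then have "((\<lambda>w. B z w $ i $ j) has_field_derivative
      - (kron (G z) (P w) $ i $ j) + (\<Sum>a\<in>UNIV. - (kron (G z) (P w) $ i $ a) * (?S ** B z w) $ a $ j +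
        - ((?S ** Bp z w) $ a $ j) * kron (G z) (G w) $ i $ a)) (at w)"
    proof (rule has_field_derivative_transform_within_open[OF _ open_slit_plane assms(2)])
      fix w' assume w': "w' \<in> slit"
      show "kron (G z) (G w') $ i $ j + (\<Sum>a\<in>UNIV. kron (G z) (G w') $ i $ a * (?S ** B z w') $ a $ j) = B z w' $ i $ j"
        by (subst (2) B_equation[OF assms(1) w']) (simp add: matrix_mult_nth[of "kron (G z) (G w')"])
    qed
    from DERIV_unique[OF this B_derivative[OF assms(2)]]
    have "- (Bp z w $ i $ j) = - (kron (G z) (P w) $ i $ j) + (\<Sum>a\<in>UNIV. - (kron (G z) (P w) $ i $ a) * (?S ** B z w) $ a $ j +
        - ((?S ** Bp z w) $ a $ j) * kron (G z) (G w) $ i $ a)" by simp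
    also have "\<dots> = - ((kron (G z) (P w) + kron (G z) (P w) ** (?S ** B z w) + kron (G z) (G w) ** (?S ** Bp z w)) $ i $ j)"
      by (simp add: matrix_mult_nth[of "kron (G z) _"] sum.distrib sum_negf sum_subtractf mult.commute)
    finally show ?thesis by (simp only: neg_equal_iff_equal)
  qed
  then show ?thesis by (simp add: vec_eq_iff)
qed

text \<open>The inhomogeneity of the system for \<open>Bp\<close> is
  \<open>Q = K' + K' \<Sigma> B\<close>. Since \<open>H\<close> is the inverse of
  \<open>1 - \<Sigma> K\<close> times \<open>\<Sigma>\<close>, it solves the system as
  \<open>H Q = \<Sigma> Bp\<close>, and \<open>\<Sigma> B = H K\<close> turns \<open>Q\<close> into
  an expression in \<open>H\<close>.\<close>

lemma Sigma_Bp: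
  assumes "z \<in> slit" "w \<in> slit"
  defines "H \<equiv> calH (Sigma_mat \<sigma>) G z w"
  shows "Sigma_mat \<sigma> ** Bp z w = H ** kron (G z) (P w) + H ** (kron (G z) (P w) ** (H ** kron (G z) (G w)))"
proof -
  let ?S = "Sigma_mat \<sigma>" and ?K = "kron (G z) (G w)" and ?K' = "kron (G z) (P w)" and ?B = "B z w" and ?Bp = "Bp z w"
  have H: "H = (mat 1 + ?S ** ?B) ** ?S" unfolding H_def by (rule calH_eq[OF assms(1,2)])
  have KS: "?K + ?B ** (?S ** ?K) = ?B" using B_equation'[OF assms(1,2)] by simp
  have SB: "?S ** ?B = H ** ?K"
  proof -
    have "H ** ?K = ?S ** (?K + ?B ** (?S ** ?K))"
      unfolding H by (simp add: matrix_add_rdistrib' matrix_add_ldistrib' matrix_mul_assoc)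
    then show ?thesis by (simp only: KS)
  qed
  define Q where "Q = ?K' + ?K' ** (?S ** ?B)"
  have "?Bp = Q + ?K ** (?S ** ?Bp)" unfolding Q_def by (rule Bp_equation[OF assms(1,2)])
  then have Q: "Q = ?Bp - ?K ** (?S ** ?Bp)" by (simp add: eq_diff_eq)
  have "H ** Q = (?S + ?S ** (?B ** ?S)) ** (?Bp - ?K ** (?S ** ?Bp))"
    unfolding Q H by (simp add: matrix_add_rdistrib' matrix_mul_assoc)
  also have "\<dots> = ?S ** ?Bp + ?S ** (?B ** (?S ** ?Bp)) - ?S ** ((?K + ?B ** (?S ** ?K)) ** (?S ** ?Bp))"
    by (simp add: matrix_add_rdistrib' matrix_add_ldistrib' matrix_diff_ldistrib matrix_mul_assoc)
  also have "\<dots> = ?S ** ?Bp" unfolding KS by simp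
  finally show ?thesis by (simp add: Q_def SB matrix_add_ldistrib')
qed

text \<open>\<open>Linv z\<close> cancels the factor \<open>G z\<close> in the first tensor
  component and leaves the second untouched.\<close>

lemma kron_G_contract:
  assumes "z \<in> slit"
  shows "(\<Sum>q\<in>UNIV. (A ** kron (G z) C) $ i $ (q, s) * Linv z $ q $ b) = (\<Sum>y\<in>UNIV. A $ i $ (b, y) * C $ y $ s)"
proof -
  have "(\<Sum>q\<in>UNIV. (A ** kron (G z) C) $ i $ (q, s) * Linv z $ q $ b) =
    (\<Sum>q\<in>UNIV. \<Sum>x\<in>UNIV. \<Sum>y\<in>UNIV. A $ i $ (x, y) * C $ y $ s * (G z $ x $ q * Linv z $ q $ b))"
    by (simp add: matrix_mult_nth sum_UNIV_pair kron_nth sum_distrib_left sum_distrib_right mult_ac)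
  also have "\<dots> = (\<Sum>x\<in>UNIV. \<Sum>y\<in>UNIV. \<Sum>q\<in>UNIV. A $ i $ (x, y) * C $ y $ s * (G z $ x $ q * Linv z $ q $ b))"
    by (subst sum.swap, rule sum.cong[OF refl], rule sum.swap)
  also have "\<dots> = (\<Sum>x\<in>UNIV. \<Sum>y\<in>UNIV. A $ i $ (x, y) * C $ y $ s * (G z ** Linv z) $ x $ b)"
    by (simp add: matrix_mult_nth[of "G z"] sum_distrib_left)
  also have "\<dots> = (\<Sum>x\<in>UNIV. if x = b then \<Sum>y\<in>UNIV. A $ i $ (b, y) * C $ y $ s else 0)"
    unfolding Linv_G[OF assms] by (intro sum.cong refl) (simp add: mat_nth)
  finally show ?thesis by simp
qed

text \<open>The two sums on the right are the origin of the two summands in the final formula, the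
  one with \<open>Theta\<close> and the one with \<open>Phi\<close>.\<close>

lemma source2_Linv:
  assumes "z \<in> slit" "w \<in> slit"
  defines "H \<equiv> calH (Sigma_mat \<sigma>) G z w"
  shows "(\<Sum>s\<in>UNIV. source2 z w a s * Linv z $ s $ b) =
    (\<Sum>t\<in>UNIV. \<Sum>y\<in>UNIV. H $ (a, t) $ (b, y) * P w $ y $ t) +
    (\<Sum>t\<in>UNIV. \<Sum>y\<in>UNIV. (H ** (kron (G z) (P w) ** H)) $ (a, t) $ (b, y) * G w $ y $ t)"
proof -
  have "source2 z w a s = (\<Sum>t\<in>UNIV. (Sigma_mat \<sigma> ** Bp z w) $ (a, t) $ (s, t))" for s
  proof -
    have "source2 z w a s = (\<Sum>t\<in>UNIV. \<Sum>k\<in>UNIV. \<Sum>r\<in>UNIV. cv (a, k) (r, t) * \<psi> (R z $ k $ s * (R w ** R w) $ t $ r))"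
      unfolding source2_def by (rule trans[OF sum.cong[OF refl sum.swap] sum.swap])
    then show ?thesis by (simp add: matrix_mult_nth[of "Sigma_mat \<sigma>"] sum_UNIV_pair Sigma_nth Bp_nth)
  qed
  then have "(\<Sum>s\<in>UNIV. source2 z w a s * Linv z $ s $ b) =
    (\<Sum>t\<in>UNIV. \<Sum>s\<in>UNIV. (Sigma_mat \<sigma> ** Bp z w) $ (a, t) $ (s, t) * Linv z $ s $ b)"
    by (simp add: sum_distrib_right) (rule sum.swap)
  also have "\<dots> = (\<Sum>t\<in>UNIV. (\<Sum>s\<in>UNIV. (H ** kron (G z) (P w)) $ (a, t) $ (s, t) * Linv z $ s $ b) +
      (\<Sum>s\<in>UNIV. ((H ** (kron (G z) (P w) ** H)) ** kron (G z) (G w)) $ (a, t) $ (s, t) * Linv z $ s $ b))"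
    unfolding Sigma_Bp[OF assms(1,2)] H_def[symmetric]
    by (simp add: distrib_right sum.distrib matrix_mul_assoc)
  also have "\<dots> = (\<Sum>t\<in>UNIV. \<Sum>y\<in>UNIV. H $ (a, t) $ (b, y) * P w $ y $ t) +
    (\<Sum>t\<in>UNIV. \<Sum>y\<in>UNIV. (H ** (kron (G z) (P w) ** H)) $ (a, t) $ (b, y) * G w $ y $ t)"
    unfolding kron_G_contract[OF assms(1)] sum.distrib ..
  finally show ?thesis .
qed

lemma sum_six:
  fixes F :: "'d \<Rightarrow> 'd \<Rightarrow> 'd \<Rightarrow> 'd \<Rightarrow> 'd \<Rightarrow> 'd \<Rightarrow> complex"
  shows "(\<Sum>t\<in>UNIV. \<Sum>y\<in>UNIV. \<Sum>x\<in>UNIV. \<Sum>s\<in>UNIV. \<Sum>x'\<in>UNIV. \<Sum>u\<in>UNIV. F t y x s x' u) =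
    (\<Sum>u\<in>UNIV. \<Sum>s\<in>UNIV. \<Sum>x'\<in>UNIV. \<Sum>y\<in>UNIV. \<Sum>x\<in>UNIV. \<Sum>t\<in>UNIV. F t y x s x' u)"
proof -
  have "(\<Sum>t\<in>UNIV. \<Sum>y\<in>UNIV. \<Sum>x\<in>UNIV. \<Sum>s\<in>UNIV. \<Sum>x'\<in>UNIV. \<Sum>u\<in>UNIV. F t y x s x' u) =
    (\<Sum>(t, y, x, s, x', u)\<in>UNIV. F t y x s x' u)"
    by (simp add: sum_UNIV_pair)
  also have "\<dots> = (\<Sum>(u, s, x', y, x, t)\<in>UNIV. F t y x s x' u)"
    by (rule sum.reindex_bij_witness[of _ "\<lambda>(u, s, x', y, x, t). (t, y, x, s, x', u)" "\<lambda>(t, y, x, s, x', u). (u, s, x', y, x, t)"]) auto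
  also have "\<dots> = (\<Sum>u\<in>UNIV. \<Sum>s\<in>UNIV. \<Sum>x'\<in>UNIV. \<Sum>y\<in>UNIV. \<Sum>x\<in>UNIV. \<Sum>t\<in>UNIV. F t y x s x' u)"
    by (simp add: sum_UNIV_pair)
  finally show ?thesis .
qed

lemma Theta_nth: "Theta A $ (p, r) $ (q, s) = A $ (p, q) $ (r, s)"
  by (simp add: Theta_def matrix4_def entry4_def)

lemma Gamma_tr_nth: "Gamma_tr A $ (p, r) $ (q, s) = A $ (p, s) $ (q, r)"
  by (simp add: Gamma_tr_def matrix4_def entry4_def)

text \<open>Under \<open>Theta\<close> the diagonal entries become those in row
  \<open>(p, p)\<close> and column \<open>(r, r)\<close>. The sums over \<open>p\<close> and
  \<open>r\<close> then act on the outer factors separately and turn both into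
  \<open>P\<close>.\<close>

lemma trace_Theta_sandwich:
  assumes "z \<in> slit" "w \<in> slit"
  shows "trace (Theta (B z z ** A ** transpose (B w w))) =
    (\<Sum>a\<in>UNIV. \<Sum>b\<in>UNIV. P z $ a $ b * (\<Sum>c\<in>UNIV. \<Sum>e\<in>UNIV. A $ (a, b) $ (c, e) * P w $ c $ e))"
proof -
  have "trace (Theta (B z z ** A ** transpose (B w w))) =
    (\<Sum>p\<in>UNIV. \<Sum>r\<in>UNIV. \<Sum>i\<in>UNIV. \<Sum>j\<in>UNIV. B z z $ (p, p) $ i * (A $ i $ j * B w w $ (r, r) $ j))"
    by (simp add: trace_def sum_UNIV_pair[of "\<lambda>i. Theta _ $ i $ i"] Theta_nth matrix_mul_assoc[symmetric]
        matrix_mult_nth transpose_def sum_distrib_left)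
  also have "\<dots> = (\<Sum>p\<in>UNIV. \<Sum>i\<in>UNIV. \<Sum>r\<in>UNIV. \<Sum>j\<in>UNIV. B z z $ (p, p) $ i * (A $ i $ j * B w w $ (r, r) $ j))"
    by (rule sum.cong[OF refl], rule sum.swap)
  also have "\<dots> = (\<Sum>p\<in>UNIV. \<Sum>i\<in>UNIV. \<Sum>j\<in>UNIV. \<Sum>r\<in>UNIV. B z z $ (p, p) $ i * (A $ i $ j * B w w $ (r, r) $ j))"
    by (intro sum.cong refl, rule sum.swap)
  also have "\<dots> = (\<Sum>i\<in>UNIV. \<Sum>p\<in>UNIV. B z z $ (p, p) $ i * (\<Sum>j\<in>UNIV. A $ i $ j * (\<Sum>r\<in>UNIV. B w w $ (r, r) $ j)))"
    by (subst sum.swap) (simp add: sum_distrib_left)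
  finally show ?thesis
    unfolding sum_distrib_right[symmetric]
    by (simp add: sum_UNIV_pair sum_B_diagonal[OF assms(1)] sum_B_diagonal[OF assms(2)])
qed

text \<open>What is left is an index rearrangement of the sandwiched term. Partial transposition
  reverses the direction of the second tensor component.\<close>

lemma G2_value_eq_trace:
  assumes "z \<in> slit" "w \<in> slit"
  shows "G2_value z w = trace (calG2 (Sigma_mat \<sigma>) G z w)"
proof -
  define H where "H = calH (Sigma_mat \<sigma>) G z w"
  let ?Q = "Gamma_tr H ** Gamma_tr (kron (G z) (G w)) ** Gamma_tr H"
  \<comment> \<open>The matrices \<open>P w\<close> and \<open>G w\<close> exchange places:
    \<open>P w\<close>, standing between the two factors \<open>H\<close>, moves outside, and
    \<open>G w\<close> takes the middle position with its indices reversed.\<close>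
  have second: "(\<Sum>t\<in>UNIV. \<Sum>y\<in>UNIV. (H ** (kron (G z) (P w) ** H)) $ (a, t) $ (b, y) * G w $ y $ t) =
    (\<Sum>c\<in>UNIV. \<Sum>e\<in>UNIV. ?Q $ (a, e) $ (b, c) * P w $ c $ e)" for a b
  proof -
    have "(\<Sum>t\<in>UNIV. \<Sum>y\<in>UNIV. (H ** (kron (G z) (P w) ** H)) $ (a, t) $ (b, y) * G w $ y $ t) =
      (\<Sum>t\<in>UNIV. \<Sum>y\<in>UNIV. \<Sum>x\<in>UNIV. \<Sum>s\<in>UNIV. \<Sum>x'\<in>UNIV. \<Sum>u\<in>UNIV.
        H $ (a, t) $ (x, s) * (G z $ x $ x' * P w $ s $ u * H $ (x', u) $ (b, y)) * G w $ y $ t)"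
      by (simp add: matrix_mult_nth sum_UNIV_pair kron_nth sum_distrib_left sum_distrib_right)
    also have "\<dots> = (\<Sum>u\<in>UNIV. \<Sum>s\<in>UNIV. \<Sum>x'\<in>UNIV. \<Sum>y\<in>UNIV. \<Sum>x\<in>UNIV. \<Sum>t\<in>UNIV.
        H $ (a, t) $ (x, s) * (G z $ x $ x' * P w $ s $ u * H $ (x', u) $ (b, y)) * G w $ y $ t)"
      by (rule sum_six)
    also have "\<dots> = (\<Sum>c\<in>UNIV. \<Sum>e\<in>UNIV. \<Sum>x'\<in>UNIV. \<Sum>y'\<in>UNIV. \<Sum>x\<in>UNIV. \<Sum>y\<in>UNIV.
        H $ (a, y) $ (x, e) * (G z $ x $ x' * G w $ y' $ y) * H $ (x', c) $ (b, y') * P w $ c $ e)"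
      by (intro sum.cong refl) (simp add: P_sym[OF assms(2)] mult_ac)
    also have "\<dots> = (\<Sum>c\<in>UNIV. \<Sum>e\<in>UNIV. ?Q $ (a, e) $ (b, c) * P w $ c $ e)"
      by (simp add: matrix_mult_nth sum_UNIV_pair Gamma_tr_nth kron_nth sum_distrib_right)
    finally show ?thesis .
  qed
  have first: "(\<Sum>t\<in>UNIV. \<Sum>y\<in>UNIV. H $ (a, t) $ (b, y) * P w $ y $ t) =
    (\<Sum>c\<in>UNIV. \<Sum>e\<in>UNIV. H $ (a, c) $ (b, e) * P w $ c $ e)" for a b
    by (intro sum.cong refl) (simp add: P_sym[OF assms(2)])
  have "trace (calG2 (Sigma_mat \<sigma>) G z w) = (\<Sum>a\<in>UNIV. \<Sum>b\<in>UNIV. P z $ a $ b *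
      (\<Sum>c\<in>UNIV. \<Sum>e\<in>UNIV. (Theta H + Phi ?Q) $ (a, b) $ (c, e) * P w $ c $ e))"
    unfolding calG2_def calGD_eq[OF assms(1,1)] calGD_eq[OF assms(2,2)] H_def
    by (rule trace_Theta_sandwich[OF assms])
  also have "\<dots> = G2_value z w"
    unfolding G2_value_def source2_Linv[OF assms] H_def[symmetric] first second
    by (simp add: Phi_def Theta_nth Gamma_tr_nth distrib_right sum.distrib)
  finally show ?thesis ..
qed

end

section \<open>Joining the random matrix limit with the semicircular family\<close>

lemma slit_plane_antimono: "K \<le> K' \<Longrightarrow> slit_plane K' \<subseteq> slit_plane K"
  unfolding slit_plane_def by (intro Compl_anti_mono image_mono) auto

lemma analytic2_on_subset: "analytic2_on F U \<Longrightarrow> open V \<Longrightarrow> V \<subseteq> U \<Longrightarrow> analytic2_on F V"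
  unfolding analytic2_on_def by blast

theorem theorem2:
  fixes \<sigma> :: "'d::finite covariance"
    and M :: "nat \<Rightarrow> 'a measure"
    and X :: "nat \<Rightarrow> 'a \<Rightarrow> 'd block_matrix"
    and \<psi> :: "'b::cstar_algebra \<Rightarrow> complex"
    and Y :: "'b^'d^'d"
  assumes block: "\<And>N. 1 \<le> N \<Longrightarrow> block_gaussian \<sigma> N (M N) (X N)"
    and state: "tracial_state \<psi>"
    and semicircular: "semicircular_family \<sigma> \<psi> Y"
  shows "(\<forall>m\<ge>1. \<forall>n\<ge>1. convergent (trace_cov M X m n)) \<and>
    (\<exists>K\<ge>0.
      (\<forall>z w. K < cmod z \<longrightarrow> K < cmod w \<longrightarrow>
         (\<lambda>(m, n). norm (G2_term (alpha M X) z w m n)) summable_on ({1..} \<times> {1..}) \<and>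
         G2 (alpha M X) z w = trace (calG2 (Sigma_mat \<sigma>) (cauchy_transform \<psi> Y) z w)) \<and>
      (\<forall>z\<in>slit_plane K. invertible (resolvent_arg Y z)) \<and>
      (\<forall>z\<in>slit_plane K. \<forall>w\<in>slit_plane K.
         invertible (H_arg (Sigma_mat \<sigma>) (cauchy_transform \<psi> Y) z w)) \<and>
      analytic2_on (calG2 (Sigma_mat \<sigma>) (cauchy_transform \<psi> Y)) (slit_plane K \<times> slit_plane K))"
proof (rule trace_cov_limit[OF block])
  fix \<gamma> :: "('d \<times> 'd) list \<Rightarrow> ('d \<times> 'd) list \<Rightarrow> complex"
  assume \<gamma>: "\<And>u. \<gamma> [] u = 0"
      "\<And>e w u. \<gamma> (e # w) u =
        split_sum (\<lambda>a g b. cov_letters \<sigma> e g * (tau (cov_letters \<sigma>) b * \<gamma> a u + tau (cov_letters \<sigma>) a * \<gamma> b u)) w +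
        split_sum (\<lambda>a g b. cov_letters \<sigma> e g * tau (cov_letters \<sigma>) (w @ b @ a)) u"
    and lim: "\<And>m n. trace_cov M X m n \<longlonglongrightarrow> (\<Sum>p\<in>UNIV. \<Sum>w\<in>paths m p p. \<Sum>q\<in>UNIV. \<Sum>u\<in>paths n q q. \<gamma> w u)"
  \<comment> \<open>The limit function of the random model is combined here with the semicircular
    family; the covariance \<open>\<sigma>\<close> is their only link.\<close>
  interpret second_order \<sigma> \<psi> Y \<gamma>
    by unfold_locales (fact state semicircular \<gamma>)+
  have lim': "trace_cov M X m n \<longlonglongrightarrow> alpha_lim m n" for m n
    using lim[of m n] by (simp add: alpha_lim_def cov_paths_def)
  have alpha: "alpha M X = alpha_lim"
    by (intro ext) (simp add: alpha_def limI[OF lim'])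
  \<comment> \<open>Invertibility and analyticity hold already on the larger slit plane of
    \<open>K\<^sub>0\<close> and are restricted to get a single constant.\<close>
  have sub: "slit_plane K\<^sub>1 \<subseteq> slit" using K1_ge by (intro slit_plane_antimono)
  show ?thesis
  proof (intro conjI exI[of _ "K\<^sub>1"] allI impI ballI)
    show "convergent (trace_cov M X m n)" for m n using lim' by (rule convergentI)
    show "0 \<le> K\<^sub>1" using K1_ge by simp
    show "(\<lambda>(m, n). norm (G2_term (alpha M X) z w m n)) summable_on ({1..} \<times> {1..})"
      if "K\<^sub>1 < cmod z" "K\<^sub>1 < cmod w" for z w
      unfolding alpha using that by (rule G2_alpha_lim)
    show "G2 (alpha M X) z w = trace (calG2 (Sigma_mat \<sigma>) G z w)"
      if "K\<^sub>1 < cmod z" "K\<^sub>1 < cmod w" for z w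
      unfolding alpha G2_alpha_lim(2)[OF that] using that by (intro G2_value_eq_trace slit_large)
    show "invertible (resolvent_arg Y z)" if "z \<in> slit_plane K\<^sub>1" for z
      using that sub by (intro inv_slit) auto
    show "invertible (H_arg (Sigma_mat \<sigma>) G z w)" if "z \<in> slit_plane K\<^sub>1" "w \<in> slit_plane K\<^sub>1" for z w
      using that sub by (intro H_arg_invertible) auto
    show "analytic2_on (calG2 (Sigma_mat \<sigma>) G) (slit_plane K\<^sub>1 \<times> slit_plane K\<^sub>1)"
      using sub by (intro analytic2_on_subset[OF calG2_analytic] open_Times open_slit_plane) auto
  qed
qed

end
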